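(* Let $K$ be a field, $A=KQ/I$ a finite-dimensional $K$-algebra given by a finite quiver $Q$ and an admissible ideal $I$, and let $k$ be a vertex of $Q$ without loops. Assume that $S_k$ is not a submodule of the radical of $P_k$. If $T^-_k$ is a tilting complex, then the BB-tilting module is defined at $k$ and $T^-_k\simeq T^{\mathrm{BB}}_k$ in $\mathcal{D}^b(A)$.
   Context: For an arrow $\alpha$ of $Q$, $s(\alpha)$ and $t(\alpha)$ denote its start and end vertices; paths compose left to right, i.e. $\alpha\beta$ is defined if $t(\alpha)=s(\beta)$. Modules are finite-dimensional right $A$-modules, and $\mathcal{D}^b(A)$ is the bounded derived category of $\operatorname{mod} A$. For a vertex $i$, $S_i$ is the simple module at $i$ and $P_i$ its projective cover, spanned by the (non-zero) paths starting at $i$. An arrow $\alpha$ induces a map $P_{t(\alpha)}\xrightarrow{\alpha}P_{s(\alpha)}$ (left multiplication by $\alpha$). $\tau$ is the Auslander-Reiten translation in $\operatorname{mod}A$. $L_k$ is the two-term complex $P_k\xrightarrow{f}\bigoplus_{\alpha:\,t(\alpha)=k}P_{s(\alpha)}$ with $P_k$ in degree $-1$, where $f$ is induced by all arrows $\alpha$ ending at $k$; and $T^-_k=L_k\oplus\bigoplus_{i\neq k}P_i$. The BB-tilting module is said to be defined at $k$ if $T^{\mathrm{BB}}_k=\tau^{-1}S_k\oplus\bigoplus_{i\neq k}P_i$ is a tilting module of projective dimension at most $1$. A tilting complex is a bounded complex $T$ of finitely generated projective modules with $\operatorname{Hom}_{\mathcal{D}^b(A)}(T,T[r])=0$ for all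 $r\neq 0$ whose direct summands generate the category $\operatorname{per}A$ of perfect complexes as a triangulated category.
   Formalization: The formal statement additionally assumes that some arrow of Q starts or ends at k; for an isolated vertex k the claim fails (e.g. A = K: T^-_k = K[1] is a tilting complex, but τ^{-1}S_k = 0, so T^BB_k = 0 is not tilting). *)

theory Defs
  imports
    "HOL-Algebra.QuotRing"
    "HOL-Algebra.Module"
    "Graph_Theory.Arc_Walk"
begin

section \<open>Bound quiver algebras\<close>

text \<open>
  A finite quiver is a finite directed multigraph (\<^locale>\<open>fin_digraph\<close>); \<^const>\<open>tail\<close> is the start
  $s$ and \<^const>\<open>head\<close> the end $t$ of an arrow.  A path is a triple (start, arrows, end), read from
  left to right; the trivial path at a vertex is included.
\<close>

type_synonym ('v, 'e) qpath = "'v \<times> 'e list \<times> 'v"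

definition paths :: "('v, 'e) pre_digraph \<Rightarrow> ('v, 'e) qpath set" where
  "paths Q = {(u, es, v). pre_digraph.awalk Q u es v}"

definition path_start :: "('v, 'e) qpath \<Rightarrow> 'v" where
  "path_start p = fst p"

definition path_arrows :: "('v, 'e) qpath \<Rightarrow> 'e list" where
  "path_arrows p = fst (snd p)"

definition path_end :: "('v, 'e) qpath \<Rightarrow> 'v" where
  "path_end p = snd (snd p)"

definition path_comp :: "('v, 'e) qpath \<Rightarrow> ('v, 'e) qpath \<Rightarrow> ('v, 'e) qpath" where
  "path_comp p q = (path_start p, path_arrows p @ path_arrows q, path_end q)"

definition vertex_path :: "'v \<Rightarrow> ('v, 'e) qpath" where
  "vertex_path i = (i, [], i)"

definition arrow_path :: "('v, 'e) pre_digraph \<Rightarrow> 'e \<Rightarrow> ('v, 'e) qpath" where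
  "arrow_path Q \<alpha> = (tail Q \<alpha>, [\<alpha>], head Q \<alpha>)"

definition path_factorizations ::
    "('v, 'e) pre_digraph \<Rightarrow> ('v, 'e) qpath \<Rightarrow> (('v, 'e) qpath \<times> ('v, 'e) qpath) set" where
  "path_factorizations Q r =
    {(p, q). p \<in> paths Q \<and> q \<in> paths Q \<and> path_end p = path_start q \<and> path_comp p q = r}"

text \<open>
  A $K$-algebra is a record of the library type \<^typ>\<open>('k, 'a) module\<close>, whose \<^const>\<open>smult\<close> is the
  action of the scalars (the library locale for algebras is restricted to commutative ones).  The
  path algebra consists of the finitely supported functions on the paths.
\<close>

definition path_algebra ::
    "('v, 'e) pre_digraph \<Rightarrow> ('k::field, ('v, 'e) qpath \<Rightarrow> 'k) module" where
  "path_algebra Q =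
    \<lparr>carrier = {x. finite {p. x p \<noteq> 0} \<and> {p. x p \<noteq> 0} \<subseteq> paths Q},
     mult = (\<lambda>x y r. \<Sum>(p, q) \<in> path_factorizations Q r. x p * y q),
     one = (\<lambda>p. if p \<in> vertex_path ` verts Q then 1 else 0),
     zero = (\<lambda>p. 0),
     add = (\<lambda>x y p. x p + y p),
     smult = (\<lambda>c x p. c * x p)\<rparr>"

definition path_elt :: "('v, 'e) qpath \<Rightarrow> ('v, 'e) qpath \<Rightarrow> 'k::field" where
  "path_elt p = (\<lambda>q. if q = p then 1 else 0)"

text \<open>The $m$-th power of the arrow ideal is spanned by the paths of length at least $m$.\<close>

definition arrow_ideal_power ::
    "('v, 'e) pre_digraph \<Rightarrow> nat \<Rightarrow> (('v, 'e) qpath \<Rightarrow> 'k::field) set" where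
  "arrow_ideal_power Q m =
    {x \<in> carrier (path_algebra Q). \<forall>p. x p \<noteq> 0 \<longrightarrow> m \<le> length (path_arrows p)}"

definition admissible ::
    "('v, 'e) pre_digraph \<Rightarrow> (('v, 'e) qpath \<Rightarrow> 'k::field) set \<Rightarrow> bool" where
  "admissible Q I \<longleftrightarrow> ideal I (path_algebra Q) \<and>
    (\<exists>m\<ge>2. arrow_ideal_power Q m \<subseteq> I) \<and> I \<subseteq> arrow_ideal_power Q 2"

type_synonym ('k, 'v, 'e) bqelt = "(('v, 'e) qpath \<Rightarrow> 'k) set"

definition bound_quiver_algebra ::
    "('v, 'e) pre_digraph \<Rightarrow> (('v, 'e) qpath \<Rightarrow> 'k::field) set \<Rightarrow>
      ('k, ('k, 'v, 'e) bqelt) module" where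
  "bound_quiver_algebra Q I =
    ring.extend (path_algebra Q Quot I)
      (module.fields
        (\<lambda>c X. \<Union>x\<in>X. I +>\<^bsub>path_algebra Q\<^esub> (c \<odot>\<^bsub>path_algebra Q\<^esub> x)))"

definition path_class ::
    "('v, 'e) pre_digraph \<Rightarrow> (('v, 'e) qpath \<Rightarrow> 'k::field) set \<Rightarrow> ('v, 'e) qpath \<Rightarrow>
      ('k, 'v, 'e) bqelt" where
  "path_class Q I p = I +>\<^bsub>path_algebra Q\<^esub> path_elt p"

section \<open>Right modules\<close>

text \<open>
  Right modules over a ring use the same record; here \<open>a \<odot>\<^bsub>M\<^esub> x\<close> stands for $x \cdot a$.
  The ring fields \<^const>\<open>mult\<close> and \<^const>\<open>one\<close> of a module carry no meaning.  Left modules are right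
  modules over the opposite algebra.
\<close>

locale right_module = R?: ring R + M?: abelian_group M
  for R :: "('k, 'a) module" (structure) and M :: "('a, 'm) module" (structure) +
  assumes act_closed: "\<lbrakk>a \<in> carrier R; x \<in> carrier M\<rbrakk> \<Longrightarrow> a \<odot>\<^bsub>M\<^esub> x \<in> carrier M"
    and act_add: "\<lbrakk>a \<in> carrier R; b \<in> carrier R; x \<in> carrier M\<rbrakk> \<Longrightarrow>
      (a \<oplus>\<^bsub>R\<^esub> b) \<odot>\<^bsub>M\<^esub> x = (a \<odot>\<^bsub>M\<^esub> x) \<oplus>\<^bsub>M\<^esub> (b \<odot>\<^bsub>M\<^esub> x)"
    and act_distr: "\<lbrakk>a \<in> carrier R; x \<in> carrier M; y \<in> carrier M\<rbrakk> \<Longrightarrow>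
      a \<odot>\<^bsub>M\<^esub> (x \<oplus>\<^bsub>M\<^esub> y) = (a \<odot>\<^bsub>M\<^esub> x) \<oplus>\<^bsub>M\<^esub> (a \<odot>\<^bsub>M\<^esub> y)"
    and act_mult: "\<lbrakk>a \<in> carrier R; b \<in> carrier R; x \<in> carrier M\<rbrakk> \<Longrightarrow>
      (a \<otimes>\<^bsub>R\<^esub> b) \<odot>\<^bsub>M\<^esub> x = b \<odot>\<^bsub>M\<^esub> (a \<odot>\<^bsub>M\<^esub> x)"
    and act_one: "x \<in> carrier M \<Longrightarrow> \<one>\<^bsub>R\<^esub> \<odot>\<^bsub>M\<^esub> x = x"

definition opposite :: "('k, 'a) module \<Rightarrow> ('k, 'a) module" where
  "opposite A = A\<lparr>mult := (\<lambda>x y. y \<otimes>\<^bsub>A\<^esub> x)\<rparr>"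

definition mk_module ::
    "'m set \<Rightarrow> ('m \<Rightarrow> 'm \<Rightarrow> 'm) \<Rightarrow> 'm \<Rightarrow> ('a \<Rightarrow> 'm \<Rightarrow> 'm) \<Rightarrow> ('a, 'm) module" where
  "mk_module C pl z act =
    \<lparr>carrier = C, mult = undefined, one = undefined, zero = z, add = pl, smult = act\<rparr>"

text \<open>The scalars act on a module through $c \mapsto c \cdot 1_A$.\<close>

definition scal :: "('k, 'a) module \<Rightarrow> ('a, 'm) module \<Rightarrow> 'k \<Rightarrow> 'm \<Rightarrow> 'm" where
  "scal A M c x = (c \<odot>\<^bsub>A\<^esub> \<one>\<^bsub>A\<^esub>) \<odot>\<^bsub>M\<^esub> x"

definition fd_module :: "('k::field, 'a) module \<Rightarrow> ('a, 'm) module \<Rightarrow> bool" where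
  "fd_module A M \<longleftrightarrow> right_module A M \<and>
    (\<exists>B. finite B \<and> B \<subseteq> carrier M \<and>
      (\<forall>x\<in>carrier M. \<exists>c. x = (\<Oplus>\<^bsub>M\<^esub>b\<in>B. scal A M (c b) b)))"

text \<open>
  The definitions below do not restrict the type of the elements of the modules they speak about.
  Where a definition quantifies over all objects of $\operatorname{mod} A$, it uses modules whose
  elements are lists of scalars: a finite-dimensional module has at most as many elements as some
  $K^n$, so every finite-dimensional module is isomorphic to one of this kind.
\<close>

type_synonym 'k univ = "'k list"

definition mod_hom :: "('k, 'a) module \<Rightarrow> ('a, 'm) module \<Rightarrow> ('a, 'n) module \<Rightarrow> ('m \<Rightarrow> 'n) \<Rightarrow> bool"
  where
  "mod_hom A M N h \<longleftrightarrow> h \<in> carrier M \<rightarrow> carrier N \<and>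
    (\<forall>x\<in>carrier M. \<forall>y\<in>carrier M. h (x \<oplus>\<^bsub>M\<^esub> y) = h x \<oplus>\<^bsub>N\<^esub> h y) \<and>
    (\<forall>a\<in>carrier A. \<forall>x\<in>carrier M. h (a \<odot>\<^bsub>M\<^esub> x) = a \<odot>\<^bsub>N\<^esub> h x)"

definition mod_iso :: "('k, 'a) module \<Rightarrow> ('a, 'm) module \<Rightarrow> ('a, 'n) module \<Rightarrow> bool" where
  "mod_iso A M N \<longleftrightarrow> (\<exists>h. mod_hom A M N h \<and> bij_betw h (carrier M) (carrier N))"

definition embeds :: "('k, 'a) module \<Rightarrow> ('a, 'm) module \<Rightarrow> ('a, 'n) module \<Rightarrow> bool" where
  "embeds A M N \<longleftrightarrow> (\<exists>h. mod_hom A M N h \<and> inj_on h (carrier M))"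

definition ker :: "('a, 'm) module \<Rightarrow> ('a, 'n) module \<Rightarrow> ('m \<Rightarrow> 'n) \<Rightarrow> 'm set" where
  "ker M N h = {x \<in> carrier M. h x = \<zero>\<^bsub>N\<^esub>}"

definition mod_surj :: "('k, 'a) module \<Rightarrow> ('a, 'm) module \<Rightarrow> ('a, 'n) module \<Rightarrow> ('m \<Rightarrow> 'n) \<Rightarrow> bool"
  where
  "mod_surj A M N h \<longleftrightarrow> mod_hom A M N h \<and> h ` carrier M = carrier N"

definition short_exact ::
    "('k, 'a) module \<Rightarrow> ('a, 'l) module \<Rightarrow> ('l \<Rightarrow> 'm) \<Rightarrow> ('a, 'm) module \<Rightarrow> ('m \<Rightarrow> 'n) \<Rightarrow>
      ('a, 'n) module \<Rightarrow> bool" where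
  "short_exact A L f M g N \<longleftrightarrow>
    mod_hom A L M f \<and> inj_on f (carrier L) \<and> mod_surj A M N g \<and> f ` carrier L = ker M N g"

definition zero_sub :: "('a, 'm) module \<Rightarrow> ('a, 'm) module" where
  "zero_sub M = M\<lparr>carrier := {\<zero>\<^bsub>M\<^esub>}\<rparr>"

definition dsum2 :: "('a, 'm) module \<Rightarrow> ('a, 'n) module \<Rightarrow> ('a, 'm \<times> 'n) module" where
  "dsum2 M N = mk_module (carrier M \<times> carrier N)
    (\<lambda>(x, y) (x', y'). (x \<oplus>\<^bsub>M\<^esub> x', y \<oplus>\<^bsub>N\<^esub> y')) (\<zero>\<^bsub>M\<^esub>, \<zero>\<^bsub>N\<^esub>)
    (\<lambda>a (x, y). (a \<odot>\<^bsub>M\<^esub> x, a \<odot>\<^bsub>N\<^esub> y))"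

definition dsum :: "'j set \<Rightarrow> ('j \<Rightarrow> ('a, 'm) module) \<Rightarrow> ('a, 'j \<Rightarrow> 'm) module" where
  "dsum J M = mk_module (\<Pi>\<^sub>E j\<in>J. carrier (M j))
    (\<lambda>x y. \<lambda>j\<in>J. x j \<oplus>\<^bsub>M j\<^esub> y j) (\<lambda>j\<in>J. \<zero>\<^bsub>M j\<^esub>)
    (\<lambda>a x. \<lambda>j\<in>J. a \<odot>\<^bsub>M j\<^esub> x j)"

definition regular :: "('k, 'a) module \<Rightarrow> ('a, 'a) module" where
  "regular A = mk_module (carrier A) (add A) \<zero>\<^bsub>A\<^esub> (\<lambda>a x. x \<otimes>\<^bsub>A\<^esub> a)"

definition projective :: "('k::field, 'a) module \<Rightarrow> ('a, 'm) module \<Rightarrow> bool" where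
  "projective A P \<longleftrightarrow> fd_module A P \<and>
    (\<forall>(X :: ('a, 'k univ) module) (Y :: ('a, 'k univ) module) g h.
      fd_module A X \<and> fd_module A Y \<and> mod_surj A X Y g \<and> mod_hom A P Y h \<longrightarrow>
      (\<exists>h'. mod_hom A P X h' \<and> (\<forall>x\<in>carrier P. g (h' x) = h x)))"

definition rad :: "('k, 'a) module \<Rightarrow> ('a, 'm) module \<Rightarrow> ('a, 'm) module" where
  "rad A M = M\<lparr>carrier := carrier M \<inter>
    \<Inter>{N. submodule N A M \<and> N \<noteq> carrier M \<and>
         (\<forall>L. submodule L A M \<and> N \<subseteq> L \<longrightarrow> L = N \<or> L = carrier M)}\<rparr>"

section \<open>Inverse Auslander-Reiten translation\<close>

definition proj_cover ::
    "('k::field, 'a) module \<Rightarrow> ('a, 'p) module \<Rightarrow> ('p \<Rightarrow> 'm) \<Rightarrow> ('a, 'm) module \<Rightarrow> bool" where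
  "proj_cover A P q M \<longleftrightarrow> projective A P \<and> mod_surj A P M q \<and>
    (\<forall>L. submodule L A P \<and>
      carrier P = {x \<oplus>\<^bsub>P\<^esub> y | x y. x \<in> ker P M q \<and> y \<in> L} \<longrightarrow> L = carrier P)"

definition min_proj_presentation ::
    "('k::field, 'a) module \<Rightarrow> ('a, 'p) module \<Rightarrow> ('p \<Rightarrow> 'q) \<Rightarrow> ('a, 'q) module \<Rightarrow> ('q \<Rightarrow> 'm) \<Rightarrow>
      ('a, 'm) module \<Rightarrow> bool" where
  "min_proj_presentation A P1 p P0 q M \<longleftrightarrow>
    proj_cover A P0 q M \<and> proj_cover A P1 p (P0\<lparr>carrier := ker P0 M q\<rparr>)"

text \<open>$\operatorname{Hom}_A(P, A)$, a left $A$-module by $(a \varphi)(x) = a\,\varphi(x)$.\<close>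

definition hom_regular :: "('k, 'a) module \<Rightarrow> ('a, 'p) module \<Rightarrow> ('a, 'p \<Rightarrow> 'a) module" where
  "hom_regular A P = mk_module
    {\<phi> \<in> extensional (carrier P). mod_hom A P (regular A) \<phi>}
    (\<lambda>\<phi> \<psi>. \<lambda>x\<in>carrier P. \<phi> x \<oplus>\<^bsub>A\<^esub> \<psi> x) (\<lambda>x\<in>carrier P. \<zero>\<^bsub>A\<^esub>)
    (\<lambda>a \<phi>. \<lambda>x\<in>carrier P. a \<otimes>\<^bsub>A\<^esub> \<phi> x)"

text \<open>
  The left module $N$ is the transpose of $M$: there is an exact sequence
  $\operatorname{Hom}_A(P_0, A) \to \operatorname{Hom}_A(P_1, A) \to N \to 0$
  for a minimal projective presentation $P_1 \to P_0 \to M \to 0$.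
\<close>

definition is_transpose ::
    "('k::field, 'a) module \<Rightarrow> ('a, 'm) module \<Rightarrow> ('a, 'n) module \<Rightarrow> bool" where
  "is_transpose A M N \<longleftrightarrow> fd_module (opposite A) N \<and>
    (\<exists>(P1 :: ('a, 'k univ) module) p (P0 :: ('a, 'k univ) module) q \<pi>.
      min_proj_presentation A P1 p P0 q M \<and>
      mod_surj (opposite A) (hom_regular A P1) N \<pi> \<and>
      ker (hom_regular A P1) N \<pi> =
        (\<lambda>\<phi>. \<lambda>x\<in>carrier P1. \<phi> (p x)) ` carrier (hom_regular A P0))"

text \<open>$D M = \operatorname{Hom}_K(M, K)$ with $(a \varphi)(x) = \varphi(x a)$.\<close>

definition dual :: "('k::field, 'a) module \<Rightarrow> ('a, 'm) module \<Rightarrow> ('a, 'm \<Rightarrow> 'k) module" where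
  "dual A M = mk_module
    {\<phi> \<in> extensional (carrier M).
      (\<forall>x\<in>carrier M. \<forall>y\<in>carrier M. \<phi> (x \<oplus>\<^bsub>M\<^esub> y) = \<phi> x + \<phi> y) \<and>
      (\<forall>c. \<forall>x\<in>carrier M. \<phi> (scal A M c x) = c * \<phi> x)}
    (\<lambda>\<phi> \<psi>. \<lambda>x\<in>carrier M. \<phi> x + \<psi> x) (\<lambda>x\<in>carrier M. 0)
    (\<lambda>a \<phi>. \<lambda>x\<in>carrier M. \<phi> (a \<odot>\<^bsub>M\<^esub> x))"

text \<open>
  \<open>is_tau_inv A M N\<close>: $N \cong \tau^{-1} M = \operatorname{Tr} D M$.  This determines $N$ up to isomorphism.
\<close>

definition is_tau_inv ::
    "('k::field, 'a) module \<Rightarrow> ('a, 'm) module \<Rightarrow> ('a, 'n) module \<Rightarrow> bool" where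
  "is_tau_inv A M N \<longleftrightarrow> is_transpose (opposite A) (dual A M) N"

section \<open>Tilting modules of projective dimension at most one\<close>

definition proj_dim_le_1 :: "('k::field, 'a) module \<Rightarrow> ('a, 'm) module \<Rightarrow> bool" where
  "proj_dim_le_1 A M \<longleftrightarrow>
    (\<exists>(P1 :: ('a, 'k univ) module) f (P0 :: ('a, 'k univ) module) g.
      projective A P1 \<and> projective A P0 \<and> short_exact A P1 f P0 g M)"

text \<open>$\operatorname{Ext}^1_A(M, N) = 0$: every extension of $M$ by $N$ splits.\<close>

definition Ext1_zero ::
    "('k::field, 'a) module \<Rightarrow> ('a, 'm) module \<Rightarrow> ('a, 'n) module \<Rightarrow> bool" where
  "Ext1_zero A M N \<longleftrightarrow>
    (\<forall>(E :: ('a, 'k univ) module) f g. fd_module A E \<and> short_exact A N f E g M \<longrightarrow>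
      (\<exists>s. mod_hom A M E s \<and> (\<forall>x\<in>carrier M. g (s x) = x)))"

text \<open>Membership in $\operatorname{add} T$.\<close>

definition in_add :: "('k::field, 'a) module \<Rightarrow> ('a, 't) module \<Rightarrow> ('a, 'm) module \<Rightarrow> bool" where
  "in_add A T M \<longleftrightarrow> fd_module A M \<and>
    (\<exists>(N :: ('a, 'k univ) module) n. fd_module A N \<and>
      mod_iso A (dsum2 M N) (dsum {..<n::nat} (\<lambda>_. T)))"

definition tilting_module :: "('k::field, 'a) module \<Rightarrow> ('a, 'm) module \<Rightarrow> bool" where
  "tilting_module A T \<longleftrightarrow> fd_module A T \<and> proj_dim_le_1 A T \<and> Ext1_zero A T T \<and>
    (\<exists>(T0 :: ('a, 'k univ) module) (T1 :: ('a, 'k univ) module) f g.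
      in_add A T T0 \<and> in_add A T T1 \<and> short_exact A (regular A) f T0 g T1)"

section \<open>The bounded derived category\<close>

record ('a, 'm) cplx =
  obj :: "int \<Rightarrow> ('a, 'm) module"
  diff :: "int \<Rightarrow> 'm \<Rightarrow> 'm"

text \<open>
  Complexes are cohomological: \<open>diff X n\<close> goes from degree \<open>n\<close> to degree \<open>n + 1\<close>.
\<close>

definition bounded_complex :: "('k::field, 'a) module \<Rightarrow> ('a, 'm) cplx \<Rightarrow> bool" where
  "bounded_complex A X \<longleftrightarrow>
    (\<forall>n. fd_module A (obj X n) \<and> mod_hom A (obj X n) (obj X (n + 1)) (diff X n) \<and>
      (\<forall>x\<in>carrier (obj X n). diff X (n + 1) (diff X n x) = \<zero>\<^bsub>obj X (n + 2)\<^esub>)) \<and>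
    finite {n. carrier (obj X n) \<noteq> {\<zero>\<^bsub>obj X n\<^esub>}}"

definition chain_map ::
    "('k, 'a) module \<Rightarrow> ('a, 'm) cplx \<Rightarrow> ('a, 'n) cplx \<Rightarrow> (int \<Rightarrow> 'm \<Rightarrow> 'n) \<Rightarrow> bool" where
  "chain_map A X Y f \<longleftrightarrow>
    (\<forall>n. mod_hom A (obj X n) (obj Y n) (f n) \<and>
      (\<forall>x\<in>carrier (obj X n). f (n + 1) (diff X n x) = diff Y n (f n x)))"

definition homotopic ::
    "('k, 'a) module \<Rightarrow> ('a, 'm) cplx \<Rightarrow> ('a, 'n) cplx \<Rightarrow> (int \<Rightarrow> 'm \<Rightarrow> 'n) \<Rightarrow>
      (int \<Rightarrow> 'm \<Rightarrow> 'n) \<Rightarrow> bool" where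
  "homotopic A X Y f g \<longleftrightarrow>
    (\<exists>h. \<forall>n. mod_hom A (obj X n) (obj Y (n - 1)) (h n) \<and>
      (\<forall>x\<in>carrier (obj X n).
        f n x = g n x \<oplus>\<^bsub>obj Y n\<^esub> (diff Y (n - 1) (h n x) \<oplus>\<^bsub>obj Y n\<^esub> h (n + 1) (diff X n x))))"

definition cocycles :: "('a, 'm) cplx \<Rightarrow> int \<Rightarrow> 'm set" where
  "cocycles X n = ker (obj X n) (obj X (n + 1)) (diff X n)"

definition coboundaries :: "('a, 'm) cplx \<Rightarrow> int \<Rightarrow> 'm set" where
  "coboundaries X n = diff X (n - 1) ` carrier (obj X (n - 1))"

text \<open>The two conditions on $f$ say that $H^n(f)$ is injective and surjective.\<close>

definition quasi_iso ::
    "('k, 'a) module \<Rightarrow> ('a, 'm) cplx \<Rightarrow> ('a, 'n) cplx \<Rightarrow> (int \<Rightarrow> 'm \<Rightarrow> 'n) \<Rightarrow> bool" where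
  "quasi_iso A X Y f \<longleftrightarrow> chain_map A X Y f \<and>
    (\<forall>n. (\<forall>x\<in>cocycles X n. f n x \<in> coboundaries Y n \<longrightarrow> x \<in> coboundaries X n) \<and>
      (\<forall>y\<in>cocycles Y n. \<exists>x\<in>cocycles X n. \<exists>b\<in>coboundaries Y n. y = f n x \<oplus>\<^bsub>obj Y n\<^esub> b))"

text \<open>
  $\mathcal{D}^b(A)$ is the localization of the homotopy category of bounded complexes over
  $\operatorname{mod} A$ at the quasi-isomorphisms: a morphism from $X$ to $Y$ is an equivalence class of
  roofs $X \leftarrow Z \to Y$ whose left leg is a quasi-isomorphism.
\<close>

type_synonym ('k, 'a, 'm, 'n) roof =
  "('a, 'k univ) cplx \<times> (int \<Rightarrow> 'k univ \<Rightarrow> 'm) \<times> (int \<Rightarrow> 'k univ \<Rightarrow> 'n)"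

definition comp_map :: "(int \<Rightarrow> 'm \<Rightarrow> 'n) \<Rightarrow> (int \<Rightarrow> 'l \<Rightarrow> 'm) \<Rightarrow> int \<Rightarrow> 'l \<Rightarrow> 'n"
    (infixl \<open>\<circ>\<^sub>c\<close> 75) where
  "f \<circ>\<^sub>c g = (\<lambda>n. f n \<circ> g n)"

definition zero_map :: "('a, 'n) cplx \<Rightarrow> int \<Rightarrow> 'm \<Rightarrow> 'n" where
  "zero_map Y = (\<lambda>n x. \<zero>\<^bsub>obj Y n\<^esub>)"

fun is_roof ::
    "('k::field, 'a) module \<Rightarrow> ('a, 'm) cplx \<Rightarrow> ('a, 'n) cplx \<Rightarrow> ('k, 'a, 'm, 'n) roof \<Rightarrow> bool"
  where
  "is_roof A X Y (Z, s, f) \<longleftrightarrow>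
    bounded_complex A X \<and> bounded_complex A Y \<and> bounded_complex A Z \<and>
    quasi_iso A Z X s \<and> chain_map A Z Y f"

fun roof_equiv ::
    "('k::field, 'a) module \<Rightarrow> ('a, 'm) cplx \<Rightarrow> ('a, 'n) cplx \<Rightarrow>
      ('k, 'a, 'm, 'n) roof \<Rightarrow> ('k, 'a, 'm, 'n) roof \<Rightarrow> bool" where
  "roof_equiv A X Y (Z, s, f) (Z', s', f') \<longleftrightarrow>
    is_roof A X Y (Z, s, f) \<and> is_roof A X Y (Z', s', f') \<and>
    (\<exists>(W :: ('a, 'k univ) cplx) u u'.
      bounded_complex A W \<and> chain_map A W Z u \<and> chain_map A W Z' u' \<and>
      quasi_iso A W X (s \<circ>\<^sub>c u) \<and>
      homotopic A W X (s \<circ>\<^sub>c u) (s' \<circ>\<^sub>c u') \<and> homotopic A W Y (f \<circ>\<^sub>c u) (f' \<circ>\<^sub>c u'))"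

text \<open>
  \<open>roof_comp A Y \<rho> \<sigma> \<kappa>\<close>: the roof \<open>\<kappa>\<close> represents the composite of \<open>\<rho>\<close>, ending at \<open>Y\<close>, followed
  by \<open>\<sigma>\<close>, starting at \<open>Y\<close>.
\<close>

fun roof_comp ::
    "('k::field, 'a) module \<Rightarrow> ('a, 'n) cplx \<Rightarrow>
      ('k, 'a, 'm, 'n) roof \<Rightarrow> ('k, 'a, 'n, 'l) roof \<Rightarrow> ('k, 'a, 'm, 'l) roof \<Rightarrow> bool" where
  "roof_comp A Y (Z, s, f) (W, t, g) (V, s', g') \<longleftrightarrow>
    (\<exists>u v. bounded_complex A V \<and> quasi_iso A V Z u \<and> chain_map A V W v \<and>
      homotopic A V Y (f \<circ>\<^sub>c u) (t \<circ>\<^sub>c v) \<and> s' = s \<circ>\<^sub>c u \<and> g' = g \<circ>\<^sub>c v)"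

fun represents_id ::
    "('k::field, 'a) module \<Rightarrow> ('a, 'm) cplx \<Rightarrow> ('k, 'a, 'm, 'm) roof \<Rightarrow> bool" where
  "represents_id A X (Z, s, f) \<longleftrightarrow> roof_equiv A X X (Z, s, f) (Z, s, s)"

definition Db_hom_zero :: "('k::field, 'a) module \<Rightarrow> ('a, 'm) cplx \<Rightarrow> ('a, 'n) cplx \<Rightarrow> bool" where
  "Db_hom_zero A X Y \<longleftrightarrow>
    (\<forall>(Z :: ('a, 'k univ) cplx) s f. is_roof A X Y (Z, s, f) \<longrightarrow>
      roof_equiv A X Y (Z, s, f) (Z, s, zero_map Y))"

definition Db_iso :: "('k::field, 'a) module \<Rightarrow> ('a, 'm) cplx \<Rightarrow> ('a, 'n) cplx \<Rightarrow> bool" where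
  "Db_iso A X Y \<longleftrightarrow>
    (\<exists>(\<rho> :: ('k, 'a, 'm, 'n) roof) (\<sigma> :: ('k, 'a, 'n, 'm) roof) \<kappa> \<kappa>'.
      is_roof A X Y \<rho> \<and> is_roof A Y X \<sigma> \<and>
      roof_comp A Y \<rho> \<sigma> \<kappa> \<and> represents_id A X \<kappa> \<and>
      roof_comp A X \<sigma> \<rho> \<kappa>' \<and> represents_id A Y \<kappa>')"

section \<open>Tilting complexes\<close>

definition shift :: "int \<Rightarrow> ('a, 'm) cplx \<Rightarrow> ('a, 'm) cplx" where
  "shift r X =
    \<lparr>obj = (\<lambda>n. obj X (n + r)),
     diff = (\<lambda>n x. if even r then diff X (n + r) x
                   else \<ominus>\<^bsub>obj X (n + r + 1)\<^esub> diff X (n + r) x)\<rparr>"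

definition csum :: "('a, 'm) cplx \<Rightarrow> ('a, 'n) cplx \<Rightarrow> ('a, 'm \<times> 'n) cplx" where
  "csum X Y =
    \<lparr>obj = (\<lambda>n. dsum2 (obj X n) (obj Y n)),
     diff = (\<lambda>n (x, y). (diff X n x, diff Y n y))\<rparr>"

definition cone ::
    "('a, 'm) cplx \<Rightarrow> ('a, 'n) cplx \<Rightarrow> (int \<Rightarrow> 'm \<Rightarrow> 'n) \<Rightarrow> ('a, 'm \<times> 'n) cplx" where
  "cone X Y f =
    \<lparr>obj = (\<lambda>n. dsum2 (obj X (n + 1)) (obj Y n)),
     diff = (\<lambda>n (x, y). (\<ominus>\<^bsub>obj X (n + 2)\<^esub> diff X (n + 1) x,
                         f (n + 1) x \<oplus>\<^bsub>obj Y (n + 1)\<^esub> diff Y n y))\<rparr>"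

definition stalk :: "('a, 'm) module \<Rightarrow> ('a, 'm) cplx" where
  "stalk M =
    \<lparr>obj = (\<lambda>n. if n = 0 then M else zero_sub M), diff = (\<lambda>n x. \<zero>\<^bsub>M\<^esub>)\<rparr>"

text \<open>The complex $M \to N$ with $M$ in degree $-1$ and $N$ in degree $0$.\<close>

definition two_term :: "('a, 'm) module \<Rightarrow> ('m \<Rightarrow> 'n) \<Rightarrow> ('a, 'n) module \<Rightarrow> ('a, 'm \<times> 'n) cplx"
  where
  "two_term M f N =
    \<lparr>obj = (\<lambda>n. dsum2 (if n = -1 then M else zero_sub M) (if n = 0 then N else zero_sub N)),
     diff = (\<lambda>n (x, y). (\<zero>\<^bsub>M\<^esub>, if n = -1 then f x else \<zero>\<^bsub>N\<^esub>))\<rparr>"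

definition perfect :: "('k::field, 'a) module \<Rightarrow> ('a, 'm) cplx \<Rightarrow> bool" where
  "perfect A X \<longleftrightarrow>
    (\<exists>P :: ('a, 'k univ) cplx. bounded_complex A P \<and> (\<forall>n. projective A (obj P n)) \<and> Db_iso A X P)"

text \<open>
  The smallest strictly full triangulated subcategory of $\mathcal{D}^b(A)$ containing the direct
  summands of $T$.  Every morphism of $\mathcal{D}^b(A)$ is, up to isomorphism, given by a
  chain map, so closure under cones of chain maps suffices.
\<close>

inductive_set generated ::
    "('k::field, 'a) module \<Rightarrow> ('a, 't) cplx \<Rightarrow> ('a, 'k univ) cplx set"
  for A :: "('k::field, 'a) module" and T :: "('a, 't) cplx" where
  summand: "bounded_complex A X \<Longrightarrow> bounded_complex A (Y :: ('a, 'k univ) cplx) \<Longrightarrow>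
    Db_iso A (csum X Y) T \<Longrightarrow> X \<in> generated A T"
| iso: "X \<in> generated A T \<Longrightarrow> Db_iso A Y X \<Longrightarrow> Y \<in> generated A T"
| shift: "X \<in> generated A T \<Longrightarrow> shift r X \<in> generated A T"
| cone: "X \<in> generated A T \<Longrightarrow> Y \<in> generated A T \<Longrightarrow> chain_map A X Y f \<Longrightarrow>
    Db_iso A Z (cone X Y f) \<Longrightarrow> Z \<in> generated A T"

definition tilting_complex :: "('k::field, 'a) module \<Rightarrow> ('a, 'm) cplx \<Rightarrow> bool" where
  "tilting_complex A T \<longleftrightarrow>
    bounded_complex A T \<and> (\<forall>n. projective A (obj T n)) \<and>
    (\<forall>r. r \<noteq> 0 \<longrightarrow> Db_hom_zero A T (shift r T)) \<and>
    generated A T = {X. perfect A X}"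

section \<open>The objects attached to a vertex\<close>

abbreviation alg where "alg \<equiv> bound_quiver_algebra"

definition proj_at ::
    "('v, 'e) pre_digraph \<Rightarrow> (('v, 'e) qpath \<Rightarrow> 'k::field) set \<Rightarrow> 'v \<Rightarrow>
      (('k, 'v, 'e) bqelt, ('k, 'v, 'e) bqelt) module" where
  "proj_at Q I i = (regular (alg Q I))
    \<lparr>carrier := {path_class Q I (vertex_path i) \<otimes>\<^bsub>alg Q I\<^esub> a | a. a \<in> carrier (alg Q I)}\<rparr>"

text \<open>
  The coefficient of the trivial path at \<open>i\<close>; it does not depend on the representative because
  relations involve only paths of length at least two.
\<close>

definition vertex_coeff :: "'v \<Rightarrow> ('k, 'v, 'e) bqelt \<Rightarrow> 'k::field" where
  "vertex_coeff i a = (THE c. \<exists>x\<in>a. x (vertex_path i) = c)"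

definition simple_at :: "'v \<Rightarrow> (('k::field, 'v, 'e) bqelt, 'k) module" where
  "simple_at i = mk_module UNIV (+) 0 (\<lambda>a x. x * vertex_coeff i a)"

definition arrows_into :: "('v, 'e) pre_digraph \<Rightarrow> 'v \<Rightarrow> 'e set" where
  "arrows_into Q k = {\<alpha> \<in> arcs Q. head Q \<alpha> = k}"

definition L_cplx ::
    "('v, 'e) pre_digraph \<Rightarrow> (('v, 'e) qpath \<Rightarrow> 'k::field) set \<Rightarrow> 'v \<Rightarrow>
      (('k, 'v, 'e) bqelt, ('k, 'v, 'e) bqelt \<times> ('e \<Rightarrow> ('k, 'v, 'e) bqelt)) cplx" where
  "L_cplx Q I k = two_term (proj_at Q I k)
    (\<lambda>x. \<lambda>\<alpha>\<in>arrows_into Q k. path_class Q I (arrow_path Q \<alpha>) \<otimes>\<^bsub>alg Q I\<^esub> x)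
    (dsum (arrows_into Q k) (\<lambda>\<alpha>. proj_at Q I (tail Q \<alpha>)))"

definition other_proj ::
    "('v, 'e) pre_digraph \<Rightarrow> (('v, 'e) qpath \<Rightarrow> 'k::field) set \<Rightarrow> 'v \<Rightarrow>
      (('k, 'v, 'e) bqelt, 'v \<Rightarrow> ('k, 'v, 'e) bqelt) module" where
  "other_proj Q I k = dsum (verts Q - {k}) (proj_at Q I)"

definition T_minus ::
    "('v, 'e) pre_digraph \<Rightarrow> (('v, 'e) qpath \<Rightarrow> 'k::field) set \<Rightarrow> 'v \<Rightarrow>
      (('k, 'v, 'e) bqelt, (('k, 'v, 'e) bqelt \<times> ('e \<Rightarrow> ('k, 'v, 'e) bqelt)) \<times>
        ('v \<Rightarrow> ('k, 'v, 'e) bqelt)) cplx" where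
  "T_minus Q I k = csum (L_cplx Q I k) (stalk (other_proj Q I k))"

text \<open>
  $\tau^{-1} S_k$ is only defined up to isomorphism; \<open>is_T_BB Q I k T\<close> says that \<open>T\<close> is the direct sum
  of a model of it and the other projectives.
\<close>

definition is_T_BB ::
    "('v, 'e) pre_digraph \<Rightarrow> (('v, 'e) qpath \<Rightarrow> 'k::field) set \<Rightarrow> 'v \<Rightarrow>
      (('k, 'v, 'e) bqelt, 'k univ \<times> ('v \<Rightarrow> ('k, 'v, 'e) bqelt)) module \<Rightarrow> bool" where
  "is_T_BB Q I k T \<longleftrightarrow>
    (\<exists>N. is_tau_inv (alg Q I) (simple_at k) N \<and> T = dsum2 N (other_proj Q I k))"

end

theory Submission
  imports Defs
begin

text \<open>
  Let $d : P_k \to \bigoplus P_{s(\alpha)}$ be the differential of $L_k$.  If $x \in \ker d$ satisfies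
  $x e_j = x$ for some $j \neq k$, then left multiplication by $x$ is a map $P_j \to P_k$ that gives
  a chain map $T^-_k \to T^-_k[-1]$; it is visible on $H^0$, so $x = 0$.  Hence $\ker d$ is a sum of
  copies of $S_k$; it lies in the radical of $P_k$ because $k$ is not isolated, and so $\ker d = 0$ by
  assumption.  Thus $T^-_k$ is a projective resolution of
  $T = \operatorname{coker} d \oplus \bigoplus_{i \neq k} P_i$.  The cokernel of $d$ is $\tau^{-1} S_k$,
  since $\operatorname{Hom}(-, A)$ turns the minimal presentation
  $\bigoplus A e_{s(\alpha)} \to A e_k \to D S_k$ into $d$.  The vanishing of $\operatorname{Ext}^1(T, T)$ is
  $\operatorname{Hom}(T^-_k, T^-_k[1]) = 0$, and the coresolution of $A$ is
  $A \to \bigoplus P_{s(\alpha)} \oplus \bigoplus_{i \neq k} P_i \to \operatorname{coker} d$.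
\<close>

text \<open>The assumption that some arrow meets k excludes a genuine exception: for an isolated k,
  P_k = S_k, the complex T^-_k is P_k[1] plus the other projectives and is still tilting, while
  tau^{-1} S_k = 0.

  Two obstacles shape the proof. Morphisms of the derived category are classes of roofs, so
  vanishing of Hom only says that a chain map becomes nullhomotopic after some quasi-isomorphism q
  into T^-_k. In degree -1 this suffices, because every degree 0 element of T^-_k is a cocycle and q
  is onto on H^0. In degree 1 a section of q up to homotopy is built by hand; that construction uses
  injectivity of d, which is therefore settled before Ext.

  Moreover \<open>projective\<close>, roofs, Ext and add quantify over modules whose elements are
  lists of scalars, whereas P_k and T^-_k live on other types. Liftings are therefore taken from
  dual bases, which work for all carriers, and modules that a definition asks for are moved to list
  models. Left modules, needed for the transpose, are right modules over
  \<open>opposite A\<close>.\<close>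

lemma mk_module_simps [simp]:
  "carrier (mk_module C pl z act) = C"
  "add (mk_module C pl z act) = pl"
  "zero (mk_module C pl z act) = z"
  "smult (mk_module C pl z act) = act"
  by (simp_all add: mk_module_def)

section \<open>Abelian groups, right modules and direct sums\<close>

context abelian_group begin

lemma a_inv_zero: "\<ominus> \<zero> = \<zero>"
  by (rule minus_equality) auto

text \<open>AC rewriting sorts the summands and may leave one term between x and its inverse. The
  four rules cancel across such a term, at the end of a sum or inside it; with them
  \<open>ag_simps\<close> settles the identities between signed sums that occur below.\<close>

lemma add_cancel_minus1: "x \<in> carrier G \<Longrightarrow> y \<in> carrier G \<Longrightarrow> x \<oplus> (y \<oplus> \<ominus> x) = y"
  using a_comm r_neg1 r_neg2 by (metis a_inv_closed)

lemma add_cancel_minus2: "x \<in> carrier G \<Longrightarrow> y \<in> carrier G \<Longrightarrow> \<ominus> x \<oplus> (y \<oplus> x) = y"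
  using a_comm r_neg1 r_neg2 by (metis a_inv_closed)

lemma add_cancel_minus3:
  "x \<in> carrier G \<Longrightarrow> y \<in> carrier G \<Longrightarrow> z \<in> carrier G \<Longrightarrow> x \<oplus> (y \<oplus> (\<ominus> x \<oplus> z)) = y \<oplus> z"
  using add_cancel_minus1 a_assoc a_comm by (metis a_inv_closed a_closed)

lemma add_cancel_minus4:
  "x \<in> carrier G \<Longrightarrow> y \<in> carrier G \<Longrightarrow> z \<in> carrier G \<Longrightarrow> \<ominus> x \<oplus> (y \<oplus> (x \<oplus> z)) = y \<oplus> z"
  using add_cancel_minus2 a_assoc a_comm by (metis a_inv_closed a_closed)

lemmas ag_simps = a_inv_zero a_minus_def minus_add minus_minus a_ac r_neg l_neg r_neg1 r_neg2
  add_cancel_minus1 add_cancel_minus2 add_cancel_minus3 add_cancel_minus4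

end

lemma right_moduleI:
  fixes R :: "('k, 'a) module" and M :: "('a, 'm) module"
  assumes "ring R"
    and "\<And>x y. x \<in> carrier M \<Longrightarrow> y \<in> carrier M \<Longrightarrow> x \<oplus>\<^bsub>M\<^esub> y \<in> carrier M"
    and "\<zero>\<^bsub>M\<^esub> \<in> carrier M"
    and "\<And>x y z. x \<in> carrier M \<Longrightarrow> y \<in> carrier M \<Longrightarrow> z \<in> carrier M \<Longrightarrow>
      (x \<oplus>\<^bsub>M\<^esub> y) \<oplus>\<^bsub>M\<^esub> z = x \<oplus>\<^bsub>M\<^esub> (y \<oplus>\<^bsub>M\<^esub> z)"
    and "\<And>x y. x \<in> carrier M \<Longrightarrow> y \<in> carrier M \<Longrightarrow> x \<oplus>\<^bsub>M\<^esub> y = y \<oplus>\<^bsub>M\<^esub> x"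
    and "\<And>x. x \<in> carrier M \<Longrightarrow> \<zero>\<^bsub>M\<^esub> \<oplus>\<^bsub>M\<^esub> x = x"
    and "\<And>x. x \<in> carrier M \<Longrightarrow> \<exists>y\<in>carrier M. y \<oplus>\<^bsub>M\<^esub> x = \<zero>\<^bsub>M\<^esub>"
    and "\<And>a x. a \<in> carrier R \<Longrightarrow> x \<in> carrier M \<Longrightarrow> a \<odot>\<^bsub>M\<^esub> x \<in> carrier M"
    and "\<And>a b x. a \<in> carrier R \<Longrightarrow> b \<in> carrier R \<Longrightarrow> x \<in> carrier M \<Longrightarrow>
      (a \<oplus>\<^bsub>R\<^esub> b) \<odot>\<^bsub>M\<^esub> x = (a \<odot>\<^bsub>M\<^esub> x) \<oplus>\<^bsub>M\<^esub> (b \<odot>\<^bsub>M\<^esub> x)"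
    and "\<And>a x y. a \<in> carrier R \<Longrightarrow> x \<in> carrier M \<Longrightarrow> y \<in> carrier M \<Longrightarrow>
      a \<odot>\<^bsub>M\<^esub> (x \<oplus>\<^bsub>M\<^esub> y) = (a \<odot>\<^bsub>M\<^esub> x) \<oplus>\<^bsub>M\<^esub> (a \<odot>\<^bsub>M\<^esub> y)"
    and "\<And>a b x. a \<in> carrier R \<Longrightarrow> b \<in> carrier R \<Longrightarrow> x \<in> carrier M \<Longrightarrow>
      (a \<otimes>\<^bsub>R\<^esub> b) \<odot>\<^bsub>M\<^esub> x = b \<odot>\<^bsub>M\<^esub> (a \<odot>\<^bsub>M\<^esub> x)"
    and "\<And>x. x \<in> carrier M \<Longrightarrow> \<one>\<^bsub>R\<^esub> \<odot>\<^bsub>M\<^esub> x = x"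
  shows "right_module R M"
proof -
  have "abelian_group M"
    by (rule abelian_groupI) (use assms in auto)
  then show ?thesis
    using assms by (auto intro!: right_module.intro right_module_axioms.intro)
qed

context right_module begin

lemma zero_act [simp]: "x \<in> carrier M \<Longrightarrow> \<zero>\<^bsub>R\<^esub> \<odot>\<^bsub>M\<^esub> x = \<zero>\<^bsub>M\<^esub>"
  by (metis M.add.l_cancel_one' R.l_zero R.zero_closed act_add act_closed)

lemma act_zero [simp]: "a \<in> carrier R \<Longrightarrow> a \<odot>\<^bsub>M\<^esub> \<zero>\<^bsub>M\<^esub> = \<zero>\<^bsub>M\<^esub>"
  by (metis M.add.l_cancel_one' M.r_zero M.zero_closed act_closed act_distr)

lemma act_minus: "a \<in> carrier R \<Longrightarrow> x \<in> carrier M \<Longrightarrow> a \<odot>\<^bsub>M\<^esub> (\<ominus>\<^bsub>M\<^esub> x) = \<ominus>\<^bsub>M\<^esub> (a \<odot>\<^bsub>M\<^esub> x)"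
  by (metis M.add.inv_closed M.l_neg M.minus_equality act_closed act_distr act_zero)

lemma minus_act: "a \<in> carrier R \<Longrightarrow> x \<in> carrier M \<Longrightarrow> (\<ominus>\<^bsub>R\<^esub> a) \<odot>\<^bsub>M\<^esub> x = \<ominus>\<^bsub>M\<^esub> (a \<odot>\<^bsub>M\<^esub> x)"
  by (metis M.minus_equality R.add.inv_closed R.l_neg act_add act_closed zero_act)

lemma minus_one_act: "x \<in> carrier M \<Longrightarrow> (\<ominus>\<^bsub>R\<^esub> \<one>\<^bsub>R\<^esub>) \<odot>\<^bsub>M\<^esub> x = \<ominus>\<^bsub>M\<^esub> x"
  by (simp add: minus_act act_one)

lemma minus_self: "x \<in> carrier M \<Longrightarrow> x \<ominus>\<^bsub>M\<^esub> x = \<zero>\<^bsub>M\<^esub>"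
  by (simp add: a_minus_def M.r_neg)

lemma minus_eq_zeroD: "x \<in> carrier M \<Longrightarrow> y \<in> carrier M \<Longrightarrow> x \<ominus>\<^bsub>M\<^esub> y = \<zero>\<^bsub>M\<^esub> \<Longrightarrow> x = y"
  by (metis M.add.inv_closed M.minus_equality M.minus_minus a_minus_def)

declare act_closed [simp, intro]

end

text \<open>Acting with -1 provides closure under negatives, so the additive subgroup contained in
  \<open>submodule\<close> needs no premise of its own.\<close>

lemma right_submoduleI:
  assumes "right_module R M"
    and "H \<subseteq> carrier M" and "\<zero>\<^bsub>M\<^esub> \<in> H"
    and "\<And>x y. x \<in> H \<Longrightarrow> y \<in> H \<Longrightarrow> x \<oplus>\<^bsub>M\<^esub> y \<in> H"
    and "\<And>a x. a \<in> carrier R \<Longrightarrow> x \<in> H \<Longrightarrow> a \<odot>\<^bsub>M\<^esub> x \<in> H"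
  shows "submodule H R M"
proof -
  interpret right_module R M by fact
  have neg: "\<ominus>\<^bsub>M\<^esub> x \<in> H" if "x \<in> H" for x
    using assms(5)[of "\<ominus>\<^bsub>R\<^esub> \<one>\<^bsub>R\<^esub>" x] that assms(2) minus_one_act[of x] by auto
  show ?thesis
    by unfold_locales (use assms neg in \<open>auto simp: a_inv_def\<close>)
qed

lemma submoduleD:
  assumes "submodule H R M"
  shows "H \<subseteq> carrier M" "\<zero>\<^bsub>M\<^esub> \<in> H"
    "x \<in> H \<Longrightarrow> y \<in> H \<Longrightarrow> x \<oplus>\<^bsub>M\<^esub> y \<in> H"
    "a \<in> carrier R \<Longrightarrow> x \<in> H \<Longrightarrow> a \<odot>\<^bsub>M\<^esub> x \<in> H"
    "x \<in> H \<Longrightarrow> \<ominus>\<^bsub>M\<^esub> x \<in> H"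
proof -
  interpret submodule H R M by fact
  show "H \<subseteq> carrier M" "\<zero>\<^bsub>M\<^esub> \<in> H"
    "x \<in> H \<Longrightarrow> y \<in> H \<Longrightarrow> x \<oplus>\<^bsub>M\<^esub> y \<in> H"
    "a \<in> carrier R \<Longrightarrow> x \<in> H \<Longrightarrow> a \<odot>\<^bsub>M\<^esub> x \<in> H"
    "x \<in> H \<Longrightarrow> \<ominus>\<^bsub>M\<^esub> x \<in> H"
    using subset one_closed m_closed m_inv_closed by (auto simp: a_inv_def)
qed

lemma right_module_sub:
  assumes "right_module R M" "submodule H R M"
  shows "right_module R (M\<lparr>carrier := H\<rparr>)"
proof -
  interpret right_module R M by fact
  note H = submoduleD[OF assms(2)]
  show ?thesis
  proof (rule right_moduleI)
    fix x assume "x \<in> carrier (M\<lparr>carrier := H\<rparr>)"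
    then show "\<exists>y\<in>carrier (M\<lparr>carrier := H\<rparr>). y \<oplus>\<^bsub>M\<lparr>carrier := H\<rparr>\<^esub> x = \<zero>\<^bsub>M\<lparr>carrier := H\<rparr>\<^esub>"
      using H by (intro bexI[of _ "\<ominus>\<^bsub>M\<^esub> x"]) (auto intro: M.l_neg)
  qed (use H in \<open>auto simp: M.a_assoc subset_eq act_add act_distr act_mult act_one R.ring_axioms
        intro: M.a_comm\<close>)
qed

lemma zero_sub_right_module:
  assumes "right_module R M" shows "right_module R (zero_sub M)"
proof -
  interpret right_module R M by fact
  show ?thesis unfolding zero_sub_def
    by (rule right_module_sub[OF assms]) (rule right_submoduleI[OF assms], auto)
qed

lemma zero_sub_simps [simp]:
  "carrier (zero_sub M) = {\<zero>\<^bsub>M\<^esub>}" "zero (zero_sub M) = \<zero>\<^bsub>M\<^esub>"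
  "add (zero_sub M) = add M" "smult (zero_sub M) = smult M"
  by (simp_all add: zero_sub_def)

lemma dsum2_simps [simp]:
  "carrier (dsum2 M N) = carrier M \<times> carrier N"
  "zero (dsum2 M N) = (\<zero>\<^bsub>M\<^esub>, \<zero>\<^bsub>N\<^esub>)"
  "(x, y) \<oplus>\<^bsub>dsum2 M N\<^esub> (x', y') = (x \<oplus>\<^bsub>M\<^esub> x', y \<oplus>\<^bsub>N\<^esub> y')"
  "a \<odot>\<^bsub>dsum2 M N\<^esub> (x, y) = (a \<odot>\<^bsub>M\<^esub> x, a \<odot>\<^bsub>N\<^esub> y)"
  by (simp_all add: dsum2_def)

lemma dsum2_right_module:
  assumes "right_module R M" "right_module R N"
  shows "right_module R (dsum2 M N)"
proof -
  interpret M: right_module R M by fact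
  interpret N: right_module R N by fact
  show ?thesis
  proof (rule right_moduleI)
    fix x assume "x \<in> carrier (dsum2 M N)"
    then show "\<exists>y\<in>carrier (dsum2 M N). y \<oplus>\<^bsub>dsum2 M N\<^esub> x = \<zero>\<^bsub>dsum2 M N\<^esub>"
      by (intro bexI[of _ "(\<ominus>\<^bsub>M\<^esub> fst x, \<ominus>\<^bsub>N\<^esub> snd x)"]) (auto intro: M.l_neg N.l_neg)
  qed (auto simp: M.a_assoc N.a_assoc M.act_add N.act_add M.act_distr N.act_distr
        M.act_mult N.act_mult M.act_one N.act_one M.R.ring_axioms intro: M.a_comm N.a_comm)
qed

lemma dsum_simps:
  "carrier (dsum J M) = (\<Pi>\<^sub>E j\<in>J. carrier (M j))"
  "zero (dsum J M) = (\<lambda>j\<in>J. \<zero>\<^bsub>M j\<^esub>)"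
  "add (dsum J M) = (\<lambda>x y. \<lambda>j\<in>J. x j \<oplus>\<^bsub>M j\<^esub> y j)"
  "smult (dsum J M) = (\<lambda>a x. \<lambda>j\<in>J. a \<odot>\<^bsub>M j\<^esub> x j)"
  by (simp_all add: dsum_def)

lemma dsum_right_module:
  assumes "ring R" "\<And>j. j \<in> J \<Longrightarrow> right_module R (M j)"
  shows "right_module R (dsum J M)"
proof -
  have ag: "abelian_group (M j)" if "j \<in> J" for j
    using assms(2)[OF that] by (simp add: right_module_def)
  note am = ag[THEN abelian_group.axioms(1)]
  show ?thesis
  proof (rule right_moduleI)
    fix x assume x: "x \<in> carrier (dsum J M)"
    then show "\<exists>y\<in>carrier (dsum J M). y \<oplus>\<^bsub>dsum J M\<^esub> x = \<zero>\<^bsub>dsum J M\<^esub>"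
      by (intro bexI[of _ "\<lambda>j\<in>J. \<ominus>\<^bsub>M j\<^esub> x j"])
        (auto simp: dsum_simps PiE_iff intro!: restrict_ext abelian_group.l_neg[OF ag]
          abelian_group.a_inv_closed[OF ag])
  next
    fix x assume x: "x \<in> carrier (dsum J M)"
    show "\<zero>\<^bsub>dsum J M\<^esub> \<oplus>\<^bsub>dsum J M\<^esub> x = x" "\<one>\<^bsub>R\<^esub> \<odot>\<^bsub>dsum J M\<^esub> x = x"
      using x assms am
      by (auto simp: dsum_simps PiE_iff extensional_def abelian_monoid.l_zero right_module.act_one
          intro!: ext)
  qed (use assms am in \<open>auto simp: dsum_simps PiE_iff abelian_monoid.a_assoc
        abelian_monoid.zero_closed abelian_monoid.a_closed right_module.act_closed[OF assms(2)]
        right_module.act_add[OF assms(2)] right_module.act_distr[OF assms(2)]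
        right_module.act_mult[OF assms(2)]
        intro!: restrict_ext abelian_monoid.a_comm\<close>)
qed

lemma regular_simps [simp]:
  "carrier (regular R) = carrier R" "zero (regular R) = \<zero>\<^bsub>R\<^esub>" "add (regular R) = add R"
  "smult (regular R) = (\<lambda>a x. x \<otimes>\<^bsub>R\<^esub> a)"
  by (simp_all add: regular_def)

lemma regular_right_module:
  assumes "ring R" shows "right_module R (regular R)"
proof -
  interpret ring R by fact
  show ?thesis
  proof (rule right_moduleI)
    fix x assume x: "x \<in> carrier (regular R)"
    then show "\<exists>y\<in>carrier (regular R). y \<oplus>\<^bsub>regular R\<^esub> x = \<zero>\<^bsub>regular R\<^esub>"
      by (intro bexI[of _ "\<ominus>\<^bsub>R\<^esub> x"]) (auto intro: l_neg)
  qed (auto simp: a_assoc m_assoc r_distr l_distr ring_axioms intro: a_comm)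
qed

section \<open>Homomorphisms\<close>

lemma mod_homI:
  assumes "\<And>x. x \<in> carrier M \<Longrightarrow> h x \<in> carrier N"
    "\<And>x y. x \<in> carrier M \<Longrightarrow> y \<in> carrier M \<Longrightarrow> h (x \<oplus>\<^bsub>M\<^esub> y) = h x \<oplus>\<^bsub>N\<^esub> h y"
    "\<And>a x. a \<in> carrier R \<Longrightarrow> x \<in> carrier M \<Longrightarrow> h (a \<odot>\<^bsub>M\<^esub> x) = a \<odot>\<^bsub>N\<^esub> h x"
  shows "mod_hom R M N h"
  using assms by (auto simp: mod_hom_def)

lemma mod_homD:
  assumes "mod_hom R M N h"
  shows "x \<in> carrier M \<Longrightarrow> h x \<in> carrier N"
    "x \<in> carrier M \<Longrightarrow> y \<in> carrier M \<Longrightarrow> h (x \<oplus>\<^bsub>M\<^esub> y) = h x \<oplus>\<^bsub>N\<^esub> h y"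
    "a \<in> carrier R \<Longrightarrow> x \<in> carrier M \<Longrightarrow> h (a \<odot>\<^bsub>M\<^esub> x) = a \<odot>\<^bsub>N\<^esub> h x"
  using assms by (auto simp: mod_hom_def)

lemma mod_hom_zero:
  assumes "mod_hom R M N h" "right_module R M" "right_module R N"
  shows "h \<zero>\<^bsub>M\<^esub> = \<zero>\<^bsub>N\<^esub>"
proof -
  interpret M: right_module R M by fact
  interpret N: right_module R N by fact
  show ?thesis
    by (metis M.R.zero_closed M.M.zero_closed M.zero_act N.zero_act mod_homD(1,3)[OF assms(1)])
qed

lemma mod_hom_neg:
  assumes "mod_hom R M N h" "right_module R M" "right_module R N" "x \<in> carrier M"
  shows "h (\<ominus>\<^bsub>M\<^esub> x) = \<ominus>\<^bsub>N\<^esub> h x"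
proof -
  interpret M: right_module R M by fact
  interpret N: right_module R N by fact
  show ?thesis
    using mod_homD(3)[OF assms(1), of "\<ominus>\<^bsub>R\<^esub> \<one>\<^bsub>R\<^esub>" x] mod_homD(1)[OF assms(1)] assms(4)
    by (simp add: M.minus_one_act N.minus_one_act)
qed

lemma mod_hom_minus:
  assumes "mod_hom R M N h" "right_module R M" "right_module R N" "x \<in> carrier M" "y \<in> carrier M"
  shows "h (x \<ominus>\<^bsub>M\<^esub> y) = h x \<ominus>\<^bsub>N\<^esub> h y"
proof -
  interpret M: right_module R M by fact
  show ?thesis
    unfolding a_minus_def using assms by (simp add: mod_homD(2)[OF assms(1)] mod_hom_neg[OF
      assms(1)])
qed

lemma mod_hom_comp:
  assumes "mod_hom R M N g" "mod_hom R N L h" shows "mod_hom R M L (\<lambda>x. h (g x))"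
  using assms by (auto simp: mod_hom_def Pi_iff)

lemma mod_hom_compo:
  assumes "mod_hom R M N g" "mod_hom R N L h" shows "mod_hom R M L (h \<circ> g)"
  using assms by (auto simp: mod_hom_def Pi_iff)

lemma mod_hom_id: "mod_hom R M M (\<lambda>x. x)"
  by (auto simp: mod_hom_def)

lemma mod_hom_cong:
  assumes "mod_hom R M N h" "right_module R M" "\<And>x. x \<in> carrier M \<Longrightarrow> h' x = h x"
  shows "mod_hom R M N h'"
proof -
  interpret right_module R M by fact
  show ?thesis using assms(1,3) by (auto simp: mod_hom_def Pi_iff)
qed

lemma mod_hom_const_zero:
  assumes "right_module R N" shows "mod_hom R M N (\<lambda>x. \<zero>\<^bsub>N\<^esub>)"
proof -
  interpret right_module R N by fact
  show ?thesis by (auto simp: mod_hom_def)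
qed

lemma mod_hom_add:
  assumes "mod_hom R M N g" "mod_hom R M N h" "right_module R N"
  shows "mod_hom R M N (\<lambda>x. g x \<oplus>\<^bsub>N\<^esub> h x)"
proof -
  interpret N: right_module R N by fact
  note g = mod_homD[OF assms(1)] and h = mod_homD[OF assms(2)]
  show ?thesis
    by (rule mod_homI) (simp_all add: g h N.act_distr N.M.a_ac)
qed

lemma mod_hom_uminus:
  assumes "mod_hom R M N h" "right_module R N"
  shows "mod_hom R M N (\<lambda>x. \<ominus>\<^bsub>N\<^esub> h x)"
proof -
  interpret N: right_module R N by fact
  note h = mod_homD[OF assms(1)]
  show ?thesis
    by (rule mod_homI) (simp_all add: h N.act_minus N.M.minus_add)
qed

lemma mod_hom_diff:
  assumes "mod_hom R M N g" "mod_hom R M N h" "right_module R N"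
  shows "mod_hom R M N (\<lambda>x. g x \<ominus>\<^bsub>N\<^esub> h x)"
  unfolding a_minus_def using assms by (intro mod_hom_add mod_hom_uminus)

lemma mod_hom_inv:
  assumes "mod_hom R M N h" "bij_betw h (carrier M) (carrier N)" "right_module R M" "right_module
    R N"
  shows "mod_hom R N M (inv_into (carrier M) h)"
proof -
  interpret M: right_module R M by fact
  interpret N: right_module R N by fact
  note h = mod_homD[OF assms(1)]
  have inj: "inj_on h (carrier M)" and im: "h ` carrier M = carrier N"
    using assms(2) by (auto simp: bij_betw_def)
  let ?i = "inv_into (carrier M) h"
  have cl: "?i x \<in> carrier M" and hi: "h (?i x) = x" if "x \<in> carrier N" for x
    using that im by (auto simp: inv_into_into f_inv_into_f)
  show ?thesis
  proof (rule mod_homI)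
    fix x y assume "x \<in> carrier N" "y \<in> carrier N"
    then show "?i (x \<oplus>\<^bsub>N\<^esub> y) = ?i x \<oplus>\<^bsub>M\<^esub> ?i y"
      by (intro inj_onD[OF inj]) (simp_all add: h cl hi)
  next
    fix a x assume "a \<in> carrier R" "x \<in> carrier N"
    then show "?i (a \<odot>\<^bsub>N\<^esub> x) = a \<odot>\<^bsub>M\<^esub> ?i x"
      by (intro inj_onD[OF inj]) (simp_all add: h cl hi)
  qed (rule cl)
qed

lemma mod_hom_inj_iff:
  assumes "mod_hom R M N h" "right_module R M" "right_module R N"
  shows "inj_on h (carrier M) \<longleftrightarrow> (\<forall>x\<in>carrier M. h x = \<zero>\<^bsub>N\<^esub> \<longrightarrow> x = \<zero>\<^bsub>M\<^esub>)"
proof -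
  interpret M: right_module R M by fact
  interpret N: right_module R N by fact
  show ?thesis
  proof
    assume "inj_on h (carrier M)"
    then show "\<forall>x\<in>carrier M. h x = \<zero>\<^bsub>N\<^esub> \<longrightarrow> x = \<zero>\<^bsub>M\<^esub>"
      using mod_hom_zero[OF assms] by (metis M.M.zero_closed inj_onD)
  next
    assume *: "\<forall>x\<in>carrier M. h x = \<zero>\<^bsub>N\<^esub> \<longrightarrow> x = \<zero>\<^bsub>M\<^esub>"
    show "inj_on h (carrier M)"
    proof (rule inj_onI)
      fix x y assume xy: "x \<in> carrier M" "y \<in> carrier M" "h x = h y"
      then have "h (x \<ominus>\<^bsub>M\<^esub> y) = \<zero>\<^bsub>N\<^esub>"
        using mod_homD(1)[OF assms(1)]
        by (simp add: mod_hom_minus[OF assms] N.minus_self)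
      with * xy have "x \<ominus>\<^bsub>M\<^esub> y = \<zero>\<^bsub>M\<^esub>" by simp
      then show "x = y" using xy M.minus_eq_zeroD by blast
    qed
  qed
qed

lemma ker_submodule:
  assumes "mod_hom R M N h" "right_module R M" "right_module R N"
  shows "submodule (ker M N h) R M"
proof -
  interpret M: right_module R M by fact
  interpret N: right_module R N by fact
  show ?thesis
    by (rule right_submoduleI[OF assms(2)])
      (auto simp: ker_def mod_homD[OF assms(1)] mod_hom_zero[OF assms])
qed

lemma image_submodule:
  assumes "mod_hom R M N h" "right_module R M" "right_module R N"
  shows "submodule (h ` carrier M) R N"
proof -
  interpret M: right_module R M by fact
  interpret N: right_module R N by fact
  show ?thesis
  proof (rule right_submoduleI[OF assms(3)])
    show "\<zero>\<^bsub>N\<^esub> \<in> h ` carrier M"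
      using mod_hom_zero[OF assms] by (metis M.M.zero_closed imageI)
  next
    fix x y assume "x \<in> h ` carrier M" "y \<in> h ` carrier M"
    then show "x \<oplus>\<^bsub>N\<^esub> y \<in> h ` carrier M"
      by (auto simp: mod_homD(2)[OF assms(1), symmetric])
  next
    fix a x assume "a \<in> carrier R" "x \<in> h ` carrier M"
    then show "a \<odot>\<^bsub>N\<^esub> x \<in> h ` carrier M"
      by (auto simp: mod_homD(3)[OF assms(1), symmetric])
  qed (use mod_homD(1)[OF assms(1)] in auto)
qed

lemma mod_hom_dsum2:
  assumes "mod_hom R M N g" "mod_hom R M L h"
  shows "mod_hom R M (dsum2 N L) (\<lambda>x. (g x, h x))"
  using assms by (auto simp: mod_hom_def)

lemma mod_hom_fst: "mod_hom R (dsum2 M N) M fst"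
  by (auto simp: mod_hom_def)

lemma mod_hom_snd: "mod_hom R (dsum2 M N) N snd"
  by (auto simp: mod_hom_def)

lemma mod_hom_dsum:
  assumes "\<And>j. j \<in> J \<Longrightarrow> mod_hom R M (N j) (h j)"
  shows "mod_hom R M (dsum J N) (\<lambda>x. \<lambda>j\<in>J. h j x)"
  using assms by (auto simp: mod_hom_def dsum_simps Pi_iff intro!: restrict_ext)

lemma mod_hom_proj: "j \<in> J \<Longrightarrow> mod_hom R (dsum J N) (N j) (\<lambda>x. x j)"
  by (auto simp: mod_hom_def dsum_simps)

text \<open>Two preimages of an element differ by an element of the kernel of g, on which u
  vanishes, so u of a chosen preimage does not depend on the choice. This is how maps are descended
  to a cokernel that is given only by a surjection.\<close>

lemma mod_hom_factor:
  assumes g: "mod_surj R M N g" and u: "mod_hom R M L u"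
    and M: "right_module R M" and N: "right_module R N" and L: "right_module R L"
    and ker: "\<And>x. x \<in> carrier M \<Longrightarrow> g x = \<zero>\<^bsub>N\<^esub> \<Longrightarrow> u x = \<zero>\<^bsub>L\<^esub>"
  shows "\<exists>s. mod_hom R N L s \<and> (\<forall>x\<in>carrier M. s (g x) = u x)"
proof -
  interpret M: right_module R M by fact
  interpret N: right_module R N by fact
  interpret L: right_module R L by fact
  have gh: "mod_hom R M N g" and im: "g ` carrier M = carrier N" using g by (auto simp:
    mod_surj_def)
  note gD = mod_homD[OF gh] and uD = mod_homD[OF u]
  define s where "s y = u (inv_into (carrier M) g y)" for y
  have s: "s (g x) = u x" if x: "x \<in> carrier M" for x
  proof -
    let ?x = "inv_into (carrier M) g (g x)"
    have x': "?x \<in> carrier M" "g ?x = g x" using x by (auto simp: inv_into_into f_inv_into_f)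
    then have "g (?x \<ominus>\<^bsub>M\<^esub> x) = \<zero>\<^bsub>N\<^esub>"
      using x gD(1) by (simp add: mod_hom_minus[OF gh M N] N.minus_self)
    then have "u (?x \<ominus>\<^bsub>M\<^esub> x) = \<zero>\<^bsub>L\<^esub>" using x x' by (simp add: ker)
    then have "u ?x \<ominus>\<^bsub>L\<^esub> u x = \<zero>\<^bsub>L\<^esub>" using x x' by (simp add: mod_hom_minus[OF u M L])
    then have "u ?x = u x" using x x' uD(1) L.minus_eq_zeroD by blast
    then show ?thesis by (simp add: s_def)
  qed
  have "mod_hom R N L s"
  proof (rule mod_homI)
    fix x assume "x \<in> carrier N"
    then obtain x' where "x' \<in> carrier M" "x = g x'" using im by auto
    then show "s x \<in> carrier L" by (simp add: s uD)
  next
    fix x y assume "x \<in> carrier N" "y \<in> carrier N"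
    then obtain x' y' where "x' \<in> carrier M" "x = g x'" "y' \<in> carrier M" "y = g y'"
      unfolding im[symmetric] by blast
    then show "s (x \<oplus>\<^bsub>N\<^esub> y) = s x \<oplus>\<^bsub>L\<^esub> s y"
      using s[of "x' \<oplus>\<^bsub>M\<^esub> y'"] s[of x'] s[of y'] by (simp add: uD gD)
  next
    fix a x assume "a \<in> carrier R" "x \<in> carrier N"
    then obtain x' where "x' \<in> carrier M" "x = g x'" "a \<in> carrier R" using im by auto
    then show "s (a \<odot>\<^bsub>N\<^esub> x) = a \<odot>\<^bsub>L\<^esub> s x"
      using s[of "a \<odot>\<^bsub>M\<^esub> x'"] s[of x'] by (simp add: uD gD)
  qed
  with s show ?thesis by blast
qed

section \<open>Images under maps whose kernel pair is a congruence\<close>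

text \<open>Quotients without a type of cosets: if the fibres of \<kappa> are the classes of a
  congruence, the images under \<kappa> stand for the classes and the operations are read off from
  chosen preimages. The target type of \<kappa> is free, so a quotient can be placed on lists of
  scalars.\<close>

definition image_module :: "('a, 'm) module \<Rightarrow> ('m \<Rightarrow> 'n) \<Rightarrow> ('a, 'n) module" where
  "image_module M \<kappa> = (let d = inv_into (carrier M) \<kappa> in mk_module (\<kappa> ` carrier M)
    (\<lambda>u v. \<kappa> (d u \<oplus>\<^bsub>M\<^esub> d v)) (\<kappa> \<zero>\<^bsub>M\<^esub>) (\<lambda>a u. \<kappa> (a \<odot>\<^bsub>M\<^esub> d u)))"

lemma image_module:
  assumes M: "right_module R M"
    and add: "\<And>x y x' y'. x \<in> carrier M \<Longrightarrow> y \<in> carrier M \<Longrightarrow> x' \<in> carrier M \<Longrightarrow> y' \<in> carrier M \<Longrightarrow>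
      \<kappa> x = \<kappa> x' \<Longrightarrow> \<kappa> y = \<kappa> y' \<Longrightarrow> \<kappa> (x \<oplus>\<^bsub>M\<^esub> y) = \<kappa> (x' \<oplus>\<^bsub>M\<^esub> y')"
    and act: "\<And>a x x'. a \<in> carrier R \<Longrightarrow> x \<in> carrier M \<Longrightarrow> x' \<in> carrier M \<Longrightarrow>
      \<kappa> x = \<kappa> x' \<Longrightarrow> \<kappa> (a \<odot>\<^bsub>M\<^esub> x) = \<kappa> (a \<odot>\<^bsub>M\<^esub> x')"
  shows "right_module R (image_module M \<kappa>)" "mod_surj R M (image_module M \<kappa>) \<kappa>"
proof -
  interpret M: right_module R M by fact
  let ?N = "image_module M \<kappa>"
  have c: "carrier ?N = \<kappa> ` carrier M" and z: "zero ?N = \<kappa> \<zero>\<^bsub>M\<^esub>"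
    by (simp_all add: image_module_def Let_def)
  let ?d = "inv_into (carrier M) \<kappa>"
  have d: "?d (\<kappa> x) \<in> carrier M" "\<kappa> (?d (\<kappa> x)) = \<kappa> x" if "x \<in> carrier M" for x
    using that by (auto simp: inv_into_into f_inv_into_f)
  have a: "\<kappa> x \<oplus>\<^bsub>?N\<^esub> \<kappa> y = \<kappa> (x \<oplus>\<^bsub>M\<^esub> y)" if "x \<in> carrier M" "y \<in> carrier M" for x y
    using that d by (auto simp: image_module_def Let_def intro!: add)
  have s: "a \<odot>\<^bsub>?N\<^esub> \<kappa> x = \<kappa> (a \<odot>\<^bsub>M\<^esub> x)" if "x \<in> carrier M" "a \<in> carrier R" for x a
    using that d by (auto simp: image_module_def Let_def intro!: act)
  show "right_module R ?N"
  proof (rule right_moduleI)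
    fix x assume "x \<in> carrier ?N"
    then obtain x' where x': "x' \<in> carrier M" "x = \<kappa> x'" by (auto simp: c)
    then show "\<exists>y\<in>carrier ?N. y \<oplus>\<^bsub>?N\<^esub> x = \<zero>\<^bsub>?N\<^esub>"
      by (intro bexI[of _ "\<kappa> (\<ominus>\<^bsub>M\<^esub> x')"]) (auto simp: a c z M.l_neg)
  qed (auto simp: c z a s M.act_add M.act_distr M.act_mult M.act_one M.a_ac M.R.ring_axioms)
  show "mod_surj R M ?N \<kappa>"
    by (auto simp: mod_surj_def c a s intro!: mod_homI)
qed

section \<open>Finite dimension\<close>

text \<open>
  Both \<open>A\<close> and \<open>opposite A\<close> are instances; scalars enter modules only through $c \cdot 1_A$.
\<close>

locale kalgebra = ring A for A :: "('k::field, 'a) module" (structure) +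
  assumes scalar_closed [simp]: "c \<odot>\<^bsub>A\<^esub> \<one>\<^bsub>A\<^esub> \<in> carrier A"
    and scalar_add: "(c + d) \<odot>\<^bsub>A\<^esub> \<one>\<^bsub>A\<^esub> = (c \<odot>\<^bsub>A\<^esub> \<one>\<^bsub>A\<^esub>) \<oplus>\<^bsub>A\<^esub> (d \<odot>\<^bsub>A\<^esub> \<one>\<^bsub>A\<^esub>)"
    and scalar_mult: "(c * d) \<odot>\<^bsub>A\<^esub> \<one>\<^bsub>A\<^esub> = (c \<odot>\<^bsub>A\<^esub> \<one>\<^bsub>A\<^esub>) \<otimes>\<^bsub>A\<^esub> (d \<odot>\<^bsub>A\<^esub> \<one>\<^bsub>A\<^esub>)"
    and scalar_one: "1 \<odot>\<^bsub>A\<^esub> \<one>\<^bsub>A\<^esub> = \<one>\<^bsub>A\<^esub>"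
    and scalar_central: "x \<in> carrier A \<Longrightarrow>
      (c \<odot>\<^bsub>A\<^esub> \<one>\<^bsub>A\<^esub>) \<otimes>\<^bsub>A\<^esub> x = x \<otimes>\<^bsub>A\<^esub> (c \<odot>\<^bsub>A\<^esub> \<one>\<^bsub>A\<^esub>)"
begin

lemma scal_closed: "right_module A M \<Longrightarrow> x \<in> carrier M \<Longrightarrow> scal A M c x \<in> carrier M"
  by (simp add: scal_def right_module.act_closed)

lemma scal_plus: "right_module A M \<Longrightarrow> x \<in> carrier M \<Longrightarrow>
    scal A M (c + d) x = scal A M c x \<oplus>\<^bsub>M\<^esub> scal A M d x"
  by (simp add: scal_def scalar_add right_module.act_add)

lemma scal_add: "right_module A M \<Longrightarrow> x \<in> carrier M \<Longrightarrow> y \<in> carrier M \<Longrightarrow>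
    scal A M c (x \<oplus>\<^bsub>M\<^esub> y) = scal A M c x \<oplus>\<^bsub>M\<^esub> scal A M c y"
  by (simp add: scal_def right_module.act_distr)

lemma scal_mult: "right_module A M \<Longrightarrow> x \<in> carrier M \<Longrightarrow>
    scal A M (c * d) x = scal A M c (scal A M d x)"
  \<comment> \<open>A right action reverses products, so the two scalars would come out in the wrong
    order; commutativity of K is applied first.\<close>
  unfolding mult.commute[of c d] by (simp add: scal_def scalar_mult right_module.act_mult)

lemma scal_one: "right_module A M \<Longrightarrow> x \<in> carrier M \<Longrightarrow> scal A M 1 x = x"
  by (simp add: scal_def scalar_one right_module.act_one)

lemma scal_zero_left: "right_module A M \<Longrightarrow> x \<in> carrier M \<Longrightarrow> scal A M 0 x = \<zero>\<^bsub>M\<^esub>"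
proof -
  assume M: "right_module A M" and x: "x \<in> carrier M"
  interpret right_module A M by fact
  have "scal A M 0 x \<oplus>\<^bsub>M\<^esub> scal A M 0 x = scal A M 0 x"
    using scal_plus[OF M x, of 0 0] by simp
  then show ?thesis using scal_closed[OF M x, of 0] by simp
qed

lemma scal_zero: "right_module A M \<Longrightarrow> scal A M c \<zero>\<^bsub>M\<^esub> = \<zero>\<^bsub>M\<^esub>"
  by (simp add: scal_def right_module.act_zero)

lemma mod_hom_scal: "mod_hom A M N h \<Longrightarrow> x \<in> carrier M \<Longrightarrow> h (scal A M c x) = scal A N c (h x)"
  by (simp add: scal_def mod_homD(3))

definition subspace :: "('a, 'm) module \<Rightarrow> 'm set \<Rightarrow> bool" where
  "subspace M S \<longleftrightarrow> S \<subseteq> carrier M \<and> \<zero>\<^bsub>M\<^esub> \<in> S \<and> (\<forall>x\<in>S. \<forall>y\<in>S. x \<oplus>\<^bsub>M\<^esub> y \<in> S) \<and>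
    (\<forall>c. \<forall>x\<in>S. scal A M c x \<in> S)"

text \<open>Spanning is phrased through subspaces instead of linear combinations. It then acts as an
  induction principle: images and direct sums are handled by pulling subspaces back, without
  manipulating coefficients.\<close>

definition spanning :: "('a, 'm) module \<Rightarrow> 'm set \<Rightarrow> bool" where
  "spanning M B \<longleftrightarrow> finite B \<and> B \<subseteq> carrier M \<and> (\<forall>S. subspace M S \<and> B \<subseteq> S \<longrightarrow> carrier M \<subseteq> S)"

lemma spanningD: "spanning M B \<Longrightarrow> subspace M S \<Longrightarrow> B \<subseteq> S \<Longrightarrow> carrier M \<subseteq> S"
  by (simp add: spanning_def)

lemma finsum_scal_in_subspace:
  assumes M: "right_module A M" and S: "subspace M S" "B \<subseteq> S" and B: "finite B"
  shows "(\<Oplus>\<^bsub>M\<^esub>b\<in>B. scal A M (c b) b) \<in> S"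
proof -
  interpret right_module A M by fact
  have sub: "S \<subseteq> carrier M" using S by (simp add: subspace_def)
  from B S(2) show ?thesis
  proof (induction B)
    case (insert b B)
    then have "b \<in> carrier M" "B \<subseteq> carrier M" using sub by auto
    then show ?case using insert S(1)
      by (subst M.finsum_insert) (auto simp: subspace_def intro!: scal_closed[OF M])
  qed (use S in \<open>simp add: subspace_def\<close>)
qed

text \<open>The linear combinations of B form a subspace containing B, so spanning in the sense of
  subspaces yields coefficients. Conversely a subspace that contains B contains every
  combination.\<close>

lemma fd_module_iff: "fd_module A M \<longleftrightarrow> right_module A M \<and> (\<exists>B. spanning M B)"
proof (cases "right_module A M")
  case M: True
  interpret right_module A M by fact
  show ?thesis
  proof
    assume "fd_module A M"
    then obtain B where B: "finite B" "B \<subseteq> carrier M"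
      "\<forall>x\<in>carrier M. \<exists>c. x = (\<Oplus>\<^bsub>M\<^esub>b\<in>B. scal A M (c b) b)"
      by (auto simp: fd_module_def)
    have "spanning M B"
      unfolding spanning_def using B finsum_scal_in_subspace[OF M] by (metis subsetI)
    then show "right_module A M \<and> (\<exists>B. spanning M B)" using M by blast
  next
    assume "right_module A M \<and> (\<exists>B. spanning M B)"
    then obtain B where B: "spanning M B" by blast
    then have fin: "finite B" and BM: "B \<subseteq> carrier M" by (auto simp: spanning_def)
    let ?f = "\<lambda>c. \<Oplus>\<^bsub>M\<^esub>b\<in>B. scal A M (c b) b"
    have cl: "(\<lambda>b. scal A M (c b) b) \<in> B \<rightarrow> carrier M" for c
      using BM by (auto intro: scal_closed[OF M])
    have "subspace M (range ?f)"
      unfolding subspace_def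
    proof (intro conjI ballI allI)
      show "range ?f \<subseteq> carrier M" using cl by auto
      have "\<zero>\<^bsub>M\<^esub> = ?f (\<lambda>_. 0)"
        using BM by (intro M.add.finprod_one_eqI[symmetric]) (auto simp: scal_zero_left[OF M])
      then show "\<zero>\<^bsub>M\<^esub> \<in> range ?f" by (rule range_eqI[where f = ?f])
      fix x y assume "x \<in> range ?f" "y \<in> range ?f"
      then obtain c d where cd: "x = ?f c" "y = ?f d" by blast
      have "?f (\<lambda>b. c b + d b) = (\<Oplus>\<^bsub>M\<^esub>b\<in>B. scal A M (c b) b \<oplus>\<^bsub>M\<^esub> scal A M (d b) b)"
        using BM by (intro M.finsum_cong') (auto simp: scal_plus[OF M] scal_closed[OF M])
      also have "\<dots> = x \<oplus>\<^bsub>M\<^esub> y" unfolding cd using cl by (intro M.finsum_addf) auto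
      finally show "x \<oplus>\<^bsub>M\<^esub> y \<in> range ?f" by (intro range_eqI[where f = ?f]) (rule sym)
    next
      fix d x assume "x \<in> range ?f"
      then obtain c where c: "x = ?f c" by blast
      have "scal A M d (\<Oplus>\<^bsub>M\<^esub>b\<in>F. scal A M (c b) b) = (\<Oplus>\<^bsub>M\<^esub>b\<in>F. scal A M (d * c b) b)"
        if "finite F" "F \<subseteq> B" for F
        using that
      proof (induction F)
        case (insert b F)
        then have bF: "b \<in> carrier M" "F \<subseteq> carrier M" using BM by auto
        have "(\<lambda>b. scal A M (c b) b) \<in> F \<rightarrow> carrier M" "(\<lambda>b. scal A M (d * c b) b) \<in> F \<rightarrow> carrier M"
          using bF by (auto intro: scal_closed[OF M])
        then show ?case using insert bF
          by (simp add: M.finsum_insert scal_add[OF M] scal_mult[OF M] scal_closed[OF M])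
      qed (simp add: scal_zero[OF M])
      from this[OF fin] c have "scal A M d x = ?f (\<lambda>b. d * c b)" by simp
      then show "scal A M d x \<in> range ?f" by (rule range_eqI[where f = ?f])
    qed
    moreover have "B \<subseteq> range ?f"
    proof
      fix b assume b: "b \<in> B"
      then have bM: "b \<in> carrier M" using BM by auto
      have "?f (\<lambda>x. if x = b then 1 else 0) = (\<Oplus>\<^bsub>M\<^esub>x\<in>B. if b = x then x else \<zero>\<^bsub>M\<^esub>)"
        using BM by (intro M.finsum_cong') (auto simp: scal_one[OF M] scal_zero_left[OF M])
      also have "\<dots> = b" using BM fin b by (intro M.finsum_singleton) auto
      finally show "b \<in> range ?f" by (intro range_eqI[where f = ?f]) (rule sym)
    qed
    ultimately have "carrier M \<subseteq> range ?f" using B by (auto simp: spanning_def)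
    then show "fd_module A M" using M fin BM unfolding fd_module_def by blast
  qed
qed (auto simp: fd_module_def)

text \<open>Preimages of subspaces are subspaces, so the image of a spanning set spans.\<close>

lemma fd_image:
  assumes "fd_module A M" "mod_surj A M N h" "right_module A N"
  shows "fd_module A N"
proof -
  from assms obtain B where M: "right_module A M" and B: "spanning M B" by (auto simp:
    fd_module_iff)
  interpret M: right_module A M by fact
  interpret N: right_module A N by fact
  have h: "mod_hom A M N h" and im: "h ` carrier M = carrier N" using assms by (auto simp:
    mod_surj_def)
  have "spanning N (h ` B)"
    unfolding spanning_def
  proof (intro conjI allI impI)
    fix S assume S: "subspace N S \<and> h ` B \<subseteq> S"
    have "subspace M {x \<in> carrier M. h x \<in> S}"
      using S unfolding subspace_def
      by (auto simp: mod_homD[OF h] mod_hom_zero[OF h M assms(3)] scal_closed[OF M]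
        mod_hom_scal[OF h])
    then have "carrier M \<subseteq> {x \<in> carrier M. h x \<in> S}"
      using B S by (intro spanningD) (auto simp: spanning_def)
    then show "carrier N \<subseteq> S" unfolding im[symmetric] by auto
  qed (use B mod_homD(1)[OF h] in \<open>auto simp: spanning_def\<close>)
  with assms(3) show ?thesis by (auto simp: fd_module_iff)
qed

lemma fd_zero_sub: "right_module A M \<Longrightarrow> fd_module A (zero_sub M)"
  unfolding fd_module_iff
  by (intro conjI exI[of _ "{}"]) (auto simp: zero_sub_right_module spanning_def subspace_def)

text \<open>A subspace that contains the embedded spanning sets contains every embedded summand, as
  its pullback along \<open>inj j\<close> shows. An arbitrary element is then reached by switching
  on its coordinates one at a time.\<close>

lemma fd_dsum:
  assumes J: "finite J" and M: "\<And>j. j \<in> J \<Longrightarrow> fd_module A (M j)"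
  shows "fd_module A (dsum J M)"
proof -
  have rm: "right_module A (M j)" if "j \<in> J" for j using M[OF that] by (simp add: fd_module_iff)
  have rD: "right_module A (dsum J M)" using rm by (rule dsum_right_module[OF ring_axioms])
  interpret D: right_module A "dsum J M" by fact
  obtain B where B: "\<And>j. j \<in> J \<Longrightarrow> spanning (M j) (B j)"
    using M unfolding fd_module_iff by metis
  define inj where "inj j x = (\<lambda>i\<in>J. if i = j then x else \<zero>\<^bsub>M i\<^esub>)" for j x
  note zc = rm[THEN right_module.axioms(2), THEN abelian_group.axioms(1)]
  have inj_hom: "mod_hom A (M j) (dsum J M) (inj j)" if "j \<in> J" for j
  proof (rule mod_homI)
    fix x assume "x \<in> carrier (M j)"
    then show "inj j x \<in> carrier (dsum J M)"
      by (auto simp: inj_def dsum_simps abelian_monoid.zero_closed[OF zc])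
  next
    fix x y assume "x \<in> carrier (M j)" "y \<in> carrier (M j)"
    show "inj j (x \<oplus>\<^bsub>M j\<^esub> y) = inj j x \<oplus>\<^bsub>dsum J M\<^esub> inj j y"
      unfolding inj_def dsum_simps
      by (rule restrict_ext) (auto simp: abelian_monoid.zero_closed[OF zc]
        abelian_monoid.l_zero[OF zc])
  next
    fix a x assume "a \<in> carrier A" "x \<in> carrier (M j)"
    then show "inj j (a \<odot>\<^bsub>M j\<^esub> x) = a \<odot>\<^bsub>dsum J M\<^esub> inj j x"
      unfolding inj_def dsum_simps
      by (intro restrict_ext) (auto simp: right_module.act_zero[OF rm])
  qed
  define C where "C = (\<Union>j\<in>J. inj j ` B j)"
  have "spanning (dsum J M) C"
    unfolding spanning_def
  proof (intro conjI allI impI)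
    show "finite C" using J B by (simp add: C_def spanning_def)
    show "C \<subseteq> carrier (dsum J M)"
    proof
      fix y assume "y \<in> C"
      then obtain j x where j: "j \<in> J" "x \<in> B j" "y = inj j x" by (auto simp: C_def)
      then have "x \<in> carrier (M j)" using B[OF j(1)] by (auto simp: spanning_def)
      then show "y \<in> carrier (dsum J M)" using j mod_homD(1)[OF inj_hom] by blast
    qed
    fix S assume S: "subspace (dsum J M) S \<and> C \<subseteq> S"
    have inj_S: "inj j x \<in> S" if j: "j \<in> J" "x \<in> carrier (M j)" for j x
    proof -
      have "subspace (M j) {x \<in> carrier (M j). inj j x \<in> S}"
        using S j unfolding subspace_def
        by (auto simp: mod_homD[OF inj_hom] mod_hom_zero[OF inj_hom rm rD] scal_closed[OF rm]
            mod_hom_scal[OF inj_hom] abelian_monoid.a_closed[OF zc] abelian_monoid.zero_closed[OF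
              zc])
      moreover have "B j \<subseteq> {x \<in> carrier (M j). inj j x \<in> S}"
        using B[OF j(1)] j S by (auto simp: spanning_def C_def)
      ultimately show ?thesis using spanningD[OF B[OF j(1)]] j(2) by blast
    qed
    show "carrier (dsum J M) \<subseteq> S"
    proof
      fix x assume x: "x \<in> carrier (dsum J M)"
      have "(\<lambda>i\<in>J. if i \<in> F then x i else \<zero>\<^bsub>M i\<^esub>) \<in> S" if "finite F" "F \<subseteq> J" for F
        using that
      proof (induction F)
        case empty
        then show ?case using S by (simp add: subspace_def dsum_simps restrict_def)
      next
        case (insert j F)
        have xi: "x i \<in> carrier (M i)" if "i \<in> J" for i using x that by (auto simp: dsum_simps)
        have eq: "(\<lambda>i\<in>J. if i \<in> insert j F then x i else \<zero>\<^bsub>M i\<^esub>) =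
          inj j (x j) \<oplus>\<^bsub>dsum J M\<^esub> (\<lambda>i\<in>J. if i \<in> F then x i else \<zero>\<^bsub>M i\<^esub>)"
          using insert.hyps insert.prems xi abelian_monoid.l_zero[OF zc] abelian_monoid.r_zero[OF
            zc]
            abelian_monoid.zero_closed[OF zc]
          by (auto simp: dsum_simps inj_def intro!: restrict_ext)
        have "inj j (x j) \<in> S" "(\<lambda>i\<in>J. if i \<in> F then x i else \<zero>\<^bsub>M i\<^esub>) \<in> S"
          using insert.IH insert.prems inj_S[of j "x j"] xi by blast+
        then show ?case unfolding eq using S unfolding subspace_def by blast
      qed
      from this[OF J order_refl]
      have "(\<lambda>i\<in>J. if i \<in> J then x i else \<zero>\<^bsub>M i\<^esub>) \<in> S" .
      also have "(\<lambda>i\<in>J. if i \<in> J then x i else \<zero>\<^bsub>M i\<^esub>) = x"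
        using x by (auto simp: dsum_simps PiE_iff extensional_def)
      finally show "x \<in> S" .
    qed
  qed
  with rD show ?thesis by (auto simp: fd_module_iff)
qed

lemma fd_dsum2:
  assumes "fd_module A M" "fd_module A N"
  shows "fd_module A (dsum2 M N)"
proof -
  from assms obtain B C where M: "right_module A M" and B: "spanning M B"
    and N: "right_module A N" and C: "spanning N C" by (auto simp: fd_module_iff)
  interpret M: right_module A M by fact
  interpret N: right_module A N by fact
  have rD: "right_module A (dsum2 M N)" using M N by (rule dsum2_right_module)
  have i1: "mod_hom A M (dsum2 M N) (\<lambda>x. (x, \<zero>\<^bsub>N\<^esub>))"
    and i2: "mod_hom A N (dsum2 M N) (\<lambda>x. (\<zero>\<^bsub>M\<^esub>, x))"
    using mod_hom_dsum2[OF mod_hom_id mod_hom_const_zero[OF N]]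
      mod_hom_dsum2[OF mod_hom_const_zero[OF M] mod_hom_id] by auto
  have "spanning (dsum2 M N) ((\<lambda>x. (x, \<zero>\<^bsub>N\<^esub>)) ` B \<union> (\<lambda>x. (\<zero>\<^bsub>M\<^esub>, x)) ` C)" (is "spanning _ ?B")
    unfolding spanning_def
  proof (intro conjI allI impI)
    fix S assume S: "subspace (dsum2 M N) S \<and> ?B \<subseteq> S"
    have "subspace M {x \<in> carrier M. (x, \<zero>\<^bsub>N\<^esub>) \<in> S}"
      using S unfolding subspace_def
      by (auto simp: mod_homD[OF i1] mod_hom_zero[OF i1 M rD] scal_closed[OF M] mod_hom_scal[OF i1]
          simp del: dsum2_simps)
    moreover have "B \<subseteq> {x \<in> carrier M. (x, \<zero>\<^bsub>N\<^esub>) \<in> S}" using B S by (auto simp: spanning_def)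
    ultimately have 1: "carrier M \<subseteq> {x \<in> carrier M. (x, \<zero>\<^bsub>N\<^esub>) \<in> S}" using B by (simp add:
      spanning_def)
    have "subspace N {x \<in> carrier N. (\<zero>\<^bsub>M\<^esub>, x) \<in> S}"
      using S unfolding subspace_def
      by (auto simp: mod_homD[OF i2] mod_hom_zero[OF i2 N rD] scal_closed[OF N] mod_hom_scal[OF i2]
          simp del: dsum2_simps)
    moreover have "C \<subseteq> {x \<in> carrier N. (\<zero>\<^bsub>M\<^esub>, x) \<in> S}" using C S by (auto simp: spanning_def)
    ultimately have 2: "carrier N \<subseteq> {x \<in> carrier N. (\<zero>\<^bsub>M\<^esub>, x) \<in> S}" using C by (simp add:
      spanning_def)
    show "carrier (dsum2 M N) \<subseteq> S"
    proof
      fix u assume "u \<in> carrier (dsum2 M N)"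
      then obtain x y where u: "u = (x, y)" "x \<in> carrier M" "y \<in> carrier N" by auto
      then have "(x, \<zero>\<^bsub>N\<^esub>) \<in> S" "(\<zero>\<^bsub>M\<^esub>, y) \<in> S" using 1 2 by auto
      then have "(x, \<zero>\<^bsub>N\<^esub>) \<oplus>\<^bsub>dsum2 M N\<^esub> (\<zero>\<^bsub>M\<^esub>, y) \<in> S" using S unfolding subspace_def by blast
      then show "u \<in> S" using u by simp
    qed
  qed (use B C in \<open>auto simp: spanning_def\<close>)
  with rD show ?thesis by (auto simp: fd_module_iff)
qed

section \<open>Models consisting of lists of scalars\<close>

text \<open>The coefficients with respect to a finite spanning set are chosen for each element
  separately, so the coding need not be linear. Injectivity is enough, because the module structure
  is transported afterwards by \<open>image_module\<close>.\<close>

lemma fd_inj_univ: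
  assumes "fd_module A M"
  obtains e :: "'m \<Rightarrow> 'k univ" where "inj_on e (carrier (M :: ('a, 'm) module))"
proof -
  from assms obtain B where B: "finite B"
    "\<forall>x\<in>carrier M. \<exists>c. x = (\<Oplus>\<^bsub>M\<^esub>b\<in>B. scal A M (c b) b)" and BM: "B \<subseteq> carrier M"
    and M: "right_module A M"
    by (auto simp: fd_module_def)
  interpret M: right_module A M by fact
  obtain bs where bs: "set bs = B" using B(1) finite_list by blast
  obtain c where c: "\<And>x. x \<in> carrier M \<Longrightarrow> x = (\<Oplus>\<^bsub>M\<^esub>b\<in>B. scal A M (c x b) b)"
    using B(2) by metis
  have "inj_on (\<lambda>x. map (c x) bs) (carrier M)"
  proof (rule inj_onI)
    fix x y assume xy: "x \<in> carrier M" "y \<in> carrier M" "map (c x) bs = map (c y) bs"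
    then have "c x b = c y b" if "b \<in> B" for b using that bs by auto
    then have "(\<Oplus>\<^bsub>M\<^esub>b\<in>B. scal A M (c x b) b) = (\<Oplus>\<^bsub>M\<^esub>b\<in>B. scal A M (c y b) b)"
      using BM by (intro M.finsum_cong') (auto intro: scal_closed[OF M])
    then show "x = y" using c xy by metis
  qed
  then show thesis by (rule that)
qed

text \<open>A coset of H is coded by a list: \<open>r\<close> picks a representative that depends
  only on the coset, and \<open>e\<close> turns it into a list of scalars. The fibres of \<kappa> =
  e r are the cosets, so \<open>image_module\<close> gives the quotient.\<close>

lemma fd_quotient_univ:
  assumes M: "fd_module A M" and H: "submodule H A M"
  obtains N :: "('a, 'k univ) module" and \<pi>
  where "fd_module A N" "mod_surj A M N \<pi>" "ker M N \<pi> = H"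
proof -
  obtain e :: "'b \<Rightarrow> 'k univ" where e: "inj_on e (carrier M)" using fd_inj_univ[OF M] by blast
  have rM: "right_module A M" using M by (simp add: fd_module_iff)
  interpret M: right_module A M by fact
  note Hd = submoduleD[OF H]
  define r where "r x = (SOME y. y \<in> carrier M \<and> x \<ominus>\<^bsub>M\<^esub> y \<in> H)" for x
  have r: "r x \<in> carrier M \<and> x \<ominus>\<^bsub>M\<^esub> r x \<in> H" if "x \<in> carrier M" for x
    unfolding r_def by (rule someI[of _ x]) (use that Hd in \<open>simp add: M.minus_self\<close>)
  have r_eq: "r x = r y \<longleftrightarrow> x \<ominus>\<^bsub>M\<^esub> y \<in> H" if xy: "x \<in> carrier M" "y \<in> carrier M" for x y
  proof
    assume "r x = r y"
    then have "x \<ominus>\<^bsub>M\<^esub> r x \<in> H" "y \<ominus>\<^bsub>M\<^esub> r x \<in> H" using r xy by metis+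
    then have "(x \<ominus>\<^bsub>M\<^esub> r x) \<oplus>\<^bsub>M\<^esub> \<ominus>\<^bsub>M\<^esub> (y \<ominus>\<^bsub>M\<^esub> r x) \<in> H" using Hd by blast
    also have "(x \<ominus>\<^bsub>M\<^esub> r x) \<oplus>\<^bsub>M\<^esub> \<ominus>\<^bsub>M\<^esub> (y \<ominus>\<^bsub>M\<^esub> r x) = x \<ominus>\<^bsub>M\<^esub> y"
      using r xy by (simp add: M.ag_simps)
    finally show "x \<ominus>\<^bsub>M\<^esub> y \<in> H" .
  next
    assume xyH: "x \<ominus>\<^bsub>M\<^esub> y \<in> H"
    have "x \<ominus>\<^bsub>M\<^esub> z \<in> H \<longleftrightarrow> y \<ominus>\<^bsub>M\<^esub> z \<in> H" if z: "z \<in> carrier M" for z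
    proof
      assume "y \<ominus>\<^bsub>M\<^esub> z \<in> H"
      then have "(x \<ominus>\<^bsub>M\<^esub> y) \<oplus>\<^bsub>M\<^esub> (y \<ominus>\<^bsub>M\<^esub> z) \<in> H" using xyH Hd by blast
      also have "(x \<ominus>\<^bsub>M\<^esub> y) \<oplus>\<^bsub>M\<^esub> (y \<ominus>\<^bsub>M\<^esub> z) = x \<ominus>\<^bsub>M\<^esub> z"
        using z xy by (simp add: M.ag_simps)
      finally show "x \<ominus>\<^bsub>M\<^esub> z \<in> H" .
    next
      assume "x \<ominus>\<^bsub>M\<^esub> z \<in> H"
      then have "\<ominus>\<^bsub>M\<^esub> (x \<ominus>\<^bsub>M\<^esub> y) \<oplus>\<^bsub>M\<^esub> (x \<ominus>\<^bsub>M\<^esub> z) \<in> H" using xyH Hd by blast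
      also have "\<ominus>\<^bsub>M\<^esub> (x \<ominus>\<^bsub>M\<^esub> y) \<oplus>\<^bsub>M\<^esub> (x \<ominus>\<^bsub>M\<^esub> z) = y \<ominus>\<^bsub>M\<^esub> z"
        using z xy by (simp add: M.ag_simps)
      finally show "y \<ominus>\<^bsub>M\<^esub> z \<in> H" .
    qed
    \<comment> \<open>The choice depends only on the predicate, and elements of the same coset have
      equivalent predicates.\<close>
    then show "r x = r y" unfolding r_def by (metis (no_types, lifting))
  qed
  define \<kappa> where "\<kappa> x = e (r x)" for x
  have \<kappa>: "\<kappa> x = \<kappa> y \<longleftrightarrow> x \<ominus>\<^bsub>M\<^esub> y \<in> H" if "x \<in> carrier M" "y \<in> carrier M" for x y
    using r_eq[OF that] r that inj_onD[OF e] unfolding \<kappa>_def by metis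
  have cong_add: "\<kappa> (x \<oplus>\<^bsub>M\<^esub> y) = \<kappa> (x' \<oplus>\<^bsub>M\<^esub> y')"
    if a: "x \<in> carrier M" "y \<in> carrier M" "x' \<in> carrier M" "y' \<in> carrier M"
      "\<kappa> x = \<kappa> x'" "\<kappa> y = \<kappa> y'" for x y x' y'
  proof -
    have "(x \<ominus>\<^bsub>M\<^esub> x') \<oplus>\<^bsub>M\<^esub> (y \<ominus>\<^bsub>M\<^esub> y') \<in> H" using a Hd by (simp add: \<kappa>)
    also have "(x \<ominus>\<^bsub>M\<^esub> x') \<oplus>\<^bsub>M\<^esub> (y \<ominus>\<^bsub>M\<^esub> y') = (x \<oplus>\<^bsub>M\<^esub> y) \<ominus>\<^bsub>M\<^esub> (x' \<oplus>\<^bsub>M\<^esub> y')"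
      using a by (simp add: M.ag_simps)
    finally show "\<kappa> (x \<oplus>\<^bsub>M\<^esub> y) = \<kappa> (x' \<oplus>\<^bsub>M\<^esub> y')" using a by (simp add: \<kappa>)
  qed
  have cong_act: "\<kappa> (a \<odot>\<^bsub>M\<^esub> x) = \<kappa> (a \<odot>\<^bsub>M\<^esub> x')"
    if a: "a \<in> carrier A" "x \<in> carrier M" "x' \<in> carrier M" "\<kappa> x = \<kappa> x'" for a x x'
  proof -
    have "a \<odot>\<^bsub>M\<^esub> (x \<ominus>\<^bsub>M\<^esub> x') \<in> H" using a Hd by (simp add: \<kappa>)
    also have "a \<odot>\<^bsub>M\<^esub> (x \<ominus>\<^bsub>M\<^esub> x') = (a \<odot>\<^bsub>M\<^esub> x) \<ominus>\<^bsub>M\<^esub> (a \<odot>\<^bsub>M\<^esub> x')"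
      using a by (simp add: a_minus_def M.act_distr M.act_minus)
    finally show "\<kappa> (a \<odot>\<^bsub>M\<^esub> x) = \<kappa> (a \<odot>\<^bsub>M\<^esub> x')" using a by (simp add: \<kappa>)
  qed
  note im = image_module[OF rM, of \<kappa>, OF cong_add cong_act]
  have "fd_module A (image_module M \<kappa>)" using fd_image[OF M] im by blast
  moreover have "ker M (image_module M \<kappa>) \<kappa> = H"
  proof -
    have "\<kappa> x = \<kappa> \<zero>\<^bsub>M\<^esub> \<longleftrightarrow> x \<in> H" if "x \<in> carrier M" for x
      using that by (simp add: \<kappa> M.ag_simps)
    then show ?thesis using Hd(1) by (auto simp: ker_def image_module_def Let_def)
  qed
  ultimately show thesis using that im(2) by blast
qed

definition iso_map :: "('a, 'm) module \<Rightarrow> ('a, 'n) module \<Rightarrow> ('m \<Rightarrow> 'n) \<Rightarrow> bool" where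
  "iso_map M N h \<longleftrightarrow> mod_hom A M N h \<and> bij_betw h (carrier M) (carrier N)"

lemma iso_map_inv:
  assumes "iso_map M N h" "right_module A M" "right_module A N"
  shows "iso_map N M (inv_into (carrier M) h)"
  using assms by (simp add: iso_map_def mod_hom_inv bij_betw_inv_into)

lemma iso_mapI:
  assumes "mod_hom A M N h" "mod_hom A N M g"
    "\<And>x. x \<in> carrier M \<Longrightarrow> g (h x) = x" "\<And>y. y \<in> carrier N \<Longrightarrow> h (g y) = y"
  shows "iso_map M N h"
  unfolding iso_map_def
  by (intro conjI bij_betw_byWitness[of _ g]) (use assms mod_homD(1) in \<open>auto simp:
    image_subset_iff\<close>)

lemma iso_mapE:
  assumes "iso_map M N h" "right_module A M" "right_module A N"
  obtains g where "iso_map N M g" "mod_hom A M N h" "mod_hom A N M g"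
    "\<And>x. x \<in> carrier M \<Longrightarrow> g (h x) = x" "\<And>y. y \<in> carrier N \<Longrightarrow> h (g y) = y"
proof (rule that)
  show "iso_map N M (inv_into (carrier M) h)" by (rule iso_map_inv) fact+
  then show "mod_hom A N M (inv_into (carrier M) h)" by (simp add: iso_map_def)
qed (use assms in \<open>auto simp: iso_map_def bij_betw_def f_inv_into_f\<close>)

text \<open>Dividing by the zero submodule moves a module to lists of scalars. This is how modules
  on other types are fed into definitions that quantify over \<open>'k univ\<close>.\<close>

lemma fd_univ_model:
  assumes M: "fd_module A (M :: ('a, 'm) module)"
  obtains N :: "('a, 'k univ) module" and h where "fd_module A N" "iso_map M N h"
proof -
  have rM: "right_module A M" using M by (simp add: fd_module_iff)
  interpret M: right_module A M by fact
  have "submodule {\<zero>\<^bsub>M\<^esub>} A M" by (rule right_submoduleI[OF rM]) auto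
  then obtain N :: "('a, 'k univ) module" and \<pi> where N: "fd_module A N" "mod_surj A M N \<pi>"
    and k: "ker M N \<pi> = {\<zero>\<^bsub>M\<^esub>}" using fd_quotient_univ[OF M] by metis
  then have "right_module A N" "mod_hom A M N \<pi>" by (auto simp: fd_module_iff mod_surj_def)
  from mod_hom_inj_iff[OF this(2) rM this(1)] k have "inj_on \<pi> (carrier M)"
    by (auto simp: ker_def)
  then have "iso_map M N \<pi>" using N by (auto simp: iso_map_def mod_surj_def bij_betw_def)
  with N(1) show thesis by (rule that)
qed

end

lemma fd_moduleD: "fd_module A M \<Longrightarrow> right_module A M"
  by (simp add: fd_module_def)

section \<open>The opposite algebra\<close>

lemma opposite_simps [simp]:
  "carrier (opposite A) = carrier A" "add (opposite A) = add A" "zero (opposite A) = zero A"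
  "one (opposite A) = one A" "smult (opposite A) = smult A"
  "mult (opposite A) = (\<lambda>x y. y \<otimes>\<^bsub>A\<^esub> x)"
  by (simp_all add: opposite_def)

lemma opposite_opposite [simp]: "opposite (opposite A) = A"
  by (simp add: opposite_def)

lemma opposite_ring:
  assumes "ring A" shows "ring (opposite A)"
proof -
  interpret ring A by fact
  show ?thesis
    by (rule ringI)
      (auto intro!: abelian_groupI monoidI simp: a_assoc m_assoc l_distr r_distr
        intro: a_comm l_neg)
qed

text \<open>Commutativity of K and centrality of the scalars keep the axioms intact when products
  are reversed. Left modules thereby inherit the results on finite dimension and list
  models.\<close>

lemma (in kalgebra) opposite_kalgebra: "kalgebra (opposite A)"
proof -
  interpret B: ring "opposite A" by (rule opposite_ring) (rule ring_axioms)
  show ?thesis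
  proof
    fix c d :: 'k
    show "(c * d) \<odot>\<^bsub>opposite A\<^esub> \<one>\<^bsub>opposite A\<^esub> =
      (c \<odot>\<^bsub>opposite A\<^esub> \<one>\<^bsub>opposite A\<^esub>) \<otimes>\<^bsub>opposite A\<^esub> (d \<odot>\<^bsub>opposite A\<^esub> \<one>\<^bsub>opposite A\<^esub>)"
      using scalar_mult[of d c] by (simp add: mult.commute)
  qed (simp_all add: scalar_add scalar_one scalar_central)
qed

section \<open>Dual bases and projectivity\<close>

text \<open>Sums are taken over lists because dual bases are lists, possibly with repetitions; each
  law about them is then an induction on the list.\<close>

definition msum :: "('a, 'm) module \<Rightarrow> 'm list \<Rightarrow> 'm" where
  "msum M xs = foldr (add M) xs \<zero>\<^bsub>M\<^esub>"

lemma msum_simps [simp]: "msum M [] = \<zero>\<^bsub>M\<^esub>" "msum M (x # xs) = x \<oplus>\<^bsub>M\<^esub> msum M xs"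
  by (simp_all add: msum_def)

context right_module begin

lemma msum_closed [simp, intro]: "set xs \<subseteq> carrier M \<Longrightarrow> msum M xs \<in> carrier M"
  by (induction xs) auto

lemma msum_append: "set xs \<subseteq> carrier M \<Longrightarrow> set ys \<subseteq> carrier M \<Longrightarrow>
    msum M (xs @ ys) = msum M xs \<oplus>\<^bsub>M\<^esub> msum M ys"
  by (induction xs) (auto simp: M.a_assoc)

lemma msum_act: "a \<in> carrier R \<Longrightarrow> set xs \<subseteq> carrier M \<Longrightarrow>
    a \<odot>\<^bsub>M\<^esub> msum M xs = msum M (map (\<lambda>x. a \<odot>\<^bsub>M\<^esub> x) xs)"
  by (induction xs) (auto simp: act_distr)

lemma msum_map_add:
  "(\<And>i. i \<in> set xs \<Longrightarrow> f i \<in> carrier M) \<Longrightarrow> (\<And>i. i \<in> set xs \<Longrightarrow> g i \<in> carrier M) \<Longrightarrow>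
    msum M (map (\<lambda>i. f i \<oplus>\<^bsub>M\<^esub> g i) xs) = msum M (map f xs) \<oplus>\<^bsub>M\<^esub> msum M (map g xs)"
proof (induction xs)
  case (Cons i xs)
  then have "set (map f xs) \<subseteq> carrier M" "set (map g xs) \<subseteq> carrier M" by auto
  then show ?case using Cons by (simp add: M.a_ac)
qed simp

lemma msum_zero: "(\<And>x. x \<in> set xs \<Longrightarrow> x = \<zero>\<^bsub>M\<^esub>) \<Longrightarrow> msum M xs = \<zero>\<^bsub>M\<^esub>"
proof (induction xs)
  case (Cons x xs)
  have "x = \<zero>\<^bsub>M\<^esub>" "msum M xs = \<zero>\<^bsub>M\<^esub>" using Cons.IH Cons.prems by (meson list.set_intros)+
  then show ?case by simp
qed simp

lemma msum_single:
  "distinct js \<Longrightarrow> j \<in> set js \<Longrightarrow> x \<in> carrier M \<Longrightarrow> msum M (map (\<lambda>i. if i = j then x else \<zero>\<^bsub>M\<^esub>) js) = x"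
proof (induction js)
  case (Cons i js)
  show ?case
  proof (cases "i = j")
    case True
    then have "msum M (map (\<lambda>i. if i = j then x else \<zero>\<^bsub>M\<^esub>) js) = \<zero>\<^bsub>M\<^esub>"
      using Cons.prems by (intro msum_zero) auto
    then show ?thesis using True Cons.prems by simp
  next
    case False
    then show ?thesis using Cons by simp
  qed
qed simp

end

lemma mod_hom_msum:
  assumes "mod_hom R M N h" "right_module R M" "right_module R N" "set xs \<subseteq> carrier M"
  shows "h (msum M xs) = msum N (map h xs)"
  using assms(4)
proof (induction xs)
  case (Cons x xs)
  then show ?case
    using right_module.msum_closed[OF assms(2), of xs] by (simp add: mod_homD(2)[OF assms(1)])
qed (simp add: mod_hom_zero[OF assms(1-3)])

lemma mod_hom_sum:
  assumes "right_module R N" "\<And>i. i \<in> set is \<Longrightarrow> mod_hom R M N (h i)"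
  shows "mod_hom R M N (\<lambda>x. msum N (map (\<lambda>i. h i x) is))"
  using assms(2)
proof (induction "is")
  case Nil
  then show ?case using mod_hom_const_zero[OF assms(1)] by simp
next
  case (Cons i js)
  have "mod_hom R M N (\<lambda>x. h i x \<oplus>\<^bsub>N\<^esub> msum N (map (\<lambda>i. h i x) js))"
    using Cons assms(1) by (intro mod_hom_add) auto
  then show ?case by simp
qed

lemma mod_hom_act_elem:
  assumes "right_module R N" "m \<in> carrier N" "mod_hom R M (regular R) \<phi>"
  shows "mod_hom R M N (\<lambda>x. \<phi> x \<odot>\<^bsub>N\<^esub> m)"
proof -
  interpret N: right_module R N by fact
  show ?thesis
    using mod_homD[OF assms(3)] assms(2)
    by (intro mod_homI) (simp_all add: N.act_add N.act_mult)
qed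

text \<open>The criterion of the dual basis lemma for a finitely generated projective module: x is
  the sum of the m acted on by \<phi> x. While \<open>projective\<close> tests lifting only against
  modules on lists of scalars, a dual basis lifts against modules with any type of elements.\<close>

definition dual_basis :: "('k, 'a) module \<Rightarrow> ('a, 'm) module \<Rightarrow> ('m \<times> ('m \<Rightarrow> 'a)) list \<Rightarrow> bool" where
  "dual_basis R M S \<longleftrightarrow>
    (\<forall>(m, \<phi>) \<in> set S. m \<in> carrier M \<and> mod_hom R M (regular R) \<phi>) \<and>
    (\<forall>x\<in>carrier M. x = msum M (map (\<lambda>(m, \<phi>). \<phi> x \<odot>\<^bsub>M\<^esub> m) S))"

lemma dual_basisD:
  assumes "dual_basis R M S"
  shows "(m, \<phi>) \<in> set S \<Longrightarrow> m \<in> carrier M" "(m, \<phi>) \<in> set S \<Longrightarrow> mod_hom R M (regular R) \<phi>"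
    "x \<in> carrier M \<Longrightarrow> msum M (map (\<lambda>(m, \<phi>). \<phi> x \<odot>\<^bsub>M\<^esub> m) S) = x"
  using assms by (auto simp: dual_basis_def)

text \<open>Choose a preimage r m of h m for each generator m and send x to the sum of the r m acted
  on by \<phi> x. Only the values of h have to lie in the image of g, so that one can also lift
  through a differential or an inclusion.\<close>

lemma dual_basis_lift:
  assumes S: "dual_basis R P S" and P: "right_module R P" and X: "right_module R X"
    and Y: "right_module R Y" and g: "mod_hom R X Y g" and h: "mod_hom R P Y h"
    and im: "\<And>x. x \<in> carrier P \<Longrightarrow> h x \<in> g ` carrier X"
  shows "\<exists>h'. mod_hom R P X h' \<and> (\<forall>x\<in>carrier P. g (h' x) = h x)"
proof -
  interpret X: right_module R X by fact
  interpret P: right_module R P by fact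
  define r where "r m = (SOME x. x \<in> carrier X \<and> g x = h m)" for m
  have r: "r m \<in> carrier X" "g (r m) = h m" if m: "m \<in> carrier P" for m
  proof -
    obtain x where "x \<in> carrier X \<and> g x = h m" using im[OF m] by auto
    from someI[of "\<lambda>x. x \<in> carrier X \<and> g x = h m", OF this]
    show "r m \<in> carrier X" "g (r m) = h m" by (auto simp: r_def)
  qed
  define h' where "h' x = msum X (map (\<lambda>p. snd p x \<odot>\<^bsub>X\<^esub> r (fst p)) S)" for x
  have Sd: "fst p \<in> carrier P" "mod_hom R P (regular R) (snd p)" if "p \<in> set S" for p
    using that dual_basisD(1,2)[OF S, of "fst p" "snd p"] by auto
  have 1: "mod_hom R P X h'"
    unfolding h'_def by (intro mod_hom_sum[OF X] mod_hom_act_elem[OF X]) (use Sd r in auto)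
  have "g (h' x) = h x" if x: "x \<in> carrier P" for x
  proof -
    have sc: "snd p x \<in> carrier R" if "p \<in> set S" for p using mod_homD(1)[OF Sd(2)[OF that] x] by
      simp
    have "g (h' x) = msum Y (map g (map (\<lambda>p. snd p x \<odot>\<^bsub>X\<^esub> r (fst p)) S))"
      unfolding h'_def by (rule mod_hom_msum[OF g X Y]) (use sc r Sd in auto)
    also have "\<dots> = msum Y (map (\<lambda>p. h (snd p x \<odot>\<^bsub>P\<^esub> fst p)) S)"
      using sc r Sd by (auto simp: mod_homD(3)[OF g] mod_homD(3)[OF h] intro!: arg_cong[of _ _
        "msum Y"])
    also have "\<dots> = msum Y (map h (map (\<lambda>(m, \<phi>). \<phi> x \<odot>\<^bsub>P\<^esub> m) S))"
      by (simp add: comp_def case_prod_unfold)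
    also have "\<dots> = h (msum P (map (\<lambda>(m, \<phi>). \<phi> x \<odot>\<^bsub>P\<^esub> m) S))"
      by (rule mod_hom_msum[OF h P Y, symmetric]) (use sc Sd in auto)
    also have "\<dots> = h x" using dual_basisD(3)[OF S x] by simp
    finally show ?thesis .
  qed
  with 1 show ?thesis by blast
qed

lemma dual_basis_projective:
  fixes A :: "('k::field, 'a) module"
  assumes S: "dual_basis A P S" and P: "fd_module A P"
  shows "projective A P"
  unfolding projective_def
proof (intro conjI P allI impI)
  fix X Y :: "('a, 'k univ) module" and g h
  assume *: "fd_module A X \<and> fd_module A Y \<and> mod_surj A X Y g \<and> mod_hom A P Y h"
  then have "right_module A X" "right_module A Y" "mod_hom A X Y g" "g ` carrier X = carrier Y"
    by (auto simp: fd_moduleD mod_surj_def)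
  then show "\<exists>h'. mod_hom A P X h' \<and> (\<forall>x\<in>carrier P. g (h' x) = h x)"
    using * by (intro dual_basis_lift[OF S fd_moduleD[OF P]]) (auto simp: mod_homD(1)[of A P Y h])
qed

text \<open>The equation i (j y) = y makes N a retract of M; generators are pushed forward along i
  and coordinate functions pulled back along j.\<close>

lemma dual_basis_iso:
  assumes S: "dual_basis R M S" and M: "right_module R M" and N: "right_module R N"
    and i: "mod_hom R M N i" and j: "mod_hom R N M j" and ij: "\<And>y. y \<in> carrier N \<Longrightarrow> i (j y) = y"
  shows "dual_basis R N (map (\<lambda>(m, \<phi>). (i m, \<lambda>y. \<phi> (j y))) S)"
  unfolding dual_basis_def
proof (intro conjI ballI)
  interpret M: right_module R M by fact
  fix y assume y: "y \<in> carrier N"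
  then have jy: "j y \<in> carrier M" by (rule mod_homD(1)[OF j])
  have sc: "\<phi> (j y) \<in> carrier R" "m \<in> carrier M" if "(m, \<phi>) \<in> set S" for m \<phi>
    using mod_homD(1)[OF dual_basisD(2)[OF S that] jy] dual_basisD(1)[OF S that] by auto
  have "y = i (msum M (map (\<lambda>(m, \<phi>). \<phi> (j y) \<odot>\<^bsub>M\<^esub> m) S))" using dual_basisD(3)[OF S jy] ij[OF y]
    by simp
  also have "\<dots> = msum N (map i (map (\<lambda>(m, \<phi>). \<phi> (j y) \<odot>\<^bsub>M\<^esub> m) S))"
    by (rule mod_hom_msum[OF i M N]) (use sc in auto)
  also have "\<dots> = msum N (map (\<lambda>(m, \<phi>). \<phi> y \<odot>\<^bsub>N\<^esub> m) (map (\<lambda>(m, \<phi>). (i m, \<lambda>y. \<phi> (j y))) S))"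
    using sc by (auto simp: mod_homD(3)[OF i] split_beta intro!: arg_cong[of _ _ "msum N"])
  finally show "y = \<dots>" .
next
  fix p assume "p \<in> set (map (\<lambda>(m, \<phi>). (i m, \<lambda>y. \<phi> (j y))) S)"
  then obtain m \<phi> where "p = (i m, \<lambda>y. \<phi> (j y))" "(m, \<phi>) \<in> set S" by auto
  then show "case p of (m, \<phi>) \<Rightarrow> m \<in> carrier N \<and> mod_hom R N (regular R) \<phi>"
    using dual_basisD(1,2)[OF S] mod_homD(1)[OF i] mod_hom_comp[OF j dual_basisD(2)[OF S]] by auto
qed

text \<open>The terms of T^-_k are nested binary sums, some summands being zero, so their dual bases
  are assembled summand by summand.\<close>

lemma dual_basis_dsum2:
  assumes S: "dual_basis R M S" and S': "dual_basis R N S'" and M: "right_module R M" and N: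
    "right_module R N"
  shows "dual_basis R (dsum2 M N) (map (\<lambda>(m, \<phi>). ((m, \<zero>\<^bsub>N\<^esub>), \<phi> \<circ> fst)) S @ map (\<lambda>(m, \<phi>). ((\<zero>\<^bsub>M\<^esub>,
    m), \<phi> \<circ> snd)) S')"
    (is "dual_basis R _ (?S @ ?S')")
  unfolding dual_basis_def
proof (intro conjI ballI)
  interpret M: right_module R M by fact
  interpret N: right_module R N by fact
  interpret D: right_module R "dsum2 M N" using M N by (rule dsum2_right_module)
  have i1: "mod_hom R M (dsum2 M N) (\<lambda>x. (x, \<zero>\<^bsub>N\<^esub>))"
    by (rule mod_hom_dsum2[OF mod_hom_id mod_hom_const_zero[OF N]])
  have i2: "mod_hom R N (dsum2 M N) (\<lambda>x. (\<zero>\<^bsub>M\<^esub>, x))"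
    by (rule mod_hom_dsum2[OF mod_hom_const_zero[OF M] mod_hom_id])
  {
    fix u assume "u \<in> carrier (dsum2 M N)"
    then obtain x y where u: "u = (x, y)" and x: "x \<in> carrier M" and y: "y \<in> carrier N" by auto
    have sc: "\<phi> x \<in> carrier R" "m \<in> carrier M" if "(m, \<phi>) \<in> set S" for m \<phi>
      using mod_homD(1)[OF dual_basisD(2)[OF S that] x] dual_basisD(1)[OF S that] by auto
    have sc': "\<phi> y \<in> carrier R" "m \<in> carrier N" if "(m, \<phi>) \<in> set S'" for m \<phi>
      using mod_homD(1)[OF dual_basisD(2)[OF S' that] y] dual_basisD(1)[OF S' that] by auto
    have "msum (dsum2 M N) (map (\<lambda>(m, \<phi>). \<phi> u \<odot>\<^bsub>dsum2 M N\<^esub> m) ?S)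
      = msum (dsum2 M N) (map (\<lambda>x. (x, \<zero>\<^bsub>N\<^esub>)) (map (\<lambda>(m, \<phi>). \<phi> x \<odot>\<^bsub>M\<^esub> m) S))"
      using sc by (auto simp: u split_beta intro!: arg_cong[of _ _ "msum _"])
    also have "\<dots> = (x, \<zero>\<^bsub>N\<^esub>)"
      by (subst mod_hom_msum[OF i1 M D.right_module_axioms, symmetric])
        (use sc dual_basisD(3)[OF S x] in auto)
    finally have 1: "msum (dsum2 M N) (map (\<lambda>(m, \<phi>). \<phi> u \<odot>\<^bsub>dsum2 M N\<^esub> m) ?S) = (x, \<zero>\<^bsub>N\<^esub>)" .
    have "msum (dsum2 M N) (map (\<lambda>(m, \<phi>). \<phi> u \<odot>\<^bsub>dsum2 M N\<^esub> m) ?S')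
      = msum (dsum2 M N) (map (\<lambda>x. (\<zero>\<^bsub>M\<^esub>, x)) (map (\<lambda>(m, \<phi>). \<phi> y \<odot>\<^bsub>N\<^esub> m) S'))"
      using sc' by (auto simp: u split_beta intro!: arg_cong[of _ _ "msum _"])
    also have "\<dots> = (\<zero>\<^bsub>M\<^esub>, y)"
      by (subst mod_hom_msum[OF i2 N D.right_module_axioms, symmetric])
        (use sc' dual_basisD(3)[OF S' y] in auto)
    finally have 2: "msum (dsum2 M N) (map (\<lambda>(m, \<phi>). \<phi> u \<odot>\<^bsub>dsum2 M N\<^esub> m) ?S') = (\<zero>\<^bsub>M\<^esub>, y)" .
    show "u = msum (dsum2 M N) (map (\<lambda>(m, \<phi>). \<phi> u \<odot>\<^bsub>dsum2 M N\<^esub> m) (?S @ ?S'))"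
    proof -
      have c: "set (map (\<lambda>(m, \<phi>). \<phi> u \<odot>\<^bsub>dsum2 M N\<^esub> m) ?S) \<subseteq> carrier (dsum2 M N)"
        "set (map (\<lambda>(m, \<phi>). \<phi> u \<odot>\<^bsub>dsum2 M N\<^esub> m) ?S') \<subseteq> carrier (dsum2 M N)"
        using sc sc' by (auto simp: u)
      show ?thesis
        unfolding map_append D.msum_append[OF c] 1 2 using u x y by simp
    qed
  next
    fix p assume "p \<in> set (?S @ ?S')"
    then show "case p of (m, \<phi>) \<Rightarrow> m \<in> carrier (dsum2 M N) \<and> mod_hom R (dsum2 M N) (regular R) \<phi>"
      using dual_basisD(1,2)[OF S] dual_basisD(1,2)[OF S']
      by (auto intro!: mod_hom_compo[OF mod_hom_fst] mod_hom_compo[OF mod_hom_snd])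
  }
qed

lemma dual_basis_zero_sub:
  assumes "right_module R M" shows "dual_basis R (zero_sub M) []"
  by (auto simp: dual_basis_def)

section \<open>Projective modules generated by idempotents\<close>

definition cyc_proj :: "('k, 'a) module \<Rightarrow> 'a \<Rightarrow> ('a, 'a) module" where
  "cyc_proj R e = (regular R)\<lparr>carrier := {e \<otimes>\<^bsub>R\<^esub> a | a. a \<in> carrier R}\<rparr>"

lemma cyc_proj_simps:
  "carrier (cyc_proj R e) = {e \<otimes>\<^bsub>R\<^esub> a | a. a \<in> carrier R}" "zero (cyc_proj R e) = \<zero>\<^bsub>R\<^esub>"
  "add (cyc_proj R e) = add R" "smult (cyc_proj R e) = (\<lambda>a x. x \<otimes>\<^bsub>R\<^esub> a)"
  by (simp_all add: cyc_proj_def)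

text \<open>Taken over A this yields the right projectives eA, taken over \<open>opposite A\<close>
  the left projectives Ae. The latter enter in the presentation of the dual of S_k.\<close>

locale idem = ring R for R :: "('k, 'a) module" (structure) +
  fixes e :: 'a
  assumes e_closed: "e \<in> carrier R" and e_idem: "e \<otimes>\<^bsub>R\<^esub> e = e"
begin

lemma cyc_proj_iff: "x \<in> carrier (cyc_proj R e) \<longleftrightarrow> x \<in> carrier R \<and> e \<otimes>\<^bsub>R\<^esub> x = x"
proof
  assume "x \<in> carrier (cyc_proj R e)"
  then obtain a where a: "a \<in> carrier R" "x = e \<otimes> a" by (auto simp: cyc_proj_simps)
  then have "e \<otimes> (e \<otimes> a) = e \<otimes> a" using e_closed by (simp add: m_assoc[symmetric] e_idem)
  then show "x \<in> carrier R \<and> e \<otimes> x = x" using a e_closed by simp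
next
  assume "x \<in> carrier R \<and> e \<otimes> x = x"
  then show "x \<in> carrier (cyc_proj R e)" by (auto simp: cyc_proj_simps intro!: exI[of _ x])
qed

lemma cyc_proj_right_module: "right_module R (cyc_proj R e)"
proof -
  have "submodule (carrier (cyc_proj R e)) R (regular R)"
    by (rule right_submoduleI[OF regular_right_module[OF ring_axioms]])
      (use e_closed in \<open>auto simp: cyc_proj_iff r_distr m_assoc[symmetric]\<close>)
  from right_module_sub[OF regular_right_module[OF ring_axioms] this]
  show ?thesis by (simp add: cyc_proj_def)
qed

lemma cyc_proj_incl: "mod_hom R (cyc_proj R e) (regular R) (\<lambda>x. x)"
  by (rule mod_homI) (auto simp: cyc_proj_iff, auto simp: cyc_proj_simps)

lemma dual_basis_cyc_proj: "dual_basis R (cyc_proj R e) [(e, \<lambda>x. x)]"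
proof -
  interpret P: right_module R "cyc_proj R e" by (rule cyc_proj_right_module)
  show ?thesis
    unfolding dual_basis_def
    using cyc_proj_incl e_closed e_idem
    by (auto simp: cyc_proj_iff) (auto simp: cyc_proj_simps)
qed

end

lemma dsum_msum:
  assumes "j \<in> J"
  shows "msum (dsum J M) xs j = msum (M j) (map (\<lambda>x. x j) xs)"
  using assms by (induction xs) (auto simp: dsum_simps)

lemma dual_basis_dsum_cyc:
  assumes R: "ring R" and e: "\<And>j. j \<in> J \<Longrightarrow> idem R (e j)" and js: "set js = J" "distinct js"
  shows "dual_basis R (dsum J (\<lambda>j. cyc_proj R (e j)))
    (map (\<lambda>j. (\<lambda>i\<in>J. if i = j then e j else \<zero>\<^bsub>R\<^esub>, \<lambda>x. x j)) js)" (is "dual_basis R ?D ?S")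
proof -
  interpret ring R by fact
  have rm: "right_module R (cyc_proj R (e j))" if "j \<in> J" for j
    by (rule idem.cyc_proj_right_module[OF e[OF that]])
  interpret D: right_module R ?D by (rule dsum_right_module[OF R rm])
  show ?thesis
    unfolding dual_basis_def
  proof (intro conjI ballI)
    fix p assume "p \<in> set ?S"
    then obtain j where j: "j \<in> J" "p = (\<lambda>i\<in>J. if i = j then e j else \<zero>\<^bsub>R\<^esub>, \<lambda>x. x j)" using js by
      auto
    have "mod_hom R ?D (regular R) (\<lambda>x. x j)"
      using mod_hom_proj[OF j(1), of R "\<lambda>j. cyc_proj R (e j)"]
        mod_hom_comp[OF _ idem.cyc_proj_incl[OF e[OF j(1)]], of ?D "\<lambda>x. x j"] by simp
    then show "case p of (m, \<phi>) \<Rightarrow> m \<in> carrier ?D \<and> mod_hom R ?D (regular R) \<phi>"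
      using j idem.e_closed[OF e] idem.e_idem[OF e]
      by (auto simp: dsum_simps idem.cyc_proj_iff[OF e])
  next
    fix x assume x: "x \<in> carrier ?D"
    have xj: "x j \<in> carrier R" "e j \<otimes>\<^bsub>R\<^esub> x j = x j" if "j \<in> J" for j
      using x that PiE_mem[of x J "\<lambda>j. carrier (cyc_proj R (e j))" j]
      by (simp_all add: dsum_simps idem.cyc_proj_iff[OF e[OF that]])
    let ?xs = "map (\<lambda>(m, \<phi>). \<phi> x \<odot>\<^bsub>?D\<^esub> m) ?S"
    have xs: "?xs = map (\<lambda>j. \<lambda>i\<in>J. if i = j then x j else \<zero>\<^bsub>R\<^esub>) js"
    proof -
      have "x j \<odot>\<^bsub>?D\<^esub> (\<lambda>i\<in>J. if i = j then e j else \<zero>\<^bsub>R\<^esub>) = (\<lambda>i\<in>J. if i = j then x j else \<zero>\<^bsub>R\<^esub>)"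
        if "j \<in> J" for j
        unfolding dsum_simps cyc_proj_simps by (rule restrict_ext) (use xj[OF that] in auto)
      then show ?thesis using js by simp
    qed
    have xsc: "set ?xs \<subseteq> carrier ?D"
    proof
      fix y assume "y \<in> set ?xs"
      then obtain j where j: "j \<in> J" "y = (\<lambda>i\<in>J. if i = j then x j else \<zero>\<^bsub>R\<^esub>)"
        unfolding xs using js by auto
      have "(if i = j then x j else \<zero>\<^bsub>R\<^esub>) \<in> carrier (cyc_proj R (e i))" if "i \<in> J" for i
        using xj[OF j(1)] xj[OF that] idem.e_closed[OF e[OF that]]
        by (simp add: idem.cyc_proj_iff[OF e[OF that]])
      then show "y \<in> carrier ?D" unfolding j(2) dsum_simps by (intro restrict_PiE_iff[THEN iffD2])
        blast
    qed
    show "x = msum ?D ?xs"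
    proof (rule extensionalityI)
      show "x \<in> extensional J" using x by (auto simp: dsum_simps PiE_iff)
      have "msum ?D ?xs \<in> carrier ?D"
        using xsc by (rule D.msum_closed)
      then show "msum ?D ?xs \<in> extensional J" by (auto simp: dsum_simps PiE_iff)
      fix j assume j: "j \<in> J"
      have "msum ?D ?xs j = msum (cyc_proj R (e j)) (map (\<lambda>x. x j) ?xs)" by (rule dsum_msum[OF j])
      also have "map (\<lambda>x. x j) ?xs = map (\<lambda>i. if i = j then x j else \<zero>\<^bsub>cyc_proj R (e j)\<^esub>) js"
        unfolding xs using j by (auto simp: cyc_proj_simps)
      also have "msum (cyc_proj R (e j)) \<dots> = x j"
        by (rule right_module.msum_single[OF rm[OF j]])
          (use js j xj in \<open>auto simp: idem.cyc_proj_iff[OF e]\<close>)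
      finally show "x j = msum ?D ?xs j" by (rule sym)
    qed
  qed
qed

text \<open>
  Nakayama: the filtration \<open>F\<close> plays the role of the powers of the radical.
\<close>

lemma superfluous:
  assumes P: "right_module R P" and S: "dual_basis R P S" and L: "submodule L R P"
    and F0: "F 0 = carrier R" and Fn: "F n = {\<zero>\<^bsub>R\<^esub>}" and FR: "\<And>i. F i \<subseteq> carrier R"
    and Fadd: "\<And>i a b. a \<in> F i \<Longrightarrow> b \<in> F i \<Longrightarrow> a \<oplus>\<^bsub>R\<^esub> b \<in> F i"
    and Fzero: "\<And>i. \<zero>\<^bsub>R\<^esub> \<in> F i"
    and Fmult: "\<And>i a b. a \<in> F 1 \<Longrightarrow> b \<in> F i \<Longrightarrow> a \<otimes>\<^bsub>R\<^esub> b \<in> F (Suc i)"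
    and K: "\<And>x m \<phi>. x \<in> K \<Longrightarrow> (m, \<phi>) \<in> set S \<Longrightarrow> \<phi> x \<in> F 1" and KP: "K \<subseteq> carrier P"
    and KL: "carrier P \<subseteq> {x \<oplus>\<^bsub>P\<^esub> y | x y. x \<in> K \<and> y \<in> L}"
  shows "L = carrier P"
proof -
  interpret P: right_module R P by fact
  note Ld = submoduleD[OF L]
  have FD: "a \<in> carrier R" if "a \<in> F i" for a i using that FR by blast
  let ?m = "\<lambda>f. msum P (map (\<lambda>p. f p \<odot>\<^bsub>P\<^esub> fst p) S)"
  have Sd: "fst p \<in> carrier P" if "p \<in> set S" for p
    using that dual_basisD(1)[OF S, of "fst p" "snd p"] by auto
  have Sh: "mod_hom R P (regular R) (snd p)" if "p \<in> set S" for p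
    using that dual_basisD(2)[OF S, of "fst p" "snd p"] by auto
  have exp: "x = ?m (\<lambda>p. snd p x)" if "x \<in> carrier P" for x
    using dual_basisD(3)[OF S that] by (simp add: case_prod_unfold)
  have cl: "?m f \<in> carrier P" if "\<And>p. p \<in> set S \<Longrightarrow> f p \<in> carrier R" for f
    using that Sd by (intro P.msum_closed) auto
  \<comment> \<open>G i stands for P times the i-th ideal: the elements with an expansion whose
    coefficients all lie in F i. The claim to be iterated is that G i is contained in L + G (i + 1);
    as G n = 0, everything then lies in L.\<close>
  define G where "G i = {x \<in> carrier P. \<exists>f. (\<forall>p\<in>set S. f p \<in> F i) \<and> x = ?m f}" for i
  have GI: "?m f \<in> G i" if "\<forall>p\<in>set S. f p \<in> F i" for i f
    unfolding G_def
  proof (intro CollectI conjI exI[of _ f])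
    show "?m f \<in> carrier P" by (rule cl) (use that FD in blast)
  qed (fact that refl)+
  have Gadd: "x \<oplus>\<^bsub>P\<^esub> y \<in> G i" if xy: "x \<in> G i" "y \<in> G i" for x y i
  proof -
    from xy obtain f g where f: "\<forall>p\<in>set S. f p \<in> F i" "x = ?m f" and g: "\<forall>p\<in>set S. g p \<in> F i" "y =
      ?m g"
      by (auto simp: G_def)
    have fR: "f p \<in> carrier R" and gR: "g p \<in> carrier R" if "p \<in> set S" for p
      using f(1) g(1) that FD[of _ i] by blast+
    have "?m (\<lambda>p. f p \<oplus>\<^bsub>R\<^esub> g p) = msum P (map (\<lambda>p. f p \<odot>\<^bsub>P\<^esub> fst p \<oplus>\<^bsub>P\<^esub> g p \<odot>\<^bsub>P\<^esub> fst p) S)"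
      by (intro arg_cong[of _ _ "msum P"] map_cong refl P.act_add Sd fR gR)
    also have "\<dots> = x \<oplus>\<^bsub>P\<^esub> y"
      unfolding f g by (intro P.msum_map_add P.act_closed Sd fR gR)
    finally have "x \<oplus>\<^bsub>P\<^esub> y = ?m (\<lambda>p. f p \<oplus>\<^bsub>R\<^esub> g p)" ..
    moreover have "?m (\<lambda>p. f p \<oplus>\<^bsub>R\<^esub> g p) \<in> G i" by (rule GI) (use f g Fadd in blast)
    ultimately show ?thesis by simp
  qed
  \<comment> \<open>Split each generator as u + l with u in K and l in L. The coordinates of u lie
    in F 1, so u acted on by a coefficient from F i has an expansion with coefficients in F (i +
    1).\<close>
  have step: "\<exists>y\<in>L. \<exists>z\<in>G (Suc i). x = y \<oplus>\<^bsub>P\<^esub> z" if "x \<in> G i" for x i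
  proof -
    from that obtain f where f: "\<forall>p\<in>set S. f p \<in> F i" "x = ?m f" by (auto simp: G_def)
    have *: "\<exists>y\<in>L. \<exists>z\<in>G (Suc i). f p \<odot>\<^bsub>P\<^esub> fst p = y \<oplus>\<^bsub>P\<^esub> z" if p: "p \<in> set S" for p
    proof -
      obtain l u where lu: "l \<in> L" "u \<in> K" "fst p = u \<oplus>\<^bsub>P\<^esub> l" using KL Sd[OF p] by blast
      have uP: "u \<in> carrier P" using lu KP by blast
      have fp: "f p \<in> F i" "f p \<in> carrier R" using f p FD by blast+
      have uq: "snd q u \<in> F 1" "snd q u \<in> carrier R" if "q \<in> set S" for q
      proof -
        show "snd q u \<in> F 1" using K[OF lu(2), of "fst q" "snd q"] that by simp
        then show "snd q u \<in> carrier R" by (rule FD)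
      qed
      have "f p \<odot>\<^bsub>P\<^esub> u = f p \<odot>\<^bsub>P\<^esub> ?m (\<lambda>q. snd q u)"
        by (rule arg_cong[OF exp[OF uP]])
      also have "\<dots> = msum P (map (\<lambda>q. f p \<odot>\<^bsub>P\<^esub> (snd q u \<odot>\<^bsub>P\<^esub> fst q)) S)"
      proof -
        have "set (map (\<lambda>q. snd q u \<odot>\<^bsub>P\<^esub> fst q) S) \<subseteq> carrier P" using uq Sd by auto
        from P.msum_act[OF fp(2) this] show ?thesis by (simp add: comp_def)
      qed
      also have "\<dots> = ?m (\<lambda>q. snd q u \<otimes>\<^bsub>R\<^esub> f p)"
        by (intro arg_cong[of _ _ "msum P"] map_cong refl P.act_mult[symmetric] uq fp Sd)
      finally have eq: "f p \<odot>\<^bsub>P\<^esub> u = ?m (\<lambda>q. snd q u \<otimes>\<^bsub>R\<^esub> f p)" .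
      have "\<forall>q\<in>set S. snd q u \<otimes>\<^bsub>R\<^esub> f p \<in> F (Suc i)" using fp uq Fmult by blast
      then have "f p \<odot>\<^bsub>P\<^esub> u \<in> G (Suc i)" unfolding eq by (rule GI)
      moreover have "f p \<odot>\<^bsub>P\<^esub> l \<in> L" using fp(2) lu(1) by (rule Ld(4))
      moreover have "f p \<odot>\<^bsub>P\<^esub> fst p = f p \<odot>\<^bsub>P\<^esub> l \<oplus>\<^bsub>P\<^esub> f p \<odot>\<^bsub>P\<^esub> u"
      proof -
        have "l \<in> carrier P" using lu(1) Ld(1) by blast
        then show ?thesis using uP fp(2) by (simp add: lu(3) P.act_distr P.M.a_comm)
      qed
      ultimately show ?thesis by blast
    qed
    have zG: "\<zero>\<^bsub>P\<^esub> \<in> G (Suc i)"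
    proof -
      have "?m (\<lambda>p. \<zero>\<^bsub>R\<^esub>) = \<zero>\<^bsub>P\<^esub>" using Sd by (intro P.msum_zero) auto
      moreover have "?m (\<lambda>p. \<zero>\<^bsub>R\<^esub>) \<in> G (Suc i)" by (rule GI) (use Fzero in blast)
      ultimately show ?thesis by simp
    qed
    have "\<exists>y\<in>L. \<exists>z\<in>G (Suc i). msum P (map (\<lambda>p. f p \<odot>\<^bsub>P\<^esub> fst p) T) = y \<oplus>\<^bsub>P\<^esub> z" if "set T \<subseteq> set S"
      for T
      using that
    proof (induction T)
      case Nil
      show ?case by (intro bexI[OF _ Ld(2)] bexI[OF _ zG]) simp
    next
      case (Cons p T)
      then obtain y z where yz: "y \<in> L" "z \<in> G (Suc i)" "msum P (map (\<lambda>p. f p \<odot>\<^bsub>P\<^esub> fst p) T) = y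
        \<oplus>\<^bsub>P\<^esub> z"
        by auto
      obtain y' z' where yz': "y' \<in> L" "z' \<in> G (Suc i)" "f p \<odot>\<^bsub>P\<^esub> fst p = y' \<oplus>\<^bsub>P\<^esub> z'"
        using *[of p] Cons.prems by auto
      have c: "y \<in> carrier P" "y' \<in> carrier P" "z \<in> carrier P" "z' \<in> carrier P"
        using yz yz' Ld(1) by (auto simp: G_def)
      have "msum P (map (\<lambda>p. f p \<odot>\<^bsub>P\<^esub> fst p) (p # T)) = (y' \<oplus>\<^bsub>P\<^esub> y) \<oplus>\<^bsub>P\<^esub> (z' \<oplus>\<^bsub>P\<^esub> z)"
        using c by (simp add: yz(3) yz'(3) P.M.a_ac)
      with Ld(3)[OF yz'(1) yz(1)] Gadd[OF yz'(2) yz(2)] show ?case by blast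
    qed
    from this[OF order_refl] show ?thesis unfolding f(2) .
  qed
  have "\<exists>y\<in>L. \<exists>z\<in>G i. x = y \<oplus>\<^bsub>P\<^esub> z" if x: "x \<in> carrier P" for x i
  proof (induction i)
    case 0
    have "snd p x \<in> F 0" if "p \<in> set S" for p using mod_homD(1)[OF Sh[OF that] x] F0 by simp
    then have "?m (\<lambda>p. snd p x) \<in> G 0" by (intro GI) blast
    then have "x \<in> G 0" by (subst exp[OF x])
    then show ?case using x by (intro bexI[OF _ Ld(2)] bexI[of _ x]) simp_all
  next
    case (Suc i)
    then obtain y z where yz: "y \<in> L" "z \<in> G i" "x = y \<oplus>\<^bsub>P\<^esub> z" by blast
    from step[OF yz(2)] obtain y' z' where yz': "y' \<in> L" "z' \<in> G (Suc i)" "z = y' \<oplus>\<^bsub>P\<^esub> z'" by blast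
    have c: "y \<in> carrier P" "y' \<in> carrier P" "z' \<in> carrier P" using yz yz' Ld(1) by (auto simp:
      G_def)
    have "x = (y \<oplus>\<^bsub>P\<^esub> y') \<oplus>\<^bsub>P\<^esub> z'" using c by (simp add: yz(3) yz'(3) P.M.a_ac)
    with Ld(3)[OF yz(1) yz'(1)] yz'(2) show ?case by blast
  qed
  note all = this
  have Gn: "z = \<zero>\<^bsub>P\<^esub>" if "z \<in> G n" for z
  proof -
    from that obtain f where f: "\<forall>p\<in>set S. f p \<in> F n" "z = ?m f" by (auto simp: G_def)
    have "msum P (map (\<lambda>p. f p \<odot>\<^bsub>P\<^esub> fst p) S) = \<zero>\<^bsub>P\<^esub>"
    proof (rule P.msum_zero)
      fix w assume "w \<in> set (map (\<lambda>p. f p \<odot>\<^bsub>P\<^esub> fst p) S)"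
      then obtain p where "p \<in> set S" "w = f p \<odot>\<^bsub>P\<^esub> fst p" by auto
      then show "w = \<zero>\<^bsub>P\<^esub>" using f(1) Fn Sd by simp
    qed
    then show ?thesis using f(2) by simp
  qed
  have "carrier P \<subseteq> L"
  proof
    fix x assume "x \<in> carrier P"
    then obtain y z where "y \<in> L" "z \<in> G n" "x = y \<oplus>\<^bsub>P\<^esub> z" using all by blast
    moreover from this have "z = \<zero>\<^bsub>P\<^esub>" "y \<in> carrier P" using Gn Ld(1) by blast+
    ultimately show "x \<in> L" by simp
  qed
  with Ld(1) show ?thesis by blast
qed

section \<open>Complexes and roofs\<close>

lemma bounded_complexD:
  assumes "bounded_complex A X"
  shows "fd_module A (obj X n)" "right_module A (obj X n)"
    "mod_hom A (obj X n) (obj X (n + 1)) (diff X n)"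
    "x \<in> carrier (obj X n) \<Longrightarrow> diff X (n + 1) (diff X n x) = \<zero>\<^bsub>obj X (n + 2)\<^esub>"
    "finite {n. carrier (obj X n) \<noteq> {\<zero>\<^bsub>obj X n\<^esub>}}"
  using assms fd_moduleD by (auto simp: bounded_complex_def)

lemma chain_mapD:
  assumes "chain_map A X Y f"
  shows "mod_hom A (obj X n) (obj Y n) (f n)"
    "x \<in> carrier (obj X n) \<Longrightarrow> f (n + 1) (diff X n x) = diff Y n (f n x)"
  using assms by (auto simp: chain_map_def)

lemma coboundaries_closed:
  assumes X: "bounded_complex A X"
  shows "coboundaries X n \<subseteq> carrier (obj X n)" "\<zero>\<^bsub>obj X n\<^esub> \<in> coboundaries X n"
    "\<lbrakk>x \<in> coboundaries X n; y \<in> coboundaries X n\<rbrakk> \<Longrightarrow> x \<oplus>\<^bsub>obj X n\<^esub> y \<in> coboundaries X n"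
proof -
  have "mod_hom A (obj X (n - 1)) (obj X n) (diff X (n - 1))" using bounded_complexD(3)[OF X, of
    "n - 1"] by simp
  from submoduleD[OF image_submodule[OF this bounded_complexD(2)[OF X] bounded_complexD(2)[OF X]]]
  show "coboundaries X n \<subseteq> carrier (obj X n)" "\<zero>\<^bsub>obj X n\<^esub> \<in> coboundaries X n"
    "\<lbrakk>x \<in> coboundaries X n; y \<in> coboundaries X n\<rbrakk> \<Longrightarrow> x \<oplus>\<^bsub>obj X n\<^esub> y \<in> coboundaries X n"
    by (simp_all add: coboundaries_def)
qed

lemma cocycles_submodule:
  assumes "bounded_complex A X" shows "submodule (cocycles X n) A (obj X n)"
  unfolding cocycles_def
  by (rule ker_submodule[OF bounded_complexD(3)[OF assms] bounded_complexD(2)[OF assms]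
    bounded_complexD(2)[OF assms]])

lemma chain_map_cocycles:
  assumes X: "bounded_complex A X" and Y: "bounded_complex A Y" and f: "chain_map A X Y f"
    and x: "x \<in> cocycles X n"
  shows "f n x \<in> cocycles Y n"
  using x mod_homD(1)[OF chain_mapD(1)[OF f]]
    mod_hom_zero[OF chain_mapD(1)[OF f] bounded_complexD(2)[OF X] bounded_complexD(2)[OF Y]]
  by (simp add: cocycles_def ker_def chain_mapD(2)[OF f, symmetric])

lemma chain_map_coboundaries:
  assumes f: "chain_map A X Y f" and x: "x \<in> coboundaries X n"
  shows "f n x \<in> coboundaries Y n"
proof -
  obtain y where y: "y \<in> carrier (obj X (n - 1))" "x = diff X (n - 1) y"
    using x by (auto simp: coboundaries_def)
  then have "f n x = diff Y (n - 1) (f (n - 1) y)" using chain_mapD(2)[OF f y(1)] by simp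
  then show ?thesis using mod_homD(1)[OF chain_mapD(1)[OF f] y(1)] by (auto simp: coboundaries_def)
qed

lemma chain_map_comp:
  assumes "chain_map A X Y f" "chain_map A Y Z g"
  shows "chain_map A X Z (g \<circ>\<^sub>c f)"
  unfolding chain_map_def comp_map_def
  using mod_hom_compo[OF chain_mapD(1)[OF assms(1)] chain_mapD(1)[OF assms(2)]]
    chain_mapD(2)[OF assms(1)] chain_mapD(2)[OF assms(2)] mod_homD(1)[OF chain_mapD(1)[OF assms(1)]]
  by simp

lemma homotopic_refl:
  assumes X: "bounded_complex A X" and Y: "bounded_complex A Y" and f: "chain_map A X Y f"
  shows "homotopic A X Y f f"
  unfolding homotopic_def
proof (intro exI[of _ "\<lambda>n x. \<zero>\<^bsub>obj Y (n - 1)\<^esub>"] allI conjI ballI)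
  fix n
  show "mod_hom A (obj X n) (obj Y (n - 1)) (\<lambda>x. \<zero>\<^bsub>obj Y (n - 1)\<^esub>)"
    by (rule mod_hom_const_zero[OF bounded_complexD(2)[OF Y]])
  fix x assume x: "x \<in> carrier (obj X n)"
  interpret Yn: right_module A "obj Y n" by (rule bounded_complexD(2)[OF Y])
  have "diff Y (n - 1) \<zero>\<^bsub>obj Y (n - 1)\<^esub> = \<zero>\<^bsub>obj Y n\<^esub>"
    using mod_hom_zero[OF bounded_complexD(3)[OF Y, of "n - 1"] bounded_complexD(2)[OF Y]
      bounded_complexD(2)[OF Y]]
    by simp
  then show "f n x = f n x \<oplus>\<^bsub>obj Y n\<^esub> (diff Y (n - 1) \<zero>\<^bsub>obj Y (n - 1)\<^esub> \<oplus>\<^bsub>obj Y n\<^esub> \<zero>\<^bsub>obj Y (n + 1 -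
    1)\<^esub>)"
    using mod_homD(1)[OF chain_mapD(1)[OF f] x] by simp
qed

lemma quasi_isoD:
  assumes "quasi_iso A X Y f"
  shows "chain_map A X Y f"
    "x \<in> cocycles X n \<Longrightarrow> f n x \<in> coboundaries Y n \<Longrightarrow> x \<in> coboundaries X n"
    "y \<in> cocycles Y n \<Longrightarrow> \<exists>x\<in>cocycles X n. \<exists>b\<in>coboundaries Y n. y = f n x \<oplus>\<^bsub>obj Y n\<^esub> b"
  using assms by (auto simp: quasi_iso_def)

lemma quasi_iso_comp:
  assumes X: "bounded_complex A X" and Y: "bounded_complex A Y" and Z: "bounded_complex A Z"
    and f: "quasi_iso A X Y f" and g: "quasi_iso A Y Z g"
  shows "quasi_iso A X Z (g \<circ>\<^sub>c f)"
  unfolding quasi_iso_def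
proof (intro conjI allI ballI impI)
  note fc = quasi_isoD(1)[OF f] and gc = quasi_isoD(1)[OF g]
  show "chain_map A X Z (g \<circ>\<^sub>c f)" by (rule chain_map_comp[OF fc gc])
  fix n
  {
    fix x assume x: "x \<in> cocycles X n" "(g \<circ>\<^sub>c f) n x \<in> coboundaries Z n"
    then have "f n x \<in> coboundaries Y n"
      using quasi_isoD(2)[OF g chain_map_cocycles[OF X Y fc x(1)]] by (simp add: comp_map_def)
    then show "x \<in> coboundaries X n" by (rule quasi_isoD(2)[OF f x(1)])
  next
    fix z assume z: "z \<in> cocycles Z n"
    obtain y b where y: "y \<in> cocycles Y n" "b \<in> coboundaries Z n" "z = g n y \<oplus>\<^bsub>obj Z n\<^esub> b"
      using quasi_isoD(3)[OF g z] by blast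
    obtain x b' where x: "x \<in> cocycles X n" "b' \<in> coboundaries Y n" "y = f n x \<oplus>\<^bsub>obj Y n\<^esub> b'"
      using quasi_isoD(3)[OF f y(1)] by blast
    interpret Zn: right_module A "obj Z n" by (rule bounded_complexD(2)[OF Z])
    have gb: "g n b' \<in> coboundaries Z n" by (rule chain_map_coboundaries[OF gc x(2)])
    have xc: "x \<in> carrier (obj X n)" using x(1) by (simp add: cocycles_def ker_def)
    have fx: "f n x \<in> carrier (obj Y n)" by (rule mod_homD(1)[OF chain_mapD(1)[OF fc] xc])
    have bc: "b \<in> carrier (obj Z n)" "b' \<in> carrier (obj Y n)" "g n b' \<in> carrier (obj Z n)"
      using y(2) x(2) gb coboundaries_closed(1)[OF Z] coboundaries_closed(1)[OF Y] by blast+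
    have "z = g n (f n x) \<oplus>\<^bsub>obj Z n\<^esub> (g n b' \<oplus>\<^bsub>obj Z n\<^esub> b)"
      using bc fx mod_homD(1)[OF chain_mapD(1)[OF gc] fx]
      by (simp add: y(3) x(3) mod_homD(2)[OF chain_mapD(1)[OF gc]] Zn.M.a_assoc)
    moreover have "g n b' \<oplus>\<^bsub>obj Z n\<^esub> b \<in> coboundaries Z n"
      by (rule coboundaries_closed(3)[OF Z gb y(2)])
    ultimately show "\<exists>x\<in>cocycles X n. \<exists>b\<in>coboundaries Z n. z = (g \<circ>\<^sub>c f) n x \<oplus>\<^bsub>obj Z n\<^esub> b"
      using x(1) by (auto simp: comp_map_def)
  }
qed

lemma chain_iso_quasi_iso:
  assumes Z: "bounded_complex A Z" and X: "bounded_complex A X" and s: "chain_map A Z X s"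
    and bij: "\<And>n. bij_betw (s n) (carrier (obj Z n)) (carrier (obj X n))"
  shows "quasi_iso A Z X s"
  unfolding quasi_iso_def
proof (intro conjI allI ballI impI s)
  fix n
  have inj: "inj_on (s n) (carrier (obj Z n))" and im: "s n ` carrier (obj Z n) = carrier (obj X
    n)" for n
    using bij by (auto simp: bij_betw_def)
  have dZ: "diff Z (n - 1) z \<in> carrier (obj Z n)" if "z \<in> carrier (obj Z (n - 1))" for z n
    using mod_homD(1)[OF bounded_complexD(3)[OF Z] that] by simp
  {
    fix x assume x: "x \<in> cocycles Z n" "s n x \<in> coboundaries X n"
    then obtain y where y: "y \<in> carrier (obj X (n - 1))" "s n x = diff X (n - 1) y"
      by (auto simp: coboundaries_def)
    then obtain z where z: "z \<in> carrier (obj Z (n - 1))" "y = s (n - 1) z" unfolding im[symmetric]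
      by blast
    have "s n x = s n (diff Z (n - 1) z)" using chain_mapD(2)[OF s z(1)] y z by simp
    then have "x = diff Z (n - 1) z"
      using x dZ[OF z(1)] by (intro inj_onD[OF inj]) (auto simp: cocycles_def ker_def)
    then show "x \<in> coboundaries Z n" using z by (auto simp: coboundaries_def)
  next
    fix y assume y: "y \<in> cocycles X n"
    then have "y \<in> carrier (obj X n)" by (simp add: cocycles_def ker_def)
    then obtain x where x: "x \<in> carrier (obj Z n)" "y = s n x" unfolding im[symmetric] by blast
    interpret Xn: right_module A "obj X n" by (rule bounded_complexD(2)[OF X])
    interpret Zn: right_module A "obj Z (n + 1)" by (rule bounded_complexD(2)[OF Z])
    have "s (n + 1) (diff Z n x) = s (n + 1) \<zero>\<^bsub>obj Z (n + 1)\<^esub>"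
      using y x chain_mapD(2)[OF s x(1)]
        mod_hom_zero[OF chain_mapD(1)[OF s] bounded_complexD(2)[OF Z] bounded_complexD(2)[OF X]]
      by (simp add: cocycles_def ker_def)
    then have "diff Z n x = \<zero>\<^bsub>obj Z (n + 1)\<^esub>"
      using mod_homD(1)[OF bounded_complexD(3)[OF Z] x(1)] by (intro inj_onD[OF inj]) auto
    then have "x \<in> cocycles Z n" using x by (simp add: cocycles_def ker_def)
    moreover have "y = s n x \<oplus>\<^bsub>obj X n\<^esub> \<zero>\<^bsub>obj X n\<^esub>"
      using x mod_homD(1)[OF chain_mapD(1)[OF s] x(1)] by simp
    ultimately show "\<exists>x\<in>cocycles Z n. \<exists>b\<in>coboundaries X n. y = s n x \<oplus>\<^bsub>obj X n\<^esub> b"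
      using coboundaries_closed(2)[OF X] by blast
  }
qed

lemma quasi_iso_id:
  assumes "bounded_complex A X" shows "quasi_iso A X X (\<lambda>n x. x)"
  by (rule chain_iso_quasi_iso[OF assms assms])
    (auto simp: chain_map_def mod_hom_id bij_betw_def)

text \<open>The shifts that occur in the argument are those by 1 and -1. Both carry the negated
  differential, whose square is zero because homomorphisms commute with negation.\<close>

lemma shift_odd_bounded:
  assumes X: "bounded_complex A X" and r: "odd r"
  shows "bounded_complex A (shift r X)"
proof -
  have "mod_hom A (obj X (n + r)) (obj X (n + r + 1)) (\<lambda>x. \<ominus>\<^bsub>obj X (n + r + 1)\<^esub> diff X (n + r) x)"
    for n
    by (rule mod_hom_uminus[OF bounded_complexD(3)[OF X] bounded_complexD(2)[OF X]])
  moreover have "\<ominus>\<^bsub>obj X (n + r + 2)\<^esub> diff X (n + r + 1) (\<ominus>\<^bsub>obj X (n + r + 1)\<^esub> diff X (n + r) x) =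
    \<zero>\<^bsub>obj X (n + r + 2)\<^esub>"
    if x: "x \<in> carrier (obj X (n + r))" for n x
  proof -
    interpret Y: right_module A "obj X (n + r + 2)" by (rule bounded_complexD(2)[OF X])
    have "diff X (n + r) x \<in> carrier (obj X (n + r + 1))" by (rule mod_homD(1)[OF
      bounded_complexD(3)[OF X] x])
    then show ?thesis
      using mod_hom_neg[OF bounded_complexD(3)[OF X] bounded_complexD(2)[OF X]
        bounded_complexD(2)[OF X], of "diff X (n + r) x" "n + r + 1"]
        bounded_complexD(4)[OF X x] Y.M.a_inv_zero by (simp add: add.assoc)
  qed
  moreover have "finite {n. carrier (obj X (n + r)) \<noteq> {\<zero>\<^bsub>obj X (n + r)\<^esub>}}"
  proof (rule finite_subset)
    show "{n. carrier (obj X (n + r)) \<noteq> {\<zero>\<^bsub>obj X (n + r)\<^esub>}} \<subseteq>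
      (\<lambda>n. n - r) ` {n. carrier (obj X n) \<noteq> {\<zero>\<^bsub>obj X n\<^esub>}}"
      by (auto intro!: image_eqI[where x = "_ + r"])
    show "finite ((\<lambda>n. n - r) ` {n. carrier (obj X n) \<noteq> {\<zero>\<^bsub>obj X n\<^esub>}})"
      using bounded_complexD(5)[OF X] by simp
  qed
  ultimately show ?thesis
    using r bounded_complexD(1)[OF X] by (simp add: bounded_complex_def shift_def ac_simps)
qed

context kalgebra begin

text \<open>Terms are replaced degree by degree by list models, and the differential is conjugated
  with the bijections. The apex of a roof must consist of lists of scalars, so this is what turns a
  chain map starting at X into a roof.\<close>

lemma complex_univ_model:
  assumes X: "bounded_complex A X"
  obtains Z :: "('a, 'k univ) cplx" and s where "bounded_complex A Z" "chain_map A Z X s"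
    "quasi_iso A Z X s"
proof -
  have "\<exists>N h g. fd_module A (N :: ('a, 'k univ) module) \<and> mod_hom A (obj X n) N h \<and> mod_hom A N
    (obj X n) g \<and>
    (\<forall>x\<in>carrier (obj X n). g (h x) = x) \<and> (\<forall>y\<in>carrier N. h (g y) = y)" for n
  proof -
    obtain N :: "('a, 'k univ) module" and h where N: "fd_module A N" "iso_map (obj X n) N h"
      using fd_univ_model[OF bounded_complexD(1)[OF X]] by blast
    show ?thesis
      by (rule iso_mapE[OF N(2) bounded_complexD(2)[OF X] fd_moduleD[OF N(1)]]) (use N(1) in blast)
  qed
  then obtain N h g where N: "\<And>n. fd_module A (N n :: ('a, 'k univ) module)"
    and h: "\<And>n. mod_hom A (obj X n) (N n) (h n)" and g: "\<And>n. mod_hom A (N n) (obj X n) (g n)"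
    and gh: "\<And>n x. x \<in> carrier (obj X n) \<Longrightarrow> g n (h n x) = x"
    and hg: "\<And>n y. y \<in> carrier (N n) \<Longrightarrow> h n (g n y) = y"
    by metis
  define Z where "Z = \<lparr>obj = N, diff = (\<lambda>n z. h (n + 1) (diff X n (g n z)))\<rparr>"
  have oZ: "obj Z n = N n" and dZ: "diff Z n = (\<lambda>z. h (n + 1) (diff X n (g n z)))" for n
    by (simp_all add: Z_def)
  note gc = mod_homD(1)[OF g] and dc = mod_homD(1)[OF bounded_complexD(3)[OF X]]
  have Zb: "bounded_complex A Z"
    unfolding bounded_complex_def oZ dZ
  proof (intro conjI allI ballI)
    fix n
    show "fd_module A (N n)" by (rule N)
    show "mod_hom A (N n) (N (n + 1)) (\<lambda>z. h (n + 1) (diff X n (g n z)))"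
      by (rule mod_hom_comp[OF mod_hom_comp[OF g bounded_complexD(3)[OF X]] h])
    fix z assume "z \<in> carrier (N n)"
    then have c: "g n z \<in> carrier (obj X n)" "diff X n (g n z) \<in> carrier (obj X (n + 1))"
      using gc dc by blast+
    have "h (n + 1 + 1) \<zero>\<^bsub>obj X (n + 2)\<^esub> = \<zero>\<^bsub>N (n + 2)\<^esub>"
      using mod_hom_zero[OF h bounded_complexD(2)[OF X] fd_moduleD[OF N], of "n + 2"] by (simp
        add: add.assoc)
    then show "h (n + 1 + 1) (diff X (n + 1) (g (n + 1) (h (n + 1) (diff X n (g n z))))) = \<zero>\<^bsub>N (n
      + 2)\<^esub>"
      using c by (simp only: gh bounded_complexD(4)[OF X])
  next
    have "carrier (N n) = {\<zero>\<^bsub>N n\<^esub>}" if *: "carrier (obj X n) = {\<zero>\<^bsub>obj X n\<^esub>}" for n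
    proof -
      interpret Nn: right_module A "N n" by (rule fd_moduleD[OF N])
      have "z = \<zero>\<^bsub>N n\<^esub>" if z: "z \<in> carrier (N n)" for z
      proof -
        have "g n z = \<zero>\<^bsub>obj X n\<^esub>" using gc[OF z] * by blast
        then show ?thesis using hg[OF z] mod_hom_zero[OF h bounded_complexD(2)[OF X] fd_moduleD[OF
          N], of n] by simp
      qed
      then show ?thesis using Nn.M.zero_closed by blast
    qed
    then have "{n. carrier (N n) \<noteq> {\<zero>\<^bsub>N n\<^esub>}} \<subseteq> {n. carrier (obj X n) \<noteq> {\<zero>\<^bsub>obj X n\<^esub>}}" by blast
    then show "finite {n. carrier (N n) \<noteq> {\<zero>\<^bsub>N n\<^esub>}}" using bounded_complexD(5)[OF X] finite_subset
      by blast
  qed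
  have s: "chain_map A Z X g"
    unfolding chain_map_def oZ dZ using g gh gc dc by simp
  have "bij_betw (g n) (carrier (obj Z n)) (carrier (obj X n))" for n
    unfolding oZ by (rule bij_betw_byWitness[of _ "h n"]) (use gh hg gc mod_homD(1)[OF h] in auto)
  from chain_iso_quasi_iso[OF Zb X s this] show thesis using Zb s that by blast
qed

text \<open>For a list model s : Z -> X, the maps s and q s form a roof from X to Y and, with the
  legs interchanged, a roof back. The two compose over the identity of Z, so each composite has
  equal legs and represents an identity.\<close>

lemma Db_iso_quasi_iso:
  assumes X: "bounded_complex A X" and Y: "bounded_complex A Y" and q: "quasi_iso A X Y q"
  shows "Db_iso A X Y"
proof -
  obtain Z :: "('a, 'k univ) cplx" and s where Z: "bounded_complex A Z" "chain_map A Z X s"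
    "quasi_iso A Z X s"
    using complex_univ_model[OF X] by blast
  have qs: "quasi_iso A Z Y (q \<circ>\<^sub>c s)" by (rule quasi_iso_comp[OF Z(1) X Y Z(3) q])
  note qsc = quasi_isoD(1)[OF qs]
  have idc: "f \<circ>\<^sub>c (\<lambda>n x. x) = f" for f :: "int \<Rightarrow> 'k univ \<Rightarrow> 'd" by (simp add: comp_map_def comp_def)
  note idq = quasi_iso_id[OF Z(1)]
  have 1: "is_roof A X Y (Z, s, q \<circ>\<^sub>c s)" "is_roof A Y X (Z, q \<circ>\<^sub>c s, s)"
    using X Y Z qs qsc by simp_all
  have 2: "roof_comp A Y (Z, s, q \<circ>\<^sub>c s) (Z, q \<circ>\<^sub>c s, s) (Z, s, s)"
    unfolding roof_comp.simps
    by (intro exI[of _ "\<lambda>n x. x"]) (simp add: idc idq Z quasi_isoD(1)[OF idq] homotopic_refl[OF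
      Z(1) Y qsc])
  have 3: "roof_comp A X (Z, q \<circ>\<^sub>c s, s) (Z, s, q \<circ>\<^sub>c s) (Z, q \<circ>\<^sub>c s, q \<circ>\<^sub>c s)"
    unfolding roof_comp.simps
    by (intro exI[of _ "\<lambda>n x. x"]) (simp add: idc idq Z quasi_isoD(1)[OF idq] homotopic_refl[OF
      Z(1) X Z(2)])
  have 4: "represents_id A X (Z, s, s)"
    unfolding represents_id.simps roof_equiv.simps is_roof.simps
    by (intro conjI X Z exI[of _ Z] exI[of _ "\<lambda>n x. x"])
      (simp_all add: idc Z quasi_isoD(1)[OF idq] homotopic_refl[OF Z(1) X Z(2)])
  have 5: "represents_id A Y (Z, q \<circ>\<^sub>c s, q \<circ>\<^sub>c s)"
    unfolding represents_id.simps roof_equiv.simps is_roof.simps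
    by (intro conjI Y Z qs qsc exI[of _ Z] exI[of _ "\<lambda>n x. x"])
      (simp_all add: idc Z quasi_isoD(1)[OF idq] qs homotopic_refl[OF Z(1) Y qsc])
  show ?thesis unfolding Db_iso_def using 1 2 3 4 5 by blast
qed

text \<open>The form in which vanishing of Hom is used. Applied to the roof (Z, s, \<Phi> s), it
  gives a refinement u : W -> Z such that \<Phi> composed with q = s u is homotopic to zero, with q
  a quasi-isomorphism.\<close>

lemma Db_hom_zeroE:
  assumes 0: "Db_hom_zero A X Y" and X: "bounded_complex A X" and Y: "bounded_complex A Y"
    and \<Phi>: "chain_map A X Y \<Phi>"
  obtains W :: "('a, 'k univ) cplx" and q h where "bounded_complex A W" "quasi_iso A W X q"
    "\<And>n. mod_hom A (obj W n) (obj Y (n - 1)) (h n)"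
    "\<And>n w. w \<in> carrier (obj W n) \<Longrightarrow> \<Phi> n (q n w) = diff Y (n - 1) (h n w) \<oplus>\<^bsub>obj Y n\<^esub> h (n + 1) (diff
      W n w)"
proof -
  obtain Z :: "('a, 'k univ) cplx" and s where Z: "bounded_complex A Z" "chain_map A Z X s"
    "quasi_iso A Z X s"
    using complex_univ_model[OF X] by blast
  have "is_roof A X Y (Z, s, \<Phi> \<circ>\<^sub>c s)" using X Y Z chain_map_comp[OF Z(2) \<Phi>] by simp
  then have "roof_equiv A X Y (Z, s, \<Phi> \<circ>\<^sub>c s) (Z, s, zero_map Y)" using 0 by (simp only:
    Db_hom_zero_def)
  then obtain W :: "('a, 'k univ) cplx" and u and u' :: "int \<Rightarrow> 'k univ \<Rightarrow> 'k univ"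
    where W: "bounded_complex A W" "quasi_iso A W X (s \<circ>\<^sub>c u)"
    "homotopic A W Y ((\<Phi> \<circ>\<^sub>c s) \<circ>\<^sub>c u) (zero_map Y \<circ>\<^sub>c u')"
    unfolding roof_equiv.simps by (elim conjE exE) (rule that; assumption)
  then obtain h where h: "\<And>n. mod_hom A (obj W n) (obj Y (n - 1)) (h n)"
    "\<And>n w. w \<in> carrier (obj W n) \<Longrightarrow> ((\<Phi> \<circ>\<^sub>c s) \<circ>\<^sub>c u) n w = (zero_map Y \<circ>\<^sub>c u') n w \<oplus>\<^bsub>obj Y n\<^esub>
      (diff Y (n - 1) (h n w) \<oplus>\<^bsub>obj Y n\<^esub> h (n + 1) (diff W n w))"
    unfolding homotopic_def by blast
  show thesis
  proof (rule that[OF W(1,2) h(1)])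
    fix n w assume w: "w \<in> carrier (obj W n)"
    interpret Yn: right_module A "obj Y n" by (rule bounded_complexD(2)[OF Y])
    have "diff Y (n - 1) (h n w) \<in> carrier (obj Y n)"
      using mod_homD(1)[OF bounded_complexD(3)[OF Y] mod_homD(1)[OF h(1) w]] by simp
    moreover have "h (n + 1) (diff W n w) \<in> carrier (obj Y n)"
      using mod_homD(1)[OF h(1) mod_homD(1)[OF bounded_complexD(3)[OF W(1)] w]] by simp
    ultimately show "\<Phi> n ((s \<circ>\<^sub>c u) n w) = diff Y (n - 1) (h n w) \<oplus>\<^bsub>obj Y n\<^esub> h (n + 1) (diff W n w)"
      using h(2)[OF w] by (simp add: comp_map_def zero_map_def)
  qed
qed

end

section \<open>Complexes in degrees -1 and 0\<close>

locale two_term_complex = kalgebra A for A :: "('k::field, 'a) module" and X :: "('a, 'm) cplx" +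
  assumes X: "bounded_complex A X"
    and trivial: "n \<noteq> -1 \<Longrightarrow> n \<noteq> 0 \<Longrightarrow> carrier (obj X n) = {\<zero>\<^bsub>obj X n\<^esub>}"
begin

abbreviation "d \<equiv> diff X (-1)"

lemma d_hom: "mod_hom A (obj X (-1)) (obj X 0) d"
  using bounded_complexD(3)[OF X, of "-1"] by simp

lemma cocycle0: "y \<in> carrier (obj X 0) \<Longrightarrow> y \<in> cocycles X 0"
  using mod_homD(1)[OF bounded_complexD(3)[OF X], of y 0] trivial[of 1] by (simp add: cocycles_def
    ker_def)

text \<open>A map \<phi> from degree 0 to degree -1 that composes to zero with d on both sides is a
  chain map X -> X[-1]. Pulled back along some q it becomes nullhomotopic, but on a degree 0 cocycle
  w of W the homotopy gives nothing: one term passes through degree -2 of X, the other through the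
  differential of w. Every y is q w plus a coboundary, and \<phi> kills both.\<close>

lemma no_hom_degree_minus_1:
  assumes 0: "Db_hom_zero A X (shift (-1) X)" and \<phi>: "mod_hom A (obj X 0) (obj X (-1)) \<phi>"
    and d\<phi>: "\<And>y. y \<in> carrier (obj X 0) \<Longrightarrow> d (\<phi> y) = \<zero>\<^bsub>obj X 0\<^esub>"
    and \<phi>d: "\<And>x. x \<in> carrier (obj X (-1)) \<Longrightarrow> \<phi> (d x) = \<zero>\<^bsub>obj X (-1)\<^esub>"
    and y: "y \<in> carrier (obj X 0)"
  shows "\<phi> y = \<zero>\<^bsub>obj X (-1)\<^esub>"
proof -
  let ?Y = "shift (-1) X"
  have Y: "bounded_complex A ?Y" by (rule shift_odd_bounded[OF X]) simp
  note rX = bounded_complexD(2)[OF X] and hX = bounded_complexD(3)[OF X]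
  note zX = mod_hom_zero[OF hX rX rX] and nz = abelian_group.a_inv_zero[OF
    right_module.axioms(2)[OF rX]]
  define \<Phi> where "\<Phi> n = (if n = 0 then \<phi> else (\<lambda>x. \<zero>\<^bsub>obj X (n - 1)\<^esub>))" for n
  have oY: "obj ?Y n = obj X (n - 1)" and dY: "diff ?Y n x = \<ominus>\<^bsub>obj X n\<^esub> diff X (n - 1) x" for n x
    by (simp_all add: shift_def)
  interpret X0: right_module A "obj X 0" by (rule rX)
  interpret X1: right_module A "obj X (-1)" by (rule rX)
  have "chain_map A X ?Y \<Phi>"
    unfolding chain_map_def
  proof (intro allI conjI ballI)
    fix n
    show "mod_hom A (obj X n) (obj ?Y n) (\<Phi> n)"
      using \<phi> mod_hom_const_zero[OF rX] by (cases "n = 0") (simp_all add: \<Phi>_def oY)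
    fix x assume x: "x \<in> carrier (obj X n)"
    consider "n = 0" | "n = -1" | "n \<noteq> 0" "n \<noteq> -1" by blast
    then show "\<Phi> (n + 1) (diff X n x) = diff ?Y n (\<Phi> n x)"
    proof cases
      case 1
      then show ?thesis using x d\<phi> by (simp add: \<Phi>_def dY nz)
    next
      case 2
      then show ?thesis using x \<phi>d zX[of "-2"] by (simp add: \<Phi>_def dY nz)
    next
      case 3
      then show ?thesis using zX[of "n - 1"] by (simp add: \<Phi>_def dY nz)
    qed
  qed
  from Db_hom_zeroE[OF 0 X Y this] obtain W :: "('a, 'k univ) cplx" and q h where
    W: "bounded_complex A W" "quasi_iso A W X q" and h: "\<And>n. mod_hom A (obj W n) (obj ?Y (n - 1))
      (h n)"
    and eq: "\<And>n w. w \<in> carrier (obj W n) \<Longrightarrow> \<Phi> n (q n w) = diff ?Y (n - 1) (h n w) \<oplus>\<^bsub>obj ?Y n\<^esub> h (n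
      + 1) (diff W n w)"
    by blast
  obtain w b where w: "w \<in> cocycles W 0" "b \<in> coboundaries X 0" "y = q 0 w \<oplus>\<^bsub>obj X 0\<^esub> b"
    using quasi_isoD(3)[OF W(2) cocycle0[OF y]] by blast
  obtain x where x: "x \<in> carrier (obj X (-1))" "b = d x" using w(2) by (auto simp: coboundaries_def)
  have wc: "w \<in> carrier (obj W 0)" and dw: "diff W 0 w = \<zero>\<^bsub>obj W 1\<^esub>" using w(1) by (auto simp:
    cocycles_def ker_def)
  have "h 0 w = \<zero>\<^bsub>obj X (-2)\<^esub>" using mod_homD(1)[OF h wc] trivial[of "-2"] by (simp add: oY)
  moreover have "h 1 (diff W 0 w) = \<zero>\<^bsub>obj X (-1)\<^esub>"
    using mod_hom_zero[OF h bounded_complexD(2)[OF W(1)] bounded_complexD(2)[OF Y], of 1] dw by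
      (simp add: oY)
  ultimately have "\<phi> (q 0 w) = \<zero>\<^bsub>obj X (-1)\<^esub>"
    using eq[OF wc] zX[of "-2"] by (simp add: \<Phi>_def oY dY nz)
  moreover have "q 0 w \<in> carrier (obj X 0)" by (rule mod_homD(1)[OF chain_mapD(1)[OF
    quasi_isoD(1)[OF W(2)]] wc])
  ultimately show ?thesis
    using x \<phi>d mod_homD(1)[OF d_hom x(1)] by (simp add: w(3) mod_homD(2)[OF \<phi>])
qed

text \<open>
  If \<open>d\<close> is injective, a bounded quasi-isomorphism into \<open>X\<close> has a homotopy section because the terms of
  \<open>X\<close> are projective; composing with it turns a nullhomotopy on the roof into one on \<open>X\<close>.
\<close>

lemma hom_degree_1_nullhomotopic:
  assumes 0: "Db_hom_zero A X (shift 1 X)" and \<phi>: "mod_hom A (obj X (-1)) (obj X 0) \<phi>"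
    and inj: "inj_on d (carrier (obj X (-1)))"
    and S1: "dual_basis A (obj X (-1)) S1" and S0: "dual_basis A (obj X 0) S0"
  shows "\<exists>a b. mod_hom A (obj X (-1)) (obj X (-1)) a \<and> mod_hom A (obj X 0) (obj X 0) b \<and>
    (\<forall>x\<in>carrier (obj X (-1)). \<phi> x = d (a x) \<oplus>\<^bsub>obj X 0\<^esub> b (d x))"
proof -
  let ?Y = "shift 1 X"
  let ?P1 = "obj X (-1)" and ?P0 = "obj X 0"
  have Y: "bounded_complex A ?Y" by (rule shift_odd_bounded[OF X]) simp
  note rX = bounded_complexD(2)[OF X] and hX = bounded_complexD(3)[OF X]
  note zX = mod_hom_zero[OF hX rX rX] and nz = abelian_group.a_inv_zero[OF
    right_module.axioms(2)[OF rX]]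
  define \<Phi> where "\<Phi> n = (if n = -1 then \<phi> else (\<lambda>x. \<zero>\<^bsub>obj X (n + 1)\<^esub>))" for n
  have oY: "obj ?Y n = obj X (n + 1)" and dY: "diff ?Y n x = \<ominus>\<^bsub>obj X (n + 2)\<^esub> diff X (n + 1) x"
    for n x
    by (simp_all add: shift_def add.assoc)
  interpret X0: right_module A ?P0 by (rule rX)
  interpret X1: right_module A ?P1 by (rule rX)
  have "chain_map A X ?Y \<Phi>"
    unfolding chain_map_def
  proof (intro allI conjI ballI)
    fix n
    show "mod_hom A (obj X n) (obj ?Y n) (\<Phi> n)"
      using \<phi> mod_hom_const_zero[OF rX] by (cases "n = -1") (simp_all add: \<Phi>_def oY)
    fix x assume x: "x \<in> carrier (obj X n)"
    consider "n = -1" | "n = -2" | "n \<noteq> -2" "n \<noteq> -1" by blast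
    then show "\<Phi> (n + 1) (diff X n x) = diff ?Y n (\<Phi> n x)"
    proof cases
      case 1
      then have "diff X 0 (\<phi> x) = \<zero>\<^bsub>obj X 1\<^esub>"
        using cocycle0[OF mod_homD(1)[OF \<phi>]] x by (simp add: cocycles_def ker_def)
      then show ?thesis using 1 by (simp add: \<Phi>_def dY nz)
    next
      case 2
      then have "diff X (-2) x = \<zero>\<^bsub>obj X (-1)\<^esub>" using x trivial[of "-2"] zX[of "-2"] by simp
      then show ?thesis using 2 zX[of "-1"] mod_hom_zero[OF \<phi> rX rX] by (simp add: \<Phi>_def dY nz)
    next
      case 3
      then show ?thesis using zX[of "n + 1"] by (simp add: \<Phi>_def dY add.assoc nz)
    qed
  qed
  from Db_hom_zeroE[OF 0 X Y this] obtain W :: "('a, 'k univ) cplx" and q h where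
    W: "bounded_complex A W" "quasi_iso A W X q" and h: "\<And>n. mod_hom A (obj W n) (obj ?Y (n - 1))
      (h n)"
    and eq: "\<And>n w. w \<in> carrier (obj W n) \<Longrightarrow> \<Phi> n (q n w) = diff ?Y (n - 1) (h n w) \<oplus>\<^bsub>obj ?Y n\<^esub> h (n
      + 1) (diff W n w)"
    by blast
  note qc = quasi_isoD(1)[OF W(2)]
  note rW = bounded_complexD(2)[OF W(1)]
  have q0: "mod_hom A (obj W 0) ?P0 (q 0)" and q1: "mod_hom A (obj W (-1)) ?P1 (q (-1))"
    by (rule chain_mapD(1)[OF qc])+
  have dW: "mod_hom A (obj W (-1)) (obj W 0) (diff W (-1))" using bounded_complexD(3)[OF W(1), of
    "-1"] by simp
  have h1: "mod_hom A (obj W (-1)) ?P1 (h (-1))" using h[of "-1"] by (simp add: oY)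
  have h0: "mod_hom A (obj W 0) ?P0 (h 0)" using h[of 0] by (simp add: oY)
  have eq1: "\<phi> (q (-1) w) = \<ominus>\<^bsub>?P0\<^esub> d (h (-1) w) \<oplus>\<^bsub>?P0\<^esub> h 0 (diff W (-1) w)" if "w \<in> carrier (obj W
    (-1))" for w
    using eq[OF that] by (simp add: \<Phi>_def oY dY)
  \<comment> \<open>W may have terms above degree 0, so degree 0 elements of X have to be lifted to
    cocycles of W, where H^0(q) is defined.\<close>
  define C where "C = (obj W 0)\<lparr>carrier := cocycles W 0\<rparr>"
  have C: "right_module A C" unfolding C_def by (rule right_module_sub[OF rW cocycles_submodule[OF
    W(1)]])
  have Cc: "carrier C = cocycles W 0" by (simp add: C_def)
  have C_incl: "mod_hom A C (obj W 0) (\<lambda>x. x)"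
    by (rule mod_homI) (auto simp: C_def cocycles_def ker_def)
  let ?D = "dsum2 C ?P1"
  have D: "right_module A ?D" by (rule dsum2_right_module[OF C rX])
  \<comment> \<open>Surjectivity of H^0(q) says exactly that this map from C plus P1 reaches all of
    P0. A splitting with components r0 and s gives q r0 + d s = 1 in degree 0.\<close>
  let ?g = "\<lambda>u. q 0 (fst u) \<oplus>\<^bsub>?P0\<^esub> d (snd u)"
  have g: "mod_hom A ?D ?P0 ?g"
    by (intro mod_hom_add mod_hom_comp[OF mod_hom_fst] mod_hom_comp[OF mod_hom_snd]
      mod_hom_comp[OF C_incl q0, simplified] d_hom rX)
  have "\<exists>h'. mod_hom A ?P0 ?D h' \<and> (\<forall>x\<in>carrier ?P0. ?g (h' x) = x)"
  proof (rule dual_basis_lift[OF S0 rX D rX g mod_hom_id])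
    fix y assume y: "y \<in> carrier ?P0"
    obtain w b where w: "w \<in> cocycles W 0" "b \<in> coboundaries X 0" "y = q 0 w \<oplus>\<^bsub>?P0\<^esub> b"
      using quasi_isoD(3)[OF W(2) cocycle0[OF y]] by blast
    obtain x where x: "x \<in> carrier ?P1" "b = d x" using w(2) by (auto simp: coboundaries_def)
    show "y \<in> ?g ` carrier ?D"
      using w x by (intro image_eqI[where x = "(w, x)"]) (auto simp: Cc)
  qed
  then obtain k where k: "mod_hom A ?P0 ?D k" "\<And>y. y \<in> carrier ?P0 \<Longrightarrow> ?g (k y) = y" by blast
  define r0 where "r0 y = fst (k y)" for y
  define s where "s y = snd (k y)" for y
  have r0C: "mod_hom A ?P0 C r0" unfolding r0_def by (rule mod_hom_comp[OF k(1) mod_hom_fst])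
  have r0: "mod_hom A ?P0 (obj W 0) r0" using mod_hom_comp[OF r0C C_incl] by simp
  have s: "mod_hom A ?P0 ?P1 s" unfolding s_def by (rule mod_hom_comp[OF k(1) mod_hom_snd])
  have ks: "q 0 (r0 y) \<oplus>\<^bsub>?P0\<^esub> d (s y) = y" if "y \<in> carrier ?P0" for y
    using k(2)[OF that] by (simp add: r0_def s_def)
  have qr: "q 0 (r0 (d x)) = d (x \<ominus>\<^bsub>?P1\<^esub> s (d x))" if x: "x \<in> carrier ?P1" for x
  proof -
    have c: "d x \<in> carrier ?P0" "s (d x) \<in> carrier ?P1" "d (s (d x)) \<in> carrier ?P0" "q 0 (r0 (d
      x)) \<in> carrier ?P0"
      using x mod_homD(1)[OF d_hom] mod_homD(1)[OF s] mod_homD(1)[OF q0] mod_homD(1)[OF r0] by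
        blast+
    have "q 0 (r0 (d x)) = (q 0 (r0 (d x)) \<oplus>\<^bsub>?P0\<^esub> d (s (d x))) \<ominus>\<^bsub>?P0\<^esub> d (s (d x))"
      using c by (simp add: X0.M.ag_simps)
    also have "\<dots> = d x \<ominus>\<^bsub>?P0\<^esub> d (s (d x))" using ks[OF c(1)] by simp
    also have "\<dots> = d (x \<ominus>\<^bsub>?P1\<^esub> s (d x))" using x c by (simp add: mod_hom_minus[OF d_hom rX rX])
    finally show ?thesis .
  qed
  \<comment> \<open>By \<open>qr\<close>, q sends r0 (d x) to a coboundary. As H^0(q) is injective,
    r0 (d x) is itself a coboundary, so r0 d lifts through the differential of W.\<close>
  have "\<exists>r1. mod_hom A ?P1 (obj W (-1)) r1 \<and> (\<forall>x\<in>carrier ?P1. diff W (-1) (r1 x) = r0 (d x))"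
  proof (rule dual_basis_lift[OF S1 rX rW rW dW mod_hom_comp[OF d_hom r0]])
    fix x assume x: "x \<in> carrier ?P1"
    have "r0 (d x) \<in> cocycles W 0" using mod_homD(1)[OF r0C mod_homD(1)[OF d_hom x]] by (simp add:
      Cc)
    moreover have "x \<ominus>\<^bsub>?P1\<^esub> s (d x) \<in> carrier ?P1"
      using x mod_homD(1)[OF s mod_homD(1)[OF d_hom x]] by simp
    then have "q 0 (r0 (d x)) \<in> coboundaries X 0" unfolding qr[OF x] by (auto simp:
      coboundaries_def)
    ultimately have "r0 (d x) \<in> coboundaries W 0" by (rule quasi_isoD(2)[OF W(2)])
    then show "r0 (d x) \<in> diff W (-1) ` carrier (obj W (-1))" by (simp add: coboundaries_def)
  qed
  then obtain r1 where r1: "mod_hom A ?P1 (obj W (-1)) r1"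
    "\<And>x. x \<in> carrier ?P1 \<Longrightarrow> diff W (-1) (r1 x) = r0 (d x)" by blast
  \<comment> \<open>Found by substituting x = q (r1 x) + s (d x) into \<phi> and using
    \<open>eq1\<close> at r1 x: the term with h in degree -1 goes into a, the term with h in degree
    0 together with \<phi> s into b. The minus sign is that of the shifted differential.\<close>
  define a where "a x = \<ominus>\<^bsub>?P1\<^esub> h (-1) (r1 x)" for x
  define b where "b y = h 0 (r0 y) \<oplus>\<^bsub>?P0\<^esub> \<phi> (s y)" for y
  have "mod_hom A ?P1 ?P1 a" unfolding a_def by (intro mod_hom_uminus mod_hom_comp[OF r1(1) h1] rX)
  moreover have "mod_hom A ?P0 ?P0 b"
    unfolding b_def by (intro mod_hom_add mod_hom_comp[OF r0 h0] mod_hom_comp[OF s \<phi>] rX)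
  moreover have "\<phi> x = d (a x) \<oplus>\<^bsub>?P0\<^esub> b (d x)" if x: "x \<in> carrier ?P1" for x
  proof -
    have c: "d x \<in> carrier ?P0" "s (d x) \<in> carrier ?P1" "r1 x \<in> carrier (obj W (-1))"
      "r0 (d x) \<in> carrier (obj W 0)"
      using x mod_homD(1)[OF d_hom] mod_homD(1)[OF s] mod_homD(1)[OF r1(1)] mod_homD(1)[OF r0] by
        blast+
    have c': "q (-1) (r1 x) \<in> carrier ?P1" "h (-1) (r1 x) \<in> carrier ?P1" "h 0 (r0 (d x)) \<in> carrier
      ?P0"
      "\<phi> (s (d x)) \<in> carrier ?P0" "d (h (-1) (r1 x)) \<in> carrier ?P0"
      using c mod_homD(1)[OF d_hom] mod_homD(1)[OF q1] mod_homD(1)[OF h1] mod_homD(1)[OF h0]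
        mod_homD(1)[OF \<phi>] by blast+
    have "d (q (-1) (r1 x)) = q 0 (diff W (-1) (r1 x))" using chain_mapD(2)[OF qc c(3)] by simp
    also have "\<dots> = d (x \<ominus>\<^bsub>?P1\<^esub> s (d x))" using r1(2)[OF x] qr[OF x] by simp
    finally have "q (-1) (r1 x) = x \<ominus>\<^bsub>?P1\<^esub> s (d x)"
      by (rule inj_onD[OF inj]) (use c c' x in simp_all)
    then have "x = q (-1) (r1 x) \<oplus>\<^bsub>?P1\<^esub> s (d x)" using c c' x by (simp add: X1.M.ag_simps)
    then have "\<phi> x = \<phi> (q (-1) (r1 x)) \<oplus>\<^bsub>?P0\<^esub> \<phi> (s (d x))" using c c' mod_homD(2)[OF \<phi>] by metis
    also have "\<dots> = (\<ominus>\<^bsub>?P0\<^esub> d (h (-1) (r1 x)) \<oplus>\<^bsub>?P0\<^esub> h 0 (r0 (d x))) \<oplus>\<^bsub>?P0\<^esub> \<phi> (s (d x))"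
      using eq1[OF c(3)] r1(2)[OF x] by simp
    also have "\<dots> = d (a x) \<oplus>\<^bsub>?P0\<^esub> b (d x)"
      using c c' by (simp add: a_def b_def mod_hom_neg[OF d_hom rX rX] X0.M.a_assoc)
    finally show ?thesis .
  qed
  ultimately show ?thesis by blast
qed

end

section \<open>Extensions and additive closure\<close>

text \<open>The lift g' of p to E restricts on P1 to a map \<phi> into T, which represents the class
  of the extension. If \<phi> = \<psi> d, then g' - i \<psi> vanishes on the image of d, descends to
  T, and splits g because g i = 0.\<close>

lemma Ext1_zeroI:
  assumes ex: "short_exact A P1 d P0 p T" and S1: "dual_basis A P1 S1" and S0: "dual_basis A P0 S0"
    and P1: "right_module A P1" and P0: "right_module A P0" and T: "right_module A T"
    and fac: "\<And>\<phi>. mod_hom A P1 T \<phi> \<Longrightarrow> \<exists>\<psi>. mod_hom A P0 T \<psi> \<and> (\<forall>x\<in>carrier P1. \<phi> x = \<psi> (d x))"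
  shows "Ext1_zero (A :: ('k::field, 'a) module) T T"
  unfolding Ext1_zero_def
proof (intro allI impI)
  fix E :: "('a, 'k univ) module" and i g
  assume *: "fd_module A E \<and> short_exact A T i E g T"
  then have E: "right_module A E" and i: "mod_hom A T E i" and g: "mod_hom A E T g"
    and gs: "g ` carrier E = carrier T" and ki: "i ` carrier T = ker E T g"
    by (auto simp: fd_moduleD short_exact_def mod_surj_def)
  have d: "mod_hom A P1 P0 d" and p: "mod_surj A P0 T p" and kp: "d ` carrier P1 = ker P0 T p"
    using ex by (auto simp: short_exact_def)
  have ph: "mod_hom A P0 T p" and pim: "p ` carrier P0 = carrier T" using p by (auto simp:
    mod_surj_def)
  interpret E: right_module A E by fact
  interpret T: right_module A T by fact
  have "\<exists>g'. mod_hom A P0 E g' \<and> (\<forall>x\<in>carrier P0. g (g' x) = p x)"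
    by (rule dual_basis_lift[OF S0 P0 E T g ph]) (use gs mod_homD(1)[OF ph] in blast)
  then obtain g' where g': "mod_hom A P0 E g'" "\<And>x. x \<in> carrier P0 \<Longrightarrow> g (g' x) = p x" by blast
  have "\<exists>\<phi>. mod_hom A P1 T \<phi> \<and> (\<forall>x\<in>carrier P1. i (\<phi> x) = g' (d x))"
  proof (rule dual_basis_lift[OF S1 P1 T E i mod_hom_comp[OF d g'(1)]])
    fix x assume x: "x \<in> carrier P1"
    then have dx: "d x \<in> carrier P0" by (rule mod_homD(1)[OF d])
    have "p (d x) = \<zero>\<^bsub>T\<^esub>" using kp x by (auto simp: ker_def)
    then show "g' (d x) \<in> i ` carrier T"
      unfolding ki using g'(2)[OF dx] mod_homD(1)[OF g'(1) dx] by (simp add: ker_def)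
  qed
  then obtain \<phi> where \<phi>: "mod_hom A P1 T \<phi>" "\<And>x. x \<in> carrier P1 \<Longrightarrow> i (\<phi> x) = g' (d x)" by blast
  from fac[OF \<phi>(1)] obtain \<psi> where \<psi>: "mod_hom A P0 T \<psi>" "\<And>x. x \<in> carrier P1 \<Longrightarrow> \<phi> x = \<psi> (d x)" by
    blast
  let ?u = "\<lambda>x. g' x \<ominus>\<^bsub>E\<^esub> i (\<psi> x)"
  have u: "mod_hom A P0 E ?u" by (intro mod_hom_diff g'(1) mod_hom_comp[OF \<psi>(1) i] E)
  have "\<exists>s. mod_hom A T E s \<and> (\<forall>x\<in>carrier P0. s (p x) = ?u x)"
  proof (rule mod_hom_factor[OF p u P0 T E])
    fix y assume "y \<in> carrier P0" "p y = \<zero>\<^bsub>T\<^esub>"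
    then obtain x where x: "x \<in> carrier P1" "y = d x" using kp by (auto simp: ker_def)
    then show "?u y = \<zero>\<^bsub>E\<^esub>"
      using \<phi>(2)[OF x(1)] \<psi>(2)[OF x(1)] mod_homD(1)[OF i mod_homD(1)[OF \<phi>(1) x(1)]] by (simp add:
        E.minus_self)
  qed
  then obtain s where s: "mod_hom A T E s" "\<And>x. x \<in> carrier P0 \<Longrightarrow> s (p x) = ?u x" by blast
  have "g (s t) = t" if t: "t \<in> carrier T" for t
  proof -
    obtain x where x: "x \<in> carrier P0" "t = p x" using t unfolding pim[symmetric] by blast
    have c: "g' x \<in> carrier E" "\<psi> x \<in> carrier T" "i (\<psi> x) \<in> carrier E" "p x \<in> carrier T"
      using x mod_homD(1)[OF g'(1)] mod_homD(1)[OF \<psi>(1)] mod_homD(1)[OF i] mod_homD(1)[OF ph] by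
        blast+
    have "i (\<psi> x) \<in> ker E T g" using c(2) unfolding ki[symmetric] by blast
    then have "g (i (\<psi> x)) = \<zero>\<^bsub>T\<^esub>" by (simp add: ker_def)
    then have "g (s (p x)) = p x \<ominus>\<^bsub>T\<^esub> \<zero>\<^bsub>T\<^esub>"
      using s(2)[OF x(1)] g'(2)[OF x(1)] mod_hom_minus[OF g E T c(1,3)] by simp
    also have "\<dots> = p x" using c(4) by (simp add: a_minus_def T.M.a_inv_zero)
    finally show ?thesis unfolding x(2) .
  qed
  with s(1) show "\<exists>s. mod_hom A T E s \<and> (\<forall>x\<in>carrier T. g (s x) = x)" by blast
qed

text \<open>The pairs present M as a retract of T^n: the maps i assemble to I, the maps p to P, and
  P I = 1. The complement is the kernel of P, which is the image of the idempotent 1 - I P; as an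
  image of T^n it is finite dimensional and so has a list model, as \<open>in_add\<close>
  demands.\<close>

lemma (in kalgebra) in_addI:
  assumes M: "fd_module A M" and T: "fd_module A T"
    and hom: "\<And>i p. (i, p) \<in> set ps \<Longrightarrow> mod_hom A M T i" "\<And>i p. (i, p) \<in> set ps \<Longrightarrow> mod_hom A T M p"
    and sum: "\<And>x. x \<in> carrier M \<Longrightarrow> msum M (map (\<lambda>(i, p). p (i x)) ps) = x"
  shows "in_add A T M"
proof -
  let ?n = "length ps"
  let ?U = "dsum {..<?n} (\<lambda>_. T)"
  have U: "fd_module A ?U" by (rule fd_dsum) (simp_all add: T)
  note rM = fd_moduleD[OF M] and rU = fd_moduleD[OF U]
  interpret U: right_module A ?U by (rule rU)
  interpret M: right_module A M by (rule rM)
  define I where "I x = (\<lambda>j\<in>{..<?n}. fst (ps ! j) x)" for x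
  define P where "P y = msum M (map (\<lambda>j. snd (ps ! j) (y j)) [0..<?n])" for y
  have hj: "mod_hom A M T (fst (ps ! j))" "mod_hom A T M (snd (ps ! j))" if "j < ?n" for j
    using hom[of "fst (ps ! j)" "snd (ps ! j)"] that by simp_all
  have I: "mod_hom A M ?U I" unfolding I_def by (rule mod_hom_dsum) (simp add: hj)
  have P: "mod_hom A ?U M P"
    unfolding P_def
    by (rule mod_hom_sum[OF rM], rule mod_hom_comp[OF mod_hom_proj]) (simp_all add: hj)
  have PI: "P (I x) = x" if x: "x \<in> carrier M" for x
  proof -
    have "map (\<lambda>j. snd (ps ! j) (I x j)) [0..<?n] = map (\<lambda>(i, p). p (i x)) (map ((!) ps) [0..<?n])"
      by (simp add: I_def case_prod_unfold)
    then show ?thesis unfolding P_def map_nth using sum[OF x] by simp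
  qed
  let ?N = "?U\<lparr>carrier := ker ?U M P\<rparr>"
  have rN: "right_module A ?N" by (rule right_module_sub[OF rU ker_submodule[OF P rU rM]])
  let ?e = "\<lambda>u. u \<ominus>\<^bsub>?U\<^esub> I (P u)"
  have e: "mod_hom A ?U ?U ?e" by (intro mod_hom_diff mod_hom_id mod_hom_comp[OF P I] rU)
  have ek: "?e u \<in> ker ?U M P" if u: "u \<in> carrier ?U" for u
  proof -
    have c: "P u \<in> carrier M" "I (P u) \<in> carrier ?U" using u mod_homD(1)[OF P] mod_homD(1)[OF I]
      by blast+
    then show ?thesis using u by (simp add: ker_def mod_hom_minus[OF P rU rM] PI M.minus_self)
  qed
  have e': "mod_hom A ?U ?N ?e"
    using e ek unfolding mod_hom_def Pi_iff by simp
  have eid: "?e u = u" if "u \<in> ker ?U M P" for u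
    using that mod_hom_zero[OF I rM rU] by (auto simp: ker_def U.M.ag_simps)
  have "mod_surj A ?U ?N ?e"
    unfolding mod_surj_def
  proof (intro conjI e' equalityI)
    show "?e ` carrier ?U \<subseteq> carrier ?N" using ek by auto
    show "carrier ?N \<subseteq> ?e ` carrier ?U"
    proof
      fix u assume "u \<in> carrier ?N"
      then have u: "u \<in> ker ?U M P" by simp
      then have "u \<in> carrier ?U" by (simp add: ker_def)
      then show "u \<in> ?e ` carrier ?U" using eid[OF u] by (metis (no_types, lifting) imageI)
    qed
  qed
  then have N: "fd_module A ?N" using fd_image[OF U _ rN] by blast
  obtain V :: "('a, 'k univ) module" and w where V: "fd_module A V" "iso_map ?N V w"
    using fd_univ_model[OF N] by blast
  note rV = fd_moduleD[OF V(1)]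
  obtain v where wv: "mod_hom A ?N V w" "mod_hom A V ?N v" "\<And>x. x \<in> carrier ?N \<Longrightarrow> v (w x) = x"
    "\<And>y. y \<in> carrier V \<Longrightarrow> w (v y) = y"
    by (rule iso_mapE[OF V(2) rN rV]) blast
  have vU: "mod_hom A V ?U v" using wv(2) by (auto simp: mod_hom_def ker_def Pi_iff)
  have vk: "v y \<in> carrier ?U" "P (v y) = \<zero>\<^bsub>M\<^esub>" if "y \<in> carrier V" for y
    using mod_homD(1)[OF wv(2) that] by (auto simp: ker_def)
  have "iso_map (dsum2 M V) ?U (\<lambda>z. I (fst z) \<oplus>\<^bsub>?U\<^esub> v (snd z))"
  proof (rule iso_mapI)
    show "mod_hom A (dsum2 M V) ?U (\<lambda>z. I (fst z) \<oplus>\<^bsub>?U\<^esub> v (snd z))"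
      by (intro mod_hom_add mod_hom_comp[OF mod_hom_fst I] mod_hom_comp[OF mod_hom_snd vU] rU)
    show "mod_hom A ?U (dsum2 M V) (\<lambda>u. (P u, w (?e u)))"
      by (intro mod_hom_dsum2 P mod_hom_comp[OF e' wv(1)])
  next
    fix z assume "z \<in> carrier (dsum2 M V)"
    then obtain x y where z: "z = (x, y)" "x \<in> carrier M" "y \<in> carrier V" by auto
    have c: "I x \<in> carrier ?U" "v y \<in> carrier ?U" using z mod_homD(1)[OF I] vk by blast+
    have Pz: "P (I x \<oplus>\<^bsub>?U\<^esub> v y) = x" using c z vk PI by (simp add: mod_homD(2)[OF P])
    have "?e (I x \<oplus>\<^bsub>?U\<^esub> v y) = v y" unfolding Pz using c by (simp add: U.M.ag_simps)
    then show "(P (I (fst z) \<oplus>\<^bsub>?U\<^esub> v (snd z)), w (?e (I (fst z) \<oplus>\<^bsub>?U\<^esub> v (snd z)))) = z"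
      using Pz z wv(4) by simp
  next
    fix u assume u: "u \<in> carrier ?U"
    have c: "P u \<in> carrier M" "I (P u) \<in> carrier ?U" using u mod_homD(1)[OF P] mod_homD(1)[OF I]
      by blast+
    have "v (w (?e u)) = ?e u" using wv(3) ek[OF u] by simp
    then show "I (fst (P u, w (?e u))) \<oplus>\<^bsub>?U\<^esub> v (snd (P u, w (?e u))) = u"
      using u c by (simp add: U.M.ag_simps)
  qed
  then have "mod_iso A (dsum2 M V) ?U" by (auto simp: mod_iso_def iso_map_def)
  then show ?thesis unfolding in_add_def using M V(1) by blast
qed

section \<open>The algebra $KQ/I$\<close>

lemma path_simps [simp]:
  "path_start (u, es, v) = u" "path_arrows (u, es, v) = es" "path_end (u, es, v) = v"
  by (simp_all add: path_start_def path_arrows_def path_end_def)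

lemma path_algebra_simps:
  "carrier (path_algebra Q) = {x. finite {p. x p \<noteq> 0} \<and> {p. x p \<noteq> 0} \<subseteq> paths Q}"
  "mult (path_algebra Q) = (\<lambda>x y r. \<Sum>(p, q) \<in> path_factorizations Q r. x p * y q)"
  "one (path_algebra Q) = (\<lambda>p. if p \<in> vertex_path ` verts Q then 1 else 0)"
  "zero (path_algebra Q) = (\<lambda>p. 0)"
  "add (path_algebra Q) = (\<lambda>x y p. x p + y p)"
  "smult (path_algebra Q) = (\<lambda>c x p. c * x p)"
  by (simp_all add: path_algebra_def)

locale bound_quiver = fin_digraph Q
  for Q :: "('v, 'e) pre_digraph" +
  fixes I :: "(('v, 'e) qpath \<Rightarrow> 'k::field) set"
  assumes adm: "admissible Q I"
begin

abbreviation PA :: "('k, ('v, 'e) qpath \<Rightarrow> 'k) module" where "PA \<equiv> path_algebra Q"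
abbreviation A :: "('k, ('k, 'v, 'e) bqelt) module" where "A \<equiv> bound_quiver_algebra Q I"
abbreviation cls :: "(('v, 'e) qpath \<Rightarrow> 'k) \<Rightarrow> ('k, 'v, 'e) bqelt" where "cls x \<equiv> I +>\<^bsub>PA\<^esub> x"

sublocale I: ideal I PA using adm by (simp add: admissible_def)

lemma paths_iff: "(u, es, v) \<in> paths Q \<longleftrightarrow> awalk u es v"
  by (simp add: paths_def)

text \<open>A factorization is fixed by the length of its first factor.\<close>

lemma finite_path_factorizations: "finite (path_factorizations Q r)"
proof (cases r)
  case (fields u es v)
  have "path_factorizations Q r \<subseteq>
    (\<lambda>n. ((u, take n es, awlast u (take n es)), (awlast u (take n es), drop n es, v))) ` {..length
      es}"
  proof
    fix pq assume pq: "pq \<in> path_factorizations Q r"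
    then obtain u' es1 w w' es2 v' where *: "pq = ((u', es1, w), (w', es2, v'))" by (cases pq) auto
    with pq have "awalk u es1 w" "w' = w" "u' = u" "v' = v" "es1 @ es2 = es"
      by (auto simp: path_factorizations_def paths_iff path_comp_def fields)
    moreover have "awlast u es1 = w" using \<open>awalk u es1 w\<close> by blast
    ultimately have "pq = ((u, take (length es1) es, awlast u (take (length es1) es)),
        (awlast u (take (length es1) es), drop (length es1) es, v))" "length es1 \<le> length es"
      using * by auto
    then show "pq \<in> (\<lambda>n. ((u, take n es, awlast u (take n es)), (awlast u (take n es), drop n es,
      v))) ` {..length es}"
      by blast
  qed
  then show ?thesis by (rule finite_subset) simp
qed

lemma vertex_path_in_paths: "i \<in> verts Q \<Longrightarrow> vertex_path i \<in> paths Q"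
  by (simp add: vertex_path_def paths_iff awalk_Nil_iff)

lemma arrow_path_in_paths: "\<alpha> \<in> arcs Q \<Longrightarrow> arrow_path Q \<alpha> \<in> paths Q"
  by (simp add: arrow_path_def paths_iff arc_implies_awalk)

lemma path_factorizations_vertex:
  assumes "i \<in> verts Q"
  shows "path_factorizations Q (vertex_path i) = {(vertex_path i, vertex_path i)}"
  using assms by (auto simp: path_factorizations_def vertex_path_def path_comp_def paths_iff
    awalk_Nil_iff
      path_start_def path_end_def path_arrows_def)

lemma path_factorizations_arrow:
  assumes "\<alpha> \<in> arcs Q"
  shows "path_factorizations Q (arrow_path Q \<alpha>) =
    {(vertex_path (tail Q \<alpha>), arrow_path Q \<alpha>), (arrow_path Q \<alpha>, vertex_path (head Q \<alpha>))}"
proof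
  show "path_factorizations Q (arrow_path Q \<alpha>) \<subseteq>
    {(vertex_path (tail Q \<alpha>), arrow_path Q \<alpha>), (arrow_path Q \<alpha>, vertex_path (head Q \<alpha>))}"
  proof
    fix pq assume pq: "pq \<in> path_factorizations Q (arrow_path Q \<alpha>)"
    then obtain u' es1 w w' es2 v' where *: "pq = ((u', es1, w), (w', es2, v'))" by (cases pq) auto
    with pq have w: "awalk u' es1 w" "awalk w es2 v'" "w' = w" "u' = tail Q \<alpha>" "v' = head Q \<alpha>"
      "es1 @ es2 = [\<alpha>]"
      by (auto simp: path_factorizations_def paths_iff path_comp_def arrow_path_def)
    then consider "es1 = []" "es2 = [\<alpha>]" | "es1 = [\<alpha>]" "es2 = []" by (cases es1) auto
    then show "pq \<in> {(vertex_path (tail Q \<alpha>), arrow_path Q \<alpha>), (arrow_path Q \<alpha>, vertex_path (head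
      Q \<alpha>))}"
      by cases (use w * in \<open>auto simp: awalk_Nil_iff vertex_path_def arrow_path_def\<close>)
  qed
qed (use assms vertex_path_in_paths arrow_path_in_paths in
    \<open>auto simp: path_factorizations_def path_comp_def vertex_path_def arrow_path_def\<close>)

lemma mult_vertex: "i \<in> verts Q \<Longrightarrow> (x \<otimes>\<^bsub>PA\<^esub> y) (vertex_path i) = x (vertex_path i) * y (vertex_path
  i)"
  by (simp add: path_algebra_simps path_factorizations_vertex)

text \<open>An arrow factors only as itself with a trivial path on one side, which gives a twisted
  Leibniz rule. Products with arrows thus reveal coefficients at vertices; both the minimality of
  the presentation and the position of ker d inside the radical are read off in this way.\<close>

lemma mult_arrow: "\<alpha> \<in> arcs Q \<Longrightarrow> (x \<otimes>\<^bsub>PA\<^esub> y) (arrow_path Q \<alpha>) =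
    x (vertex_path (tail Q \<alpha>)) * y (arrow_path Q \<alpha>) + x (arrow_path Q \<alpha>) * y (vertex_path (head Q
      \<alpha>))"
proof -
  assume a: "\<alpha> \<in> arcs Q"
  have "(vertex_path (tail Q \<alpha>), arrow_path Q \<alpha>) \<noteq> (arrow_path Q \<alpha>, vertex_path (head Q \<alpha>))"
    by (simp add: vertex_path_def arrow_path_def)
  then show ?thesis by (simp add: path_algebra_simps path_factorizations_arrow[OF a])
qed

lemma mult_nonzero:
  assumes "(x \<otimes>\<^bsub>PA\<^esub> y) r \<noteq> 0"
  obtains p q where "(p, q) \<in> path_factorizations Q r" "x p \<noteq> 0" "y q \<noteq> 0"
proof -
  have "\<exists>a\<in>path_factorizations Q r. (case a of (p, q) \<Rightarrow> x p * y q) \<noteq> 0"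
    using assms by (auto simp: path_algebra_simps elim: sum.not_neutral_contains_not_neutral)
  then show thesis using that by auto
qed

lemma smult_mult_left: "(c \<odot>\<^bsub>PA\<^esub> x) \<otimes>\<^bsub>PA\<^esub> y = c \<odot>\<^bsub>PA\<^esub> (x \<otimes>\<^bsub>PA\<^esub> y)"
  by (simp add: path_algebra_simps sum_distrib_left case_prod_unfold mult.assoc)

lemma smult_mult_right: "x \<otimes>\<^bsub>PA\<^esub> (c \<odot>\<^bsub>PA\<^esub> y) = c \<odot>\<^bsub>PA\<^esub> (x \<otimes>\<^bsub>PA\<^esub> y)"
  by (simp add: path_algebra_simps sum_distrib_left case_prod_unfold mult.left_commute)

lemma smult_closed: "x \<in> carrier PA \<Longrightarrow> c \<odot>\<^bsub>PA\<^esub> x \<in> carrier PA"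
  by (auto simp: path_algebra_simps intro: finite_subset[rotated])

lemma path_elt_closed [simp]: "p \<in> paths Q \<Longrightarrow> path_elt p \<in> carrier PA"
  by (auto simp: path_algebra_simps path_elt_def intro: finite_subset[of _ "{p}"])

lemma path_elt_mult:
  assumes "p \<in> paths Q" "q \<in> paths Q"
  shows "path_elt p \<otimes>\<^bsub>PA\<^esub> path_elt q =
    (if path_end p = path_start q then path_elt (path_comp p q) else \<zero>\<^bsub>PA\<^esub>)"
proof
  fix r
  have "(path_elt p \<otimes>\<^bsub>PA\<^esub> path_elt q) r = (\<Sum>a\<in>path_factorizations Q r. if a = (p, q) then 1 else
    (0::'k))"
    unfolding path_algebra_simps by (rule sum.cong) (auto simp: path_elt_def split: if_splits)
  also have "\<dots> = (if (p, q) \<in> path_factorizations Q r then 1 else 0)"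
    by (simp add: finite_path_factorizations)
  also have "\<dots> = (if path_end p = path_start q then path_elt (path_comp p q) else \<zero>\<^bsub>PA\<^esub>) r"
    using assms by (auto simp: path_factorizations_def path_elt_def path_algebra_simps)
  finally show "(path_elt p \<otimes>\<^bsub>PA\<^esub> path_elt q :: _ \<Rightarrow> 'k) r = \<dots>" .
qed

lemma arrow_ideal_powerD: "x \<in> arrow_ideal_power Q n \<Longrightarrow> x p \<noteq> 0 \<Longrightarrow> n \<le> length (path_arrows p)"
  unfolding arrow_ideal_power_def by blast

lemma arrow_ideal_powerI:
  "x \<in> carrier PA \<Longrightarrow> (\<And>p. x p \<noteq> 0 \<Longrightarrow> n \<le> length (path_arrows p)) \<Longrightarrow> x \<in> arrow_ideal_power Q n"
  unfolding arrow_ideal_power_def by blast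

lemma I_coeff:
  assumes "x \<in> I" "length (path_arrows p) < 2" shows "x p = 0"
proof -
  have "x \<in> arrow_ideal_power Q 2" using adm assms(1) unfolding admissible_def by blast
  from arrow_ideal_powerD[OF this, of p] assms(2) show ?thesis by linarith
qed

subsection \<open>The quotient\<close>

lemma alg_simps:
  "carrier A = cls ` carrier PA" "mult A = rcoset_mult PA I" "one A = cls \<one>\<^bsub>PA\<^esub>" "zero A = I"
  "add A = set_add PA"
  "smult A = (\<lambda>c X. \<Union>x\<in>X. cls (c \<odot>\<^bsub>PA\<^esub> x))"
  by (auto simp: bound_quiver_algebra_def FactRing_def ring.defs module.defs A_RCOSETS_def')

lemma alg_eq_quot: "carrier A = carrier (PA Quot I)" "mult A = mult (PA Quot I)"
  "one A = one (PA Quot I)" "zero A = zero (PA Quot I)" "add A = add (PA Quot I)"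
  by (simp_all add: bound_quiver_algebra_def ring.defs module.defs)

text \<open>A is the quotient ring extended by a scalar multiplication; the ring operations agree
  fieldwise, so the axioms carry over although the record types differ.\<close>

sublocale A: ring A
proof -
  interpret B: ring "PA Quot I" by (rule I.quotient_is_ring)
  show "ring A"
  proof (rule ringI)
    show "abelian_group A"
      by (rule abelian_groupI; unfold alg_eq_quot)
        (erule (2) B.a_assoc | erule (1) B.a_comm | blast intro: B.l_neg | simp)+
    show "Group.monoid A"
      by (rule monoidI; unfold alg_eq_quot) (simp_all add: B.m_assoc)
  qed (unfold alg_eq_quot, simp_all only: B.l_distr B.r_distr)
qed

lemma cls_closed [simp]: "x \<in> carrier PA \<Longrightarrow> cls x \<in> carrier A"
  by (simp add: alg_simps)

lemma cls_add: "x \<in> carrier PA \<Longrightarrow> y \<in> carrier PA \<Longrightarrow> cls x \<oplus>\<^bsub>A\<^esub> cls y = cls (x \<oplus>\<^bsub>PA\<^esub> y)"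
  by (simp add: alg_simps I.a_rcos_sum)

lemma cls_mult: "x \<in> carrier PA \<Longrightarrow> y \<in> carrier PA \<Longrightarrow> cls x \<otimes>\<^bsub>A\<^esub> cls y = cls (x \<otimes>\<^bsub>PA\<^esub> y)"
  by (simp add: alg_simps I.rcoset_mult_add)

lemma cls_zero: "cls \<zero>\<^bsub>PA\<^esub> = \<zero>\<^bsub>A\<^esub>"
  by (simp add: alg_simps I.a_rcos_const)

lemma cls_self: "x \<in> carrier PA \<Longrightarrow> x \<in> cls x"
  by (rule I.a_rcos_self)

lemma cls_mem: "y \<in> cls x \<longleftrightarrow> (\<exists>i\<in>I. y = i \<oplus>\<^bsub>PA\<^esub> x)"
  by (auto simp: a_r_coset_def')

lemma cls_I_add: "x \<in> carrier PA \<Longrightarrow> i \<in> I \<Longrightarrow> cls (i \<oplus>\<^bsub>PA\<^esub> x) = cls x"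
proof -
  assume x: "x \<in> carrier PA" and i: "i \<in> I"
  have "cls (i \<oplus>\<^bsub>PA\<^esub> x) = cls i \<oplus>\<^bsub>A\<^esub> cls x" using x i by (simp add: cls_add I.a_Hcarr)
  also have "cls i = \<zero>\<^bsub>A\<^esub>" using i by (simp add: alg_simps I.a_rcos_const)
  finally show ?thesis using x by simp
qed

lemma carrierE:
  assumes "X \<in> carrier A" obtains x where "x \<in> carrier PA" "X = cls x"
  using assms by (auto simp: alg_simps)

text \<open>The union over representatives in the record field collapses to one coset because I
  absorbs scalars: c i = (c 1) i.\<close>

lemma cls_smult: "x \<in> carrier PA \<Longrightarrow> c \<odot>\<^bsub>A\<^esub> cls x = cls (c \<odot>\<^bsub>PA\<^esub> x)"
proof -
  assume x: "x \<in> carrier PA"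
  have "cls (c \<odot>\<^bsub>PA\<^esub> y) = cls (c \<odot>\<^bsub>PA\<^esub> x)" if y: "y \<in> cls x" for y
  proof -
    obtain i where i: "i \<in> I" "y = i \<oplus>\<^bsub>PA\<^esub> x" using y unfolding cls_mem by blast
    have "c \<odot>\<^bsub>PA\<^esub> i = (c \<odot>\<^bsub>PA\<^esub> \<one>\<^bsub>PA\<^esub>) \<otimes>\<^bsub>PA\<^esub> i" using i by (simp add: smult_mult_left I.a_Hcarr)
    also have "\<dots> \<in> I" using i by (intro I.I_l_closed smult_closed) auto
    finally have ci: "c \<odot>\<^bsub>PA\<^esub> i \<in> I" .
    have "c \<odot>\<^bsub>PA\<^esub> y = (c \<odot>\<^bsub>PA\<^esub> i) \<oplus>\<^bsub>PA\<^esub> (c \<odot>\<^bsub>PA\<^esub> x)"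
      by (simp add: i path_algebra_simps distrib_left)
    then show ?thesis using cls_I_add[OF smult_closed[OF x] ci] by simp
  qed
  then have "(\<Union>y\<in>cls x. cls (c \<odot>\<^bsub>PA\<^esub> y)) = (\<Union>y\<in>cls x. cls (c \<odot>\<^bsub>PA\<^esub> x))" by (rule SUP_cong[OF refl])
  also have "\<dots> = cls (c \<odot>\<^bsub>PA\<^esub> x)" using cls_self[OF x] by blast
  finally show ?thesis unfolding alg_simps(6) .
qed

sublocale A: kalgebra A
proof
  have one: "\<one>\<^bsub>PA\<^esub> \<in> carrier PA" by simp
  have c1: "c \<odot>\<^bsub>A\<^esub> \<one>\<^bsub>A\<^esub> = cls (c \<odot>\<^bsub>PA\<^esub> \<one>\<^bsub>PA\<^esub>)" for c
    using cls_smult[OF one] by (simp add: alg_simps(3))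
  note sc = smult_closed[OF one]
  fix c d
  show "c \<odot>\<^bsub>A\<^esub> \<one>\<^bsub>A\<^esub> \<in> carrier A" using sc by (simp add: c1)
  show "(c + d) \<odot>\<^bsub>A\<^esub> \<one>\<^bsub>A\<^esub> = (c \<odot>\<^bsub>A\<^esub> \<one>\<^bsub>A\<^esub>) \<oplus>\<^bsub>A\<^esub> (d \<odot>\<^bsub>A\<^esub> \<one>\<^bsub>A\<^esub>)"
    unfolding c1 by (subst cls_add[OF sc sc]) (simp add: path_algebra_simps distrib_right)
  show "(c * d) \<odot>\<^bsub>A\<^esub> \<one>\<^bsub>A\<^esub> = (c \<odot>\<^bsub>A\<^esub> \<one>\<^bsub>A\<^esub>) \<otimes>\<^bsub>A\<^esub> (d \<odot>\<^bsub>A\<^esub> \<one>\<^bsub>A\<^esub>)"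
  proof -
    have "(c \<odot>\<^bsub>PA\<^esub> \<one>\<^bsub>PA\<^esub>) \<otimes>\<^bsub>PA\<^esub> (d \<odot>\<^bsub>PA\<^esub> \<one>\<^bsub>PA\<^esub>) = c \<odot>\<^bsub>PA\<^esub> (d \<odot>\<^bsub>PA\<^esub> \<one>\<^bsub>PA\<^esub>)"
      using sc[of d] by (simp only: smult_mult_left I.l_one)
    also have "\<dots> = (c * d) \<odot>\<^bsub>PA\<^esub> \<one>\<^bsub>PA\<^esub>" by (simp add: path_algebra_simps mult.assoc)
    finally show ?thesis unfolding c1 by (simp add: cls_mult[OF sc sc])
  qed
  have "1 \<odot>\<^bsub>PA\<^esub> x = x" for x by (simp add: path_algebra_simps)
  then show "1 \<odot>\<^bsub>A\<^esub> \<one>\<^bsub>A\<^esub> = \<one>\<^bsub>A\<^esub>" unfolding c1 by (simp add: alg_simps(3))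
  fix X assume "X \<in> carrier A"
  then obtain x where x: "x \<in> carrier PA" "X = cls x" by (rule carrierE)
  show "(c \<odot>\<^bsub>A\<^esub> \<one>\<^bsub>A\<^esub>) \<otimes>\<^bsub>A\<^esub> X = X \<otimes>\<^bsub>A\<^esub> (c \<odot>\<^bsub>A\<^esub> \<one>\<^bsub>A\<^esub>)"
    unfolding c1 x(2) using x(1)
    by (simp add: cls_mult[OF sc x(1)] cls_mult[OF x(1) sc] smult_mult_left smult_mult_right)
qed

text \<open>\<open>coeff p\<close> is well defined for paths of length at most one, where it extends \<open>vertex_coeff\<close>.\<close>

definition coeff :: "('v, 'e) qpath \<Rightarrow> ('k, 'v, 'e) bqelt \<Rightarrow> 'k" where
  "coeff p a = (THE c. \<exists>x\<in>a. x p = c)"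

lemma coeff_cls:
  assumes "x \<in> carrier PA" "length (path_arrows p) < 2" shows "coeff p (cls x) = x p"
  unfolding coeff_def
proof (rule the_equality)
  show "\<exists>y\<in>cls x. y p = x p" using cls_self[OF assms(1)] by blast
  fix c assume "\<exists>y\<in>cls x. y p = c"
  then show "c = x p" using I_coeff[OF _ assms(2)] by (auto simp: cls_mem path_algebra_simps)
qed

lemma vertex_coeff_eq: "vertex_coeff i = coeff (vertex_path i)"
  by (simp add: vertex_coeff_def coeff_def fun_eq_iff)

abbreviation vc :: "'v \<Rightarrow> ('k, 'v, 'e) bqelt \<Rightarrow> 'k" where "vc \<equiv> vertex_coeff"
abbreviation ac :: "'e \<Rightarrow> ('k, 'v, 'e) bqelt \<Rightarrow> 'k" where "ac \<alpha> \<equiv> coeff (arrow_path Q \<alpha>)"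

lemma short_paths: "length (path_arrows (vertex_path i)) < 2" "length (path_arrows (arrow_path Q
  \<alpha>)) < 2"
  by (simp_all add: vertex_path_def arrow_path_def)

lemma vc_cls: "x \<in> carrier PA \<Longrightarrow> vc i (cls x) = x (vertex_path i)"
  by (simp add: vertex_coeff_eq coeff_cls short_paths)

lemma ac_cls: "x \<in> carrier PA \<Longrightarrow> ac \<alpha> (cls x) = x (arrow_path Q \<alpha>)"
  by (simp add: coeff_cls short_paths)

lemma vc_add: "X \<in> carrier A \<Longrightarrow> Y \<in> carrier A \<Longrightarrow> vc i (X \<oplus>\<^bsub>A\<^esub> Y) = vc i X + vc i Y"
  by (auto elim!: carrierE simp: cls_add vc_cls) (simp add: path_algebra_simps)

lemma ac_add: "X \<in> carrier A \<Longrightarrow> Y \<in> carrier A \<Longrightarrow> ac \<alpha> (X \<oplus>\<^bsub>A\<^esub> Y) = ac \<alpha> X + ac \<alpha> Y"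
  by (auto elim!: carrierE simp: cls_add ac_cls) (simp add: path_algebra_simps)

lemma vc_mult: "i \<in> verts Q \<Longrightarrow> X \<in> carrier A \<Longrightarrow> Y \<in> carrier A \<Longrightarrow> vc i (X \<otimes>\<^bsub>A\<^esub> Y) = vc i X * vc i Y"
  by (auto elim!: carrierE simp: cls_mult vc_cls mult_vertex)

lemma ac_mult: "\<alpha> \<in> arcs Q \<Longrightarrow> X \<in> carrier A \<Longrightarrow> Y \<in> carrier A \<Longrightarrow>
    ac \<alpha> (X \<otimes>\<^bsub>A\<^esub> Y) = vc (tail Q \<alpha>) X * ac \<alpha> Y + ac \<alpha> X * vc (head Q \<alpha>) Y"
  by (auto elim!: carrierE simp: cls_mult vc_cls ac_cls mult_arrow)

lemma vc_zero: "vc i \<zero>\<^bsub>A\<^esub> = 0" and ac_zero: "ac \<alpha> \<zero>\<^bsub>A\<^esub> = 0"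
  using vc_cls[of "\<zero>\<^bsub>PA\<^esub>" i] ac_cls[of "\<zero>\<^bsub>PA\<^esub>" \<alpha>]
  by (simp_all add: cls_zero) (simp_all add: path_algebra_simps)

lemma vc_scalar: "i \<in> verts Q \<Longrightarrow> vc i (c \<odot>\<^bsub>A\<^esub> \<one>\<^bsub>A\<^esub>) = c"
proof -
  assume "i \<in> verts Q"
  moreover have "c \<odot>\<^bsub>A\<^esub> \<one>\<^bsub>A\<^esub> = cls (c \<odot>\<^bsub>PA\<^esub> \<one>\<^bsub>PA\<^esub>)" using cls_smult[of "\<one>\<^bsub>PA\<^esub>"] by (simp add:
    alg_simps(3))
  moreover have "vc i (cls (c \<odot>\<^bsub>PA\<^esub> \<one>\<^bsub>PA\<^esub>)) = (c \<odot>\<^bsub>PA\<^esub> \<one>\<^bsub>PA\<^esub>) (vertex_path i)"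
    by (rule vc_cls[OF smult_closed]) simp
  ultimately show ?thesis by (simp add: path_algebra_simps(3,6))
qed

subsection \<open>Path classes\<close>

definition pc :: "('v, 'e) qpath \<Rightarrow> ('k, 'v, 'e) bqelt" where "pc = path_class Q I"
definition ve :: "'v \<Rightarrow> ('k, 'v, 'e) bqelt" where "ve i = pc (vertex_path i)"
definition ar :: "'e \<Rightarrow> ('k, 'v, 'e) bqelt" where "ar \<alpha> = pc (arrow_path Q \<alpha>)"

lemma pc_cls: "pc p = cls (path_elt p)"
  by (simp add: pc_def path_class_def)

lemma pc_closed [simp]: "p \<in> paths Q \<Longrightarrow> pc p \<in> carrier A"
  by (simp add: pc_cls)

lemma ve_closed [simp]: "i \<in> verts Q \<Longrightarrow> ve i \<in> carrier A"
  by (simp add: ve_def vertex_path_in_paths)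

lemma ar_closed [simp]: "\<alpha> \<in> arcs Q \<Longrightarrow> ar \<alpha> \<in> carrier A"
  by (simp add: ar_def arrow_path_in_paths)

lemma pc_mult: "p \<in> paths Q \<Longrightarrow> q \<in> paths Q \<Longrightarrow>
    pc p \<otimes>\<^bsub>A\<^esub> pc q = (if path_end p = path_start q then pc (path_comp p q) else \<zero>\<^bsub>A\<^esub>)"
  by (simp add: pc_cls cls_mult path_elt_mult cls_zero)

lemma ve_mult: "i \<in> verts Q \<Longrightarrow> j \<in> verts Q \<Longrightarrow> ve i \<otimes>\<^bsub>A\<^esub> ve j = (if i = j then ve i else \<zero>\<^bsub>A\<^esub>)"
  unfolding ve_def by (subst pc_mult) (auto simp: vertex_path_in_paths, auto simp: vertex_path_def
    path_comp_def)

lemma ve_ar: "i \<in> verts Q \<Longrightarrow> \<alpha> \<in> arcs Q \<Longrightarrow> ve i \<otimes>\<^bsub>A\<^esub> ar \<alpha> = (if i = tail Q \<alpha> then ar \<alpha> else \<zero>\<^bsub>A\<^esub>)"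
  unfolding ve_def ar_def
  by (subst pc_mult) (auto simp: vertex_path_in_paths arrow_path_in_paths, auto simp:
    vertex_path_def arrow_path_def path_comp_def)

lemma ar_ve: "i \<in> verts Q \<Longrightarrow> \<alpha> \<in> arcs Q \<Longrightarrow> ar \<alpha> \<otimes>\<^bsub>A\<^esub> ve i = (if i = head Q \<alpha> then ar \<alpha> else \<zero>\<^bsub>A\<^esub>)"
  unfolding ve_def ar_def
  by (subst pc_mult) (auto simp: vertex_path_in_paths arrow_path_in_paths, auto simp:
    vertex_path_def arrow_path_def path_comp_def)

lemma vc_pc: "p \<in> paths Q \<Longrightarrow> vc i (pc p) = (if p = vertex_path i then 1 else 0)"
  by (simp add: pc_cls vc_cls) (simp add: path_elt_def)

lemma vc_ve: "i \<in> verts Q \<Longrightarrow> vc j (ve i) = (if i = j then 1 else 0)"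
  by (auto simp: ve_def vc_pc vertex_path_in_paths) (auto simp: vertex_path_def)

lemma vc_ar: "\<alpha> \<in> arcs Q \<Longrightarrow> vc i (ar \<alpha>) = 0"
  by (auto simp: ar_def vc_pc arrow_path_in_paths) (auto simp: vertex_path_def arrow_path_def)

lemma ac_ar: "\<beta> \<in> arcs Q \<Longrightarrow> ac \<alpha> (ar \<beta>) = (if \<alpha> = \<beta> then 1 else 0)"
  by (auto simp: ar_def pc_cls ac_cls arrow_path_in_paths) (auto simp: path_elt_def arrow_path_def)

definition filt :: "nat \<Rightarrow> ('k, 'v, 'e) bqelt set" where
  "filt n = cls ` arrow_ideal_power Q n"

lemma arrow_ideal_power_PA: "x \<in> arrow_ideal_power Q n \<Longrightarrow> x \<in> carrier PA"
  by (simp add: arrow_ideal_power_def)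

lemma filt_0: "filt 0 = carrier A"
  by (auto simp: filt_def alg_simps arrow_ideal_power_def)

lemma filt_subset: "filt n \<subseteq> carrier A"
  by (auto simp: filt_def intro!: cls_closed arrow_ideal_power_PA)

lemma filt_zero: "\<zero>\<^bsub>A\<^esub> \<in> filt n"
proof -
  have "\<zero>\<^bsub>PA\<^esub> \<in> arrow_ideal_power Q n" using I.zero_closed by (simp add: arrow_ideal_power_def)
    (simp add: path_algebra_simps)
  then show ?thesis using cls_zero by (auto simp: filt_def intro: image_eqI[of _ _ "\<zero>\<^bsub>PA\<^esub>"])
qed

lemma filt_add:
  assumes "X \<in> filt n" "Y \<in> filt n" shows "X \<oplus>\<^bsub>A\<^esub> Y \<in> filt n"
proof -
  obtain x y where x: "x \<in> arrow_ideal_power Q n" "X = cls x" and y: "y \<in> arrow_ideal_power Q n"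
    "Y = cls y"
    using assms by (auto simp: filt_def)
  have "x \<oplus>\<^bsub>PA\<^esub> y \<in> carrier PA" using x y by (auto intro: arrow_ideal_power_PA)
  moreover have "n \<le> length (path_arrows p)" if "(x \<oplus>\<^bsub>PA\<^esub> y) p \<noteq> 0" for p
  proof -
    have "x p \<noteq> 0 \<or> y p \<noteq> 0" using that by (auto simp: path_algebra_simps)
    then show ?thesis using x y arrow_ideal_powerD by blast
  qed
  ultimately have "x \<oplus>\<^bsub>PA\<^esub> y \<in> arrow_ideal_power Q n" by (rule arrow_ideal_powerI)
  moreover have "X \<oplus>\<^bsub>A\<^esub> Y = cls (x \<oplus>\<^bsub>PA\<^esub> y)" using x y by (simp add: cls_add arrow_ideal_power_PA)
  ultimately show ?thesis by (auto simp: filt_def)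
qed

lemma filt_mult:
  assumes "X \<in> filt n" "Y \<in> filt m" shows "X \<otimes>\<^bsub>A\<^esub> Y \<in> filt (n + m)"
proof -
  obtain x y where x: "x \<in> arrow_ideal_power Q n" "X = cls x" and y: "y \<in> arrow_ideal_power Q m"
    "Y = cls y"
    using assms by (auto simp: filt_def)
  have "x \<otimes>\<^bsub>PA\<^esub> y \<in> carrier PA" using x y by (auto intro: arrow_ideal_power_PA)
  moreover have "n + m \<le> length (path_arrows r)" if nz: "(x \<otimes>\<^bsub>PA\<^esub> y) r \<noteq> 0" for r
  proof -
    obtain p q where pq: "(p, q) \<in> path_factorizations Q r" "x p \<noteq> 0" "y q \<noteq> 0"
      using nz by (rule mult_nonzero)
    then have "n \<le> length (path_arrows p)" "m \<le> length (path_arrows q)"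
      using x y arrow_ideal_powerD by blast+
    moreover have "length (path_arrows r) = length (path_arrows p) + length (path_arrows q)"
      using pq(1) by (auto simp: path_factorizations_def path_comp_def)
    ultimately show ?thesis by simp
  qed
  ultimately have "x \<otimes>\<^bsub>PA\<^esub> y \<in> arrow_ideal_power Q (n + m)" by (rule arrow_ideal_powerI)
  moreover have "X \<otimes>\<^bsub>A\<^esub> Y = cls (x \<otimes>\<^bsub>PA\<^esub> y)" using x y by (simp add: cls_mult arrow_ideal_power_PA)
  ultimately show ?thesis by (auto simp: filt_def)
qed

lemma filt_nilpotent: "\<exists>m. filt m = {\<zero>\<^bsub>A\<^esub>}"
proof -
  obtain m where m: "arrow_ideal_power Q m \<subseteq> I" using adm by (auto simp: admissible_def)
  have "X = \<zero>\<^bsub>A\<^esub>" if "X \<in> filt m" for X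
    using that m by (auto simp: filt_def alg_simps I.a_rcos_const subset_eq)
  then show ?thesis using filt_zero by blast
qed

text \<open>A path of length zero is the trivial path at a vertex, so vanishing of all vertex
  coefficients leaves only paths of positive length. In other words, these coefficients are the
  coordinates of A modulo its radical, a product of copies of K.\<close>

lemma filt_1_iff: "X \<in> filt 1 \<longleftrightarrow> X \<in> carrier A \<and> (\<forall>i\<in>verts Q. vc i X = 0)"
proof
  assume "X \<in> filt 1"
  then obtain x where x: "x \<in> arrow_ideal_power Q 1" "X = cls x" by (auto simp: filt_def)
  have "x (vertex_path i) = 0" for i
    using x(1) unfolding arrow_ideal_power_def by (fastforce simp: vertex_path_def)
  then show "X \<in> carrier A \<and> (\<forall>i\<in>verts Q. vc i X = 0)" using x by (simp add: arrow_ideal_power_PA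
    vc_cls)
next
  assume X: "X \<in> carrier A \<and> (\<forall>i\<in>verts Q. vc i X = 0)"
  then obtain x where x: "x \<in> carrier PA" "X = cls x" using carrierE by blast
  have "1 \<le> length (path_arrows p)" if p: "x p \<noteq> 0" for p
  proof (rule ccontr)
    assume "\<not> 1 \<le> length (path_arrows p)"
    moreover obtain u es v where uv: "p = (u, es, v)" by (cases p)
    ultimately have "es = []" by (cases es) simp_all
    moreover have "p \<in> paths Q" using p x by (auto simp: path_algebra_simps)
    ultimately have "p = vertex_path u" "u \<in> verts Q" using uv by (auto simp: paths_iff
      awalk_Nil_iff vertex_path_def)
    then show False using X x p by (auto simp: vc_cls)
  qed
  with x(1) have "x \<in> arrow_ideal_power Q 1" by (rule arrow_ideal_powerI)
  then show "X \<in> filt 1" using x by (auto simp: filt_def)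
qed

text \<open>An induction principle for linear statements: a power of the radical is spanned by the
  classes of paths that are long enough. The proof removes one path at a time from the finite
  support of a representative.\<close>

lemma filt_span:
  assumes X: "X \<in> filt n" and S: "A.subspace (regular A) S"
    and p: "\<And>p. p \<in> paths Q \<Longrightarrow> n \<le> length (path_arrows p) \<Longrightarrow> pc p \<in> S"
  shows "X \<in> S"
proof -
  obtain x where x: "x \<in> arrow_ideal_power Q n" "X = cls x" using X by (auto simp: filt_def)
  have "cls y \<in> S" if "finite F" "y \<in> arrow_ideal_power Q n" "{p. y p \<noteq> 0} \<subseteq> F" for F y
    using that
  proof (induction F arbitrary: y)
    case empty
    then have "y = \<zero>\<^bsub>PA\<^esub>" by (auto simp: path_algebra_simps)
    then show ?case using S by (simp add: cls_zero A.subspace_def)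
  next
    case (insert q F)
    have yc: "y \<in> carrier PA" by (rule arrow_ideal_power_PA[OF insert.prems(1)])
    show ?case
    proof (cases "y q = 0")
      case True
      then show ?thesis using insert.IH[OF insert.prems(1)] insert.prems(2) by auto
    next
      case False
      define z where "z = y(q := 0)"
      have sub: "{p. z p \<noteq> 0} \<subseteq> {p. y p \<noteq> 0}" by (auto simp: z_def)
      have "z \<in> arrow_ideal_power Q n"
      proof -
        have "z \<in> carrier PA" using yc finite_subset[OF sub] sub unfolding path_algebra_simps by
          blast
        moreover have "n \<le> length (path_arrows p)" if "z p \<noteq> 0" for p
          using arrow_ideal_powerD[OF insert.prems(1), of p] that sub by blast
        ultimately show ?thesis by (rule arrow_ideal_powerI)
      qed
      moreover have "{p. z p \<noteq> 0} \<subseteq> F" using insert.prems(2) by (auto simp: z_def)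
      ultimately have z: "cls z \<in> S" "z \<in> carrier PA" using insert.IH arrow_ideal_power_PA by blast+
      have q: "q \<in> paths Q" "n \<le> length (path_arrows q)"
        using False yc arrow_ideal_powerD[OF insert.prems(1)] by (auto simp: path_algebra_simps)
      have "y = (y q \<odot>\<^bsub>PA\<^esub> path_elt q) \<oplus>\<^bsub>PA\<^esub> z"
        by (auto simp: path_algebra_simps path_elt_def z_def)
      then have "cls y = cls (y q \<odot>\<^bsub>PA\<^esub> path_elt q) \<oplus>\<^bsub>A\<^esub> cls z"
        using z q by (metis cls_add smult_closed path_elt_closed)
      also have "cls (y q \<odot>\<^bsub>PA\<^esub> path_elt q) = pc q \<otimes>\<^bsub>A\<^esub> (y q \<odot>\<^bsub>A\<^esub> \<one>\<^bsub>A\<^esub>)"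
      proof -
        have "y q \<odot>\<^bsub>A\<^esub> \<one>\<^bsub>A\<^esub> = cls (y q \<odot>\<^bsub>PA\<^esub> \<one>\<^bsub>PA\<^esub>)" using cls_smult[of "\<one>\<^bsub>PA\<^esub>"] by (simp add:
          alg_simps(3))
        then show ?thesis
          using q(1) by (simp add: pc_cls cls_mult smult_closed smult_mult_right)
      qed
      also have "\<dots> = scal A (regular A) (y q) (pc q)" by (simp add: scal_def)
      finally show ?thesis using z(1) p[OF q] S by (simp add: A.subspace_def)
    qed
  qed
  from this[OF _ x(1) order_refl] show ?thesis using x by (simp add: arrow_ideal_power_def
    path_algebra_simps)
qed

text \<open>If the m-th power of the radical is zero, paths of length at least m have class zero,
  and the finitely many shorter ones span.\<close>

lemma fd_regular: "fd_module A (regular A)"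
proof -
  obtain m where m: "filt m = {\<zero>\<^bsub>A\<^esub>}" using filt_nilpotent by blast
  let ?P = "{p \<in> paths Q. length (path_arrows p) < m}"
  have "?P \<subseteq> (\<lambda>(u, es, v). (u, es, v)) ` (verts Q \<times> {es. set es \<subseteq> arcs Q \<and> length es \<le> m} \<times> verts
    Q)"
    by (auto simp: paths_iff awalk_def) (metis awalk_def awalk_last_in_verts)
  moreover have "finite (verts Q \<times> {es. set es \<subseteq> arcs Q \<and> length es \<le> m} \<times> verts Q)"
    by (intro finite_cartesian_product finite_lists_length_le) auto
  ultimately have fin: "finite ?P" using finite_subset by blast
  have "A.spanning (regular A) (pc ` ?P)"
    unfolding A.spanning_def
  proof (intro conjI allI impI)
    show "finite (pc ` ?P)" using fin by simp
    show "pc ` ?P \<subseteq> carrier (regular A)" by auto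
    fix S assume S: "A.subspace (regular A) S \<and> pc ` ?P \<subseteq> S"
    show "carrier (regular A) \<subseteq> S"
    proof
      fix X assume "X \<in> carrier (regular A)"
      then have X: "X \<in> filt 0" by (simp add: filt_0)
      show "X \<in> S"
      proof (rule filt_span[OF X])
        fix p assume p: "p \<in> paths Q" "0 \<le> length (path_arrows p)"
        show "pc p \<in> S"
        proof (cases "length (path_arrows p) < m")
          case True
          then show ?thesis using S p by blast
        next
          case False
          then have "(path_elt p :: _ \<Rightarrow> 'k) \<in> arrow_ideal_power Q m"
            using path_elt_closed[OF p(1)] by (auto simp: arrow_ideal_power_def path_elt_def)
          then have "pc p \<in> filt m" by (auto simp: filt_def pc_cls)
          then show ?thesis using m S by (simp add: A.subspace_def)
        qed
      qed (use S in blast)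
    qed
  qed
  then show ?thesis using regular_right_module[OF A.ring_axioms] by (auto simp: A.fd_module_iff)
qed

end

section \<open>Projective resolutions of length one\<close>

lemma dual_basis_hom_eq:
  assumes S: "dual_basis R P S" and P: "right_module R P" and N: "right_module R N"
    and g: "mod_hom R P N g" and h: "mod_hom R P N h"
    and eq: "\<And>m \<phi>. (m, \<phi>) \<in> set S \<Longrightarrow> g m = h m" and x: "x \<in> carrier P"
  shows "g x = h x"
proof -
  interpret P: right_module R P by fact
  let ?xs = "map (\<lambda>(m, \<phi>). \<phi> x \<odot>\<^bsub>P\<^esub> m) S"
  have sc: "\<phi> x \<in> carrier R" "m \<in> carrier P" if "(m, \<phi>) \<in> set S" for m \<phi>
    using mod_homD(1)[OF dual_basisD(2)[OF S that] x] dual_basisD(1)[OF S that] by auto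
  have xs: "set ?xs \<subseteq> carrier P" using sc by auto
  have "map g ?xs = map h ?xs"
    using sc eq by (auto simp: mod_homD(3)[OF g] mod_homD(3)[OF h])
  then have "g (msum P ?xs) = h (msum P ?xs)"
    by (simp only: mod_hom_msum[OF g P N xs] mod_hom_msum[OF h P N xs])
  then show ?thesis by (simp only: dual_basisD(3)[OF S x])
qed

context kalgebra begin

lemma stalk_bounded:
  assumes T: "fd_module A T" shows "bounded_complex A (stalk T)"
proof -
  interpret T: right_module A T by (rule fd_moduleD[OF T])
  have Z: "right_module A (zero_sub T)" by (rule zero_sub_right_module[OF fd_moduleD[OF T]])
  have "{n::int. carrier (if n = 0 then T else zero_sub T) \<noteq> {\<zero>\<^bsub>if n = 0 then T else zero_sub T\<^esub>}}
    \<subseteq> {0::int}" by auto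
  then have "finite {n::int. carrier (if n = 0 then T else zero_sub T) \<noteq> {\<zero>\<^bsub>if n = 0 then T else
    zero_sub T\<^esub>}}"
    by (rule finite_subset) simp
  moreover have "mod_hom A (if n = 0 then T else zero_sub T) (if n + 1 = 0 then T else zero_sub T)
    (\<lambda>x. \<zero>\<^bsub>T\<^esub>)" for n :: int
    by (cases "n + 1 = 0")
      (simp_all add: mod_hom_const_zero[OF fd_moduleD[OF T]] mod_hom_const_zero[OF Z, simplified])
  ultimately show ?thesis
    using T fd_zero_sub[OF fd_moduleD[OF T]] by (simp add: bounded_complex_def stalk_def)
qed

end

context two_term_complex begin

text \<open>Extended by zero, p is a quasi-isomorphism to the stalk: exactness at the middle term
  and surjectivity of p take care of degree 0, injectivity of d of degree -1, and all other terms
  vanish.\<close>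

lemma resolution_Db_iso:
  assumes ex: "short_exact A (obj X (-1)) d (obj X 0) p T" and T: "fd_module A T"
  shows "Db_iso A X (stalk T)"
proof (rule Db_iso_quasi_iso[OF X stalk_bounded[OF T]])
  note rX = bounded_complexD(2)[OF X] and rT = fd_moduleD[OF T]
  note bT = stalk_bounded[OF T]
  interpret T: right_module A T by (rule rT)
  have inj: "inj_on d (carrier (obj X (-1)))" and ph: "mod_hom A (obj X 0) T p"
    and pim: "p ` carrier (obj X 0) = carrier T" and kp: "d ` carrier (obj X (-1)) = ker (obj X 0)
      T p"
    using ex by (auto simp: short_exact_def mod_surj_def)
  define q where "q n = (if n = 0 then p else (\<lambda>x. \<zero>\<^bsub>T\<^esub>))" for n :: int
  have oS: "obj (stalk T) n = (if n = 0 then T else zero_sub T)" and dS: "diff (stalk T) n x =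
    \<zero>\<^bsub>T\<^esub>" for n x
    by (simp_all add: stalk_def)
  have zS: "\<zero>\<^bsub>obj (stalk T) n\<^esub> = \<zero>\<^bsub>T\<^esub>" for n by (simp add: oS)
  have cob: "coboundaries (stalk T) n = {\<zero>\<^bsub>T\<^esub>}" for n
    using coboundaries_closed(2)[OF bT, of n] by (auto simp: coboundaries_def dS zS)
  have qc: "chain_map A X (stalk T) q"
    unfolding chain_map_def
  proof (intro allI conjI ballI)
    fix n
    show "mod_hom A (obj X n) (obj (stalk T) n) (q n)"
      using ph mod_hom_const_zero[OF zero_sub_right_module[OF rT], of "obj X n"] by (simp add:
        q_def oS)
    fix x assume x: "x \<in> carrier (obj X n)"
    show "q (n + 1) (diff X n x) = diff (stalk T) n (q n x)"
    proof (cases "n = -1")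
      case True
      then have "d x \<in> ker (obj X 0) T p" using x unfolding kp[symmetric] by blast
      then show ?thesis using True by (simp add: q_def dS ker_def)
    qed (auto simp: q_def dS)
  qed
  show "quasi_iso A X (stalk T) q"
    unfolding quasi_iso_def
  proof (intro conjI qc allI ballI impI)
    fix n x assume x: "x \<in> cocycles X n" and qx: "q n x \<in> coboundaries (stalk T) n"
    then have xc: "x \<in> carrier (obj X n)" and dx: "diff X n x = \<zero>\<^bsub>obj X (n + 1)\<^esub>" by (auto simp:
      cocycles_def ker_def)
    consider "n = 0" | "n = -1" | "n \<noteq> 0" "n \<noteq> -1" by blast
    then show "x \<in> coboundaries X n"
    proof cases
      case 1
      then have "x \<in> ker (obj X 0) T p" using xc qx by (simp add: cob q_def ker_def)
      then show ?thesis using 1 unfolding kp[symmetric] by (simp add: coboundaries_def)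
    next
      case 2
      then have "d x = \<zero>\<^bsub>obj X 0\<^esub>" using dx by simp
      then have "x = \<zero>\<^bsub>obj X (-1)\<^esub>"
        using mod_hom_inj_iff[OF d_hom rX rX] inj xc 2 by blast
      then show ?thesis using coboundaries_closed(2)[OF X] 2 by simp
    next
      case 3
      then have "x = \<zero>\<^bsub>obj X n\<^esub>" using trivial xc by blast
      then show ?thesis using coboundaries_closed(2)[OF X] by simp
    qed
  next
    fix n y assume y: "y \<in> cocycles (stalk T) n"
    then have yc: "y \<in> carrier (obj (stalk T) n)" by (simp add: cocycles_def ker_def)
    interpret Sn: right_module A "obj (stalk T) n" by (rule bounded_complexD(2)[OF bT])
    show "\<exists>x\<in>cocycles X n. \<exists>b\<in>coboundaries (stalk T) n. y = q n x \<oplus>\<^bsub>obj (stalk T) n\<^esub> b"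
    proof (cases "n = 0")
      case True
      then have "y \<in> carrier T" using yc by (simp add: oS)
      then obtain x where x: "x \<in> carrier (obj X 0)" "y = p x" unfolding pim[symmetric] by blast
      then show ?thesis
        using True \<open>y \<in> carrier T\<close> cocycle0[OF x(1)] by (intro bexI[of _ x]) (simp_all add: cob
          q_def oS)
    next
      case False
      then have "y = \<zero>\<^bsub>T\<^esub>" using yc by (simp add: oS)
      then show ?thesis
        using False submoduleD(2)[OF cocycles_submodule[OF X, of n]]
        by (intro bexI[of _ "\<zero>\<^bsub>obj X n\<^esub>"]) (simp_all add: cob q_def oS)
    qed
  qed
qed

text \<open>Lift \<phi> through p to a map from degree -1 to degree 0; the vanishing in degree 1
  writes it as d a + b d. Composition with p kills the first term, so \<phi> = (p b) d extends to
  the degree 0 term.\<close>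

lemma resolution_Ext1_zero:
  assumes 0: "Db_hom_zero A X (shift 1 X)"
    and ex: "short_exact A (obj X (-1)) d (obj X 0) p T" and T: "right_module A T"
    and S1: "dual_basis A (obj X (-1)) S1" and S0: "dual_basis A (obj X 0) S0"
  shows "Ext1_zero A T T"
proof (rule Ext1_zeroI[OF ex S1 S0 _ _ T])
  note rX = bounded_complexD(2)[OF X]
  show "right_module A (obj X (-1))" "right_module A (obj X 0)" by (rule rX)+
  interpret T: right_module A T by fact
  have inj: "inj_on d (carrier (obj X (-1)))" and ph: "mod_hom A (obj X 0) T p"
    and pim: "p ` carrier (obj X 0) = carrier T" and kp: "d ` carrier (obj X (-1)) = ker (obj X 0)
      T p"
    using ex by (auto simp: short_exact_def mod_surj_def)
  fix \<phi> assume \<phi>: "mod_hom A (obj X (-1)) T \<phi>"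
  have "\<exists>\<phi>'. mod_hom A (obj X (-1)) (obj X 0) \<phi>' \<and> (\<forall>x\<in>carrier (obj X (-1)). p (\<phi>' x) = \<phi> x)"
    by (rule dual_basis_lift[OF S1 rX rX T ph \<phi>]) (use pim mod_homD(1)[OF \<phi>] in blast)
  then obtain \<phi>' where \<phi>': "mod_hom A (obj X (-1)) (obj X 0) \<phi>'"
    "\<And>x. x \<in> carrier (obj X (-1)) \<Longrightarrow> p (\<phi>' x) = \<phi> x" by blast
  obtain a b where a: "mod_hom A (obj X (-1)) (obj X (-1)) a" and b: "mod_hom A (obj X 0) (obj X
    0) b"
    and ab: "\<And>x. x \<in> carrier (obj X (-1)) \<Longrightarrow> \<phi>' x = d (a x) \<oplus>\<^bsub>obj X 0\<^esub> b (d x)"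
    using hom_degree_1_nullhomotopic[OF 0 \<phi>'(1) inj S1 S0] by blast
  have "\<phi> x = p (b (d x))" if x: "x \<in> carrier (obj X (-1))" for x
  proof -
    have c: "a x \<in> carrier (obj X (-1))" "d (a x) \<in> carrier (obj X 0)" "b (d x) \<in> carrier (obj X 0)"
      using x mod_homD(1)[OF a] mod_homD(1)[OF b] mod_homD(1)[OF d_hom] by blast+
    have "d (a x) \<in> ker (obj X 0) T p" using c(1) unfolding kp[symmetric] by blast
    then have "p (d (a x)) = \<zero>\<^bsub>T\<^esub>" by (simp add: ker_def)
    then show ?thesis
      using \<phi>'(2)[OF x] c mod_homD(1)[OF ph c(3)] by (simp add: ab[OF x] mod_homD(2)[OF ph])
  qed
  then show "\<exists>\<psi>. mod_hom A (obj X 0) T \<psi> \<and> (\<forall>x\<in>carrier (obj X (-1)). \<phi> x = \<psi> (d x))"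
    using mod_hom_comp[OF b ph] by blast
qed

end

lemma (in kalgebra) short_exact_transport:
  assumes ex: "short_exact A L f M g N"
    and L': "mod_hom A L L' hl" "mod_hom A L' L gl" "\<And>x. x \<in> carrier L \<Longrightarrow> gl (hl x) = x" "\<And>x. x \<in>
      carrier L' \<Longrightarrow> hl (gl x) = x"
    and M': "mod_hom A M M' hm" "mod_hom A M' M gm" "\<And>x. x \<in> carrier M \<Longrightarrow> gm (hm x) = x" "\<And>x. x \<in>
      carrier M' \<Longrightarrow> hm (gm x) = x"
  shows "short_exact A L' (\<lambda>x. hm (f (gl x))) M' (\<lambda>x. g (gm x)) N"
proof -
  have f: "mod_hom A L M f" and inj: "inj_on f (carrier L)" and g: "mod_hom A M N g"
    and gs: "g ` carrier M = carrier N" and k: "f ` carrier L = ker M N g"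
    using ex by (auto simp: short_exact_def mod_surj_def)
  note fc = mod_homD(1)[OF f] and glc = mod_homD(1)[OF L'(2)] and hlc = mod_homD(1)[OF L'(1)]
    and gmc = mod_homD(1)[OF M'(2)] and hmc = mod_homD(1)[OF M'(1)]
  show ?thesis
    unfolding short_exact_def mod_surj_def
  proof (intro conjI)
    show "mod_hom A L' M' (\<lambda>x. hm (f (gl x)))" by (rule mod_hom_comp[OF mod_hom_comp[OF L'(2) f]
      M'(1)])
    show "mod_hom A M' N (\<lambda>x. g (gm x))" by (rule mod_hom_comp[OF M'(2) g])
    show "inj_on (\<lambda>x. hm (f (gl x))) (carrier L')"
    proof (rule inj_onI)
      fix x y assume xy: "x \<in> carrier L'" "y \<in> carrier L'" "hm (f (gl x)) = hm (f (gl y))"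
      then have "f (gl x) = f (gl y)" using M'(3) fc glc by metis
      then have "gl x = gl y" using inj_onD[OF inj] xy glc by blast
      then show "x = y" using L'(4) xy by metis
    qed
    show "(\<lambda>x. g (gm x)) ` carrier M' = carrier N"
    proof -
      have "gm ` carrier M' = carrier M" using gmc hmc M'(3) by (auto simp: image_iff) (metis)
      then show ?thesis unfolding gs[symmetric] by (metis image_image)
    qed
    show "(\<lambda>x. hm (f (gl x))) ` carrier L' = ker M' N (\<lambda>x. g (gm x))"
    proof
      show "(\<lambda>x. hm (f (gl x))) ` carrier L' \<subseteq> ker M' N (\<lambda>x. g (gm x))"
      proof
        fix y assume "y \<in> (\<lambda>x. hm (f (gl x))) ` carrier L'"
        then obtain x where x: "x \<in> carrier L'" "y = hm (f (gl x))" by blast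
        then have "f (gl x) \<in> ker M N g" using glc unfolding k[symmetric] by blast
        then show "y \<in> ker M' N (\<lambda>x. g (gm x))" using x M'(3) hmc by (simp add: ker_def)
      qed
      show "ker M' N (\<lambda>x. g (gm x)) \<subseteq> (\<lambda>x. hm (f (gl x))) ` carrier L'"
      proof
        fix y assume "y \<in> ker M' N (\<lambda>x. g (gm x))"
        then have y: "y \<in> carrier M'" "g (gm y) = \<zero>\<^bsub>N\<^esub>" by (auto simp: ker_def)
        then have "gm y \<in> ker M N g" using gmc by (simp add: ker_def)
        then obtain x where x: "x \<in> carrier L" "gm y = f x" unfolding k[symmetric] by blast
        then have "y = hm (f (gl (hl x)))" using M'(4)[OF y(1)] L'(3) by simp
        then show "y \<in> (\<lambda>x. hm (f (gl x))) ` carrier L'" using hlc x(1) by blast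
      qed
    qed
  qed
qed

lemma (in kalgebra) univ_model_maps:
  assumes M: "fd_module A (M :: ('a, 'm) module)"
  obtains N :: "('a, 'k univ) module" and h g where "fd_module A N" "mod_hom A M N h" "mod_hom A N
    M g"
    "\<And>x. x \<in> carrier M \<Longrightarrow> g (h x) = x" "\<And>x. x \<in> carrier N \<Longrightarrow> h (g x) = x"
proof -
  obtain N :: "('a, 'k univ) module" and h where N: "fd_module A N" "iso_map M N h"
    using fd_univ_model[OF M] by blast
  show thesis
    by (rule iso_mapE[OF N(2) fd_moduleD[OF M] fd_moduleD[OF N(1)]]) (rule that[OF N(1)])
qed

text \<open>The definition asks for projective modules on lists of scalars, so the given resolution
  is transported to list models, and projectivity is carried along by the dual bases.\<close>

lemma (in kalgebra) proj_dim_le_1I: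
  assumes ex: "short_exact A P1 f P0 g M" and P: "fd_module A P1" "fd_module A P0"
    and S: "dual_basis A P1 S1" "dual_basis A P0 S0"
  shows "proj_dim_le_1 A M"
proof -
  obtain P1' :: "('a, 'k univ) module" and h1 g1 where 1: "fd_module A P1'" "mod_hom A P1 P1' h1"
    "mod_hom A P1' P1 g1"
    "\<And>x. x \<in> carrier P1 \<Longrightarrow> g1 (h1 x) = x" "\<And>x. x \<in> carrier P1' \<Longrightarrow> h1 (g1 x) = x"
    using univ_model_maps[OF P(1)] by blast
  obtain P0' :: "('a, 'k univ) module" and h0 g0 where 0: "fd_module A P0'" "mod_hom A P0 P0' h0"
    "mod_hom A P0' P0 g0"
    "\<And>x. x \<in> carrier P0 \<Longrightarrow> g0 (h0 x) = x" "\<And>x. x \<in> carrier P0' \<Longrightarrow> h0 (g0 x) = x"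
    using univ_model_maps[OF P(2)] by blast
  have "projective A P1'"
    by (rule dual_basis_projective[OF dual_basis_iso[OF S(1) fd_moduleD[OF P(1)] fd_moduleD[OF
      1(1)] 1(2,3,5)] 1(1)])
  moreover have "projective A P0'"
    by (rule dual_basis_projective[OF dual_basis_iso[OF S(2) fd_moduleD[OF P(2)] fd_moduleD[OF
      0(1)] 0(2,3,5)] 0(1)])
  ultimately show ?thesis
    using short_exact_transport[OF ex 1(2-5) 0(2-5)] unfolding proj_dim_le_1_def by blast
qed

section \<open>Idempotents and one-sided decompositions of $KQ/I$\<close>

context bound_quiver begin

lemma A_idem: "i \<in> verts Q \<Longrightarrow> idem A (ve i)"
  by unfold_locales (simp_all add: ve_mult)

lemma opp_idem: "i \<in> verts Q \<Longrightarrow> idem (opposite A) (ve i)"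
  using opposite_ring[OF A.ring_axioms]
  by (intro idem.intro idem_axioms.intro) (simp_all add: ve_mult)

lemma proj_at_eq: "proj_at Q I i = cyc_proj A (ve i)"
  by (simp add: proj_at_def cyc_proj_def ve_def pc_def)

lemma proj_at_iff: "i \<in> verts Q \<Longrightarrow> x \<in> carrier (proj_at Q I i) \<longleftrightarrow> x \<in> carrier A \<and> ve i \<otimes>\<^bsub>A\<^esub> x = x"
  by (simp add: proj_at_eq idem.cyc_proj_iff[OF A_idem])

lemma left_mult_hom: "x \<in> carrier A \<Longrightarrow> mod_hom A (regular A) (regular A) (\<lambda>y. x \<otimes>\<^bsub>A\<^esub> y)"
  by (rule mod_homI) (simp_all add: A.r_distr A.m_assoc)

lemma right_mult_hom:
  "x \<in> carrier A \<Longrightarrow> mod_hom (opposite A) (regular (opposite A)) (regular (opposite A)) (\<lambda>y. y \<otimes>\<^bsub>A\<^esub>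
    x)"
  by (rule mod_homI) (simp_all add: A.l_distr A.m_assoc)

lemma msum_regular_opposite: "msum (regular (opposite A)) = msum (regular A)"
  by (simp add: msum_def fun_eq_iff)

text \<open>Partial sums are the classes of the indicator functions of sets of trivial paths, and
  the indicator function of all trivial paths is the unit of the path algebra.\<close>

lemma one_eq_msum:
  assumes vs: "set vs = verts Q" "distinct vs"
  shows "msum (regular A) (map ve vs) = \<one>\<^bsub>A\<^esub>"
proof -
  let ?u = "\<lambda>V p. if p \<in> vertex_path ` V then 1 else (0::'k)"
  have "?u (set ws) \<in> carrier PA \<and> msum (regular A) (map ve ws) = cls (?u (set ws))"
    if "set ws \<subseteq> verts Q" "distinct ws" for ws
    using that
  proof (induction ws)
    case Nil
    have "?u (set []) = \<zero>\<^bsub>PA\<^esub>" by (simp add: path_algebra_simps)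
    then show ?case by (simp only: cls_zero) (simp add: cls_zero[symmetric])
  next
    case (Cons w ws)
    then have IH: "?u (set ws) \<in> carrier PA" "msum (regular A) (map ve ws) = cls (?u (set ws))" by
      auto
    have w: "w \<in> verts Q" "w \<notin> set ws" using Cons.prems by auto
    have e: "?u (set (w # ws)) = path_elt (vertex_path w) \<oplus>\<^bsub>PA\<^esub> ?u (set ws)"
      using w by (auto simp: path_algebra_simps path_elt_def fun_eq_iff vertex_path_def)
    have pw: "path_elt (vertex_path w) \<in> carrier PA" using w by (simp add: vertex_path_in_paths)
    have "?u (set (w # ws)) \<in> carrier PA" unfolding e using pw IH(1) by (rule I.a_closed)
    moreover have "msum (regular A) (map ve (w # ws)) = cls (?u (set (w # ws)))"
      unfolding e using IH by (simp add: cls_add[OF pw IH(1), symmetric] ve_def pc_cls)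
    ultimately show ?case by blast
  qed
  from this[of vs] vs show ?thesis by (simp add: alg_simps(3) path_algebra_simps(3))
qed

lemma sum_left:
  assumes vs: "set vs = verts Q" "distinct vs" and x: "x \<in> carrier A"
  shows "msum (regular A) (map (\<lambda>i. ve i \<otimes>\<^bsub>A\<^esub> x) vs) = x"
proof -
  have "set (map ve vs) \<subseteq> carrier (regular (opposite A))" using vs by auto
  from mod_hom_msum[OF right_mult_hom[OF x] regular_right_module regular_right_module this]
  have "msum (regular A) (map ve vs) \<otimes>\<^bsub>A\<^esub> x = msum (regular A) (map (\<lambda>i. ve i \<otimes>\<^bsub>A\<^esub> x) vs)"
    by (simp add: opposite_ring[OF A.ring_axioms] msum_regular_opposite comp_def)
  then show ?thesis using x by (simp add: one_eq_msum[OF vs])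
qed

lemma sum_right:
  assumes vs: "set vs = verts Q" "distinct vs" and x: "x \<in> carrier A"
  shows "msum (regular A) (map (\<lambda>i. x \<otimes>\<^bsub>A\<^esub> ve i) vs) = x"
proof -
  have "set (map ve vs) \<subseteq> carrier (regular A)" using vs by auto
  from mod_hom_msum[OF left_mult_hom[OF x] regular_right_module regular_right_module this]
  have "x \<otimes>\<^bsub>A\<^esub> msum (regular A) (map ve vs) = msum (regular A) (map (\<lambda>i. x \<otimes>\<^bsub>A\<^esub> ve i) vs)"
    by (simp add: A.ring_axioms comp_def)
  then show ?thesis using x by (simp add: one_eq_msum[OF vs])
qed

lemma verts_list: obtains vs where "set vs = verts Q" "distinct vs"
  using finite_distinct_list[OF finite_verts] by blast

lemma zero_if_left:
  assumes "x \<in> carrier A" "\<And>i. i \<in> verts Q \<Longrightarrow> ve i \<otimes>\<^bsub>A\<^esub> x = \<zero>\<^bsub>A\<^esub>" shows "x = \<zero>\<^bsub>A\<^esub>"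
proof -
  obtain vs where vs: "set vs = verts Q" "distinct vs" by (rule verts_list)
  interpret R: right_module A "regular A" by (rule regular_right_module[OF A.ring_axioms])
  have "msum (regular A) (map (\<lambda>i. ve i \<otimes>\<^bsub>A\<^esub> x) vs) = \<zero>\<^bsub>regular A\<^esub>"
    by (rule R.msum_zero) (use assms(2) vs in auto)
  then show ?thesis using sum_left[OF vs assms(1)] by simp
qed

lemma eq_right_if:
  assumes "x \<in> carrier A" "k \<in> verts Q" "\<And>i. i \<in> verts Q \<Longrightarrow> i \<noteq> k \<Longrightarrow> x \<otimes>\<^bsub>A\<^esub> ve i = \<zero>\<^bsub>A\<^esub>"
  shows "x \<otimes>\<^bsub>A\<^esub> ve k = x"
proof -
  obtain vs where vs: "set vs = verts Q" "distinct vs" by (rule verts_list)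
  interpret R: right_module A "regular A" by (rule regular_right_module[OF A.ring_axioms])
  have "map (\<lambda>i. x \<otimes>\<^bsub>A\<^esub> ve i) vs = map (\<lambda>i. if i = k then x \<otimes>\<^bsub>A\<^esub> ve k else \<zero>\<^bsub>regular A\<^esub>) vs"
    using assms(3) vs by auto
  then have "msum (regular A) (map (\<lambda>i. x \<otimes>\<^bsub>A\<^esub> ve i) vs)
    = msum (regular A) (map (\<lambda>i. if i = k then x \<otimes>\<^bsub>A\<^esub> ve k else \<zero>\<^bsub>regular A\<^esub>) vs)" by (rule
      arg_cong)
  also have "\<dots> = x \<otimes>\<^bsub>A\<^esub> ve k" by (rule R.msum_single[OF vs(2)]) (use vs assms in simp_all)
  finally show ?thesis using sum_right[OF vs assms(1)] by simp
qed

lemma pc_cases: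
  assumes p: "p \<in> paths Q"
  obtains i where "i \<in> verts Q" "p = vertex_path i"
  | \<beta> q where "\<beta> \<in> arcs Q" "q \<in> paths Q" "pc p = ar \<beta> \<otimes>\<^bsub>A\<^esub> pc q" "path_arrows p \<noteq> []"
proof -
  obtain u es v where uv: "p = (u, es, v)" by (cases p)
  show thesis
  proof (cases es)
    case Nil
    then have "p = vertex_path u" "u \<in> verts Q" using p by (auto simp: uv paths_iff awalk_Nil_iff
      vertex_path_def)
    then show thesis using that(1) by blast
  next
    case (Cons \<beta> es')
    then have b: "\<beta> \<in> arcs Q" "u = tail Q \<beta>" "awalk (head Q \<beta>) es' v" using p by (auto simp: uv
      paths_iff awalk_Cons_iff)
    let ?q = "(head Q \<beta>, es', v)"
    have q: "?q \<in> paths Q" using b by (simp add: paths_iff)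
    have "ar \<beta> \<otimes>\<^bsub>A\<^esub> pc ?q = pc p"
      unfolding ar_def by (subst pc_mult) (use b q in \<open>simp_all add: arrow_path_in_paths, simp
        add: arrow_path_def path_comp_def uv Cons\<close>)
    then show thesis using that(2)[OF b(1) q] Cons uv by simp
  qed
qed

lemma pc_snoc:
  assumes p: "p \<in> paths Q" "1 \<le> length (path_arrows p)"
  obtains \<beta> q where "\<beta> \<in> arcs Q" "q \<in> paths Q" "pc p = pc q \<otimes>\<^bsub>A\<^esub> ar \<beta>"
proof -
  obtain u es v where uv: "p = (u, es, v)" by (cases p)
  then obtain es' \<beta> where es: "es = es' @ [\<beta>]" using p(2) by (cases es rule: rev_cases) auto
  then have b: "awalk u es' (awlast u es')" "awalk (awlast u es') [\<beta>] v" using p by (auto simp: uv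
    paths_iff)
  then have bb: "\<beta> \<in> arcs Q" "awlast u es' = tail Q \<beta>" "v = head Q \<beta>" by (auto simp:
    awalk_Cons_iff awalk_Nil_iff)
  let ?q = "(u, es', tail Q \<beta>)"
  have q: "?q \<in> paths Q" using b bb by (simp add: paths_iff)
  have "pc ?q \<otimes>\<^bsub>A\<^esub> ar \<beta> = pc p"
    unfolding ar_def by (subst pc_mult) (use bb q in \<open>simp_all add: arrow_path_in_paths, simp add:
      arrow_path_def path_comp_def uv es\<close>)
  then show thesis using that[OF bb(1) q] by simp
qed

text \<open>The arrows generate the radical as a left module, because a path of positive length ends
  in an arrow and such sums form a subspace. The order of the arrows is left open so that those
  ending at k can later be put in front.\<close>

lemma filt_1_right_decomp:
  assumes y: "y \<in> filt 1" and bs: "set bs = arcs Q" "distinct bs"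
  shows "\<exists>w. (\<forall>\<beta>\<in>arcs Q. w \<beta> \<in> carrier A) \<and> y = msum (regular A) (map (\<lambda>\<beta>. w \<beta> \<otimes>\<^bsub>A\<^esub> ar \<beta>) bs)"
proof -
  interpret R: right_module A "regular A" by (rule regular_right_module[OF A.ring_axioms])
  define S where "S = {y \<in> carrier A. \<exists>w. (\<forall>\<beta>\<in>arcs Q. w \<beta> \<in> carrier A) \<and> y = msum (regular A) (map
    (\<lambda>\<beta>. w \<beta> \<otimes>\<^bsub>A\<^esub> ar \<beta>) bs)}"
  have SI: "msum (regular A) (map (\<lambda>\<beta>. w \<beta> \<otimes>\<^bsub>A\<^esub> ar \<beta>) bs) \<in> S" if "\<forall>\<beta>\<in>arcs Q. w \<beta> \<in> carrier A" for w
  proof -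
    have "set (map (\<lambda>\<beta>. w \<beta> \<otimes>\<^bsub>A\<^esub> ar \<beta>) bs) \<subseteq> carrier (regular A)" using that bs by auto
    from R.msum_closed[OF this] show ?thesis using that unfolding S_def by auto
  qed
  have "y \<in> S"
  proof (rule filt_span[OF y])
    show "A.subspace (regular A) S"
      unfolding A.subspace_def
    proof (intro conjI ballI allI)
      show "S \<subseteq> carrier (regular A)" by (auto simp: S_def)
      have "msum (regular A) (map (\<lambda>\<beta>. \<zero>\<^bsub>A\<^esub> \<otimes>\<^bsub>A\<^esub> ar \<beta>) bs) = \<zero>\<^bsub>regular A\<^esub>"
        by (rule R.msum_zero) (use bs in auto)
      then show "\<zero>\<^bsub>regular A\<^esub> \<in> S" using SI[of "\<lambda>_. \<zero>\<^bsub>A\<^esub>"] by simp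
      fix x z assume "x \<in> S" "z \<in> S"
      then obtain w w' where w: "\<forall>\<beta>\<in>arcs Q. w \<beta> \<in> carrier A" "x = msum (regular A) (map (\<lambda>\<beta>. w \<beta>
        \<otimes>\<^bsub>A\<^esub> ar \<beta>) bs)"
        "\<forall>\<beta>\<in>arcs Q. w' \<beta> \<in> carrier A" "z = msum (regular A) (map (\<lambda>\<beta>. w' \<beta> \<otimes>\<^bsub>A\<^esub> ar \<beta>) bs)"
        by (auto simp: S_def)
      have "map (\<lambda>\<beta>. (w \<beta> \<oplus>\<^bsub>A\<^esub> w' \<beta>) \<otimes>\<^bsub>A\<^esub> ar \<beta>) bs = map (\<lambda>\<beta>. w \<beta> \<otimes>\<^bsub>A\<^esub> ar \<beta> \<oplus>\<^bsub>regular A\<^esub> w' \<beta> \<otimes>\<^bsub>A\<^esub>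
        ar \<beta>) bs"
        using w bs by (auto simp: A.l_distr)
      then have "msum (regular A) (map (\<lambda>\<beta>. (w \<beta> \<oplus>\<^bsub>A\<^esub> w' \<beta>) \<otimes>\<^bsub>A\<^esub> ar \<beta>) bs)
        = msum (regular A) (map (\<lambda>\<beta>. w \<beta> \<otimes>\<^bsub>A\<^esub> ar \<beta> \<oplus>\<^bsub>regular A\<^esub> w' \<beta> \<otimes>\<^bsub>A\<^esub> ar \<beta>) bs)"
        by (rule arg_cong)
      also have "msum (regular A) (map (\<lambda>\<beta>. w \<beta> \<otimes>\<^bsub>A\<^esub> ar \<beta> \<oplus>\<^bsub>regular A\<^esub> w' \<beta> \<otimes>\<^bsub>A\<^esub> ar \<beta>) bs) = x
        \<oplus>\<^bsub>regular A\<^esub> z"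
        unfolding w(2,4) by (rule R.msum_map_add) (use w bs in auto)
      finally have "msum (regular A) (map (\<lambda>\<beta>. (w \<beta> \<oplus>\<^bsub>A\<^esub> w' \<beta>) \<otimes>\<^bsub>A\<^esub> ar \<beta>) bs) = x \<oplus>\<^bsub>regular A\<^esub> z" .
      then show "x \<oplus>\<^bsub>regular A\<^esub> z \<in> S" using SI[of "\<lambda>\<beta>. w \<beta> \<oplus>\<^bsub>A\<^esub> w' \<beta>"] w by simp
    next
      fix c x assume "x \<in> S"
      then obtain w where w: "\<forall>\<beta>\<in>arcs Q. w \<beta> \<in> carrier A" "x = msum (regular A) (map (\<lambda>\<beta>. w \<beta> \<otimes>\<^bsub>A\<^esub>
        ar \<beta>) bs)"
        and x: "x \<in> carrier A" by (auto simp: S_def)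
      let ?c = "c \<odot>\<^bsub>A\<^esub> \<one>\<^bsub>A\<^esub>"
      have cl: "set (map (\<lambda>\<beta>. w \<beta> \<otimes>\<^bsub>A\<^esub> ar \<beta>) bs) \<subseteq> carrier (regular A)" using w bs by auto
      have "scal A (regular A) c x = ?c \<otimes>\<^bsub>A\<^esub> x" using x by (simp add: scal_def A.scalar_central)
      also have "\<dots> = msum (regular A) (map (\<lambda>y. ?c \<otimes>\<^bsub>A\<^esub> y) (map (\<lambda>\<beta>. w \<beta> \<otimes>\<^bsub>A\<^esub> ar \<beta>) bs))"
        unfolding w(2)
        by (rule mod_hom_msum[OF left_mult_hom regular_right_module regular_right_module cl])
          (simp_all add: A.ring_axioms)
      also have "map (\<lambda>y. ?c \<otimes>\<^bsub>A\<^esub> y) (map (\<lambda>\<beta>. w \<beta> \<otimes>\<^bsub>A\<^esub> ar \<beta>) bs) = map (\<lambda>\<beta>. (?c \<otimes>\<^bsub>A\<^esub> w \<beta>) \<otimes>\<^bsub>A\<^esub> ar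
        \<beta>) bs"
        using w bs by (auto simp: A.m_assoc)
      finally show "scal A (regular A) c x \<in> S" using SI[of "\<lambda>\<beta>. ?c \<otimes>\<^bsub>A\<^esub> w \<beta>"] w by simp
    qed
  next
    fix p assume p: "p \<in> paths Q" "1 \<le> length (path_arrows p)"
    obtain \<beta> q where b: "\<beta> \<in> arcs Q" "q \<in> paths Q" "pc p = pc q \<otimes>\<^bsub>A\<^esub> ar \<beta>" using pc_snoc[OF p] by
      blast
    have "map (\<lambda>\<gamma>. (if \<gamma> = \<beta> then pc q else \<zero>\<^bsub>A\<^esub>) \<otimes>\<^bsub>A\<^esub> ar \<gamma>) bs = map (\<lambda>\<gamma>. if \<gamma> = \<beta> then pc p else
      \<zero>\<^bsub>regular A\<^esub>) bs"
      using b bs by auto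
    then have "msum (regular A) (map (\<lambda>\<gamma>. (if \<gamma> = \<beta> then pc q else \<zero>\<^bsub>A\<^esub>) \<otimes>\<^bsub>A\<^esub> ar \<gamma>) bs)
      = msum (regular A) (map (\<lambda>\<gamma>. if \<gamma> = \<beta> then pc p else \<zero>\<^bsub>regular A\<^esub>) bs)" by (rule arg_cong)
    also have "\<dots> = pc p" by (rule R.msum_single[OF bs(2)]) (use bs b p in simp_all)
    finally have "msum (regular A) (map (\<lambda>\<gamma>. (if \<gamma> = \<beta> then pc q else \<zero>\<^bsub>A\<^esub>) \<otimes>\<^bsub>A\<^esub> ar \<gamma>) bs) = pc p" .
    then show "pc p \<in> S" using SI[of "\<lambda>\<gamma>. if \<gamma> = \<beta> then pc q else \<zero>\<^bsub>A\<^esub>"] b by simp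
  qed
  then show ?thesis unfolding S_def by blast
qed

lemma opp_kalgebra: "kalgebra (opposite A)"
  by (rule A.opposite_kalgebra)

text \<open>Scalars are central, so a subspace for one side is a subspace for the other, and the
  same finite set spans.\<close>

lemma fd_regular_opposite: "fd_module (opposite A) (regular (opposite A))"
proof -
  interpret B: kalgebra "opposite A" by (rule opp_kalgebra)
  obtain S where S: "A.spanning (regular A) S" using fd_regular by (auto simp: A.fd_module_iff)
  have "A.subspace (regular A) V" if V: "B.subspace (regular (opposite A)) V" for V
  proof -
    have "scal A (regular A) c x = scal (opposite A) (regular (opposite A)) c x" if "x \<in> V" for c x
    proof -
      have "x \<in> carrier A" using that V by (auto simp: B.subspace_def)
      then show ?thesis by (simp add: scal_def A.scalar_central)
    qed
    then show ?thesis using V by (simp add: A.subspace_def B.subspace_def)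
  qed
  then have "B.spanning (regular (opposite A)) S"
    using S by (simp add: A.spanning_def B.spanning_def)
  then show ?thesis using regular_right_module[OF B.ring_axioms] by (auto simp: B.fd_module_iff)
qed

end

lemma (in kalgebra) fd_cyc_proj:
  assumes "fd_module A (regular A)" "idem A e" shows "fd_module A (cyc_proj A e)"
proof -
  interpret idem A e by fact
  have "mod_surj A (regular A) (cyc_proj A e) (\<lambda>x. e \<otimes>\<^bsub>A\<^esub> x)"
    unfolding mod_surj_def
    by (intro conjI mod_homI) (use e_closed in \<open>auto simp: cyc_proj_simps r_distr m_assoc\<close>)
  then show ?thesis by (rule fd_image[OF assms(1) _ cyc_proj_right_module])
qed

section \<open>The inverse translate of the simple module\<close>

lemma mod_surj_comp:
  assumes "mod_surj R M N g" "mod_surj R N L h" shows "mod_surj R M L (\<lambda>x. h (g x))"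
  using assms mod_hom_comp[of R M N g L h] unfolding mod_surj_def by (metis image_image)

lemma simple_at_simps:
  "carrier (simple_at i) = UNIV" "add (simple_at i) = (+)" "zero (simple_at i) = 0"
  "smult (simple_at i) = (\<lambda>a x. x * vertex_coeff i a)"
  by (simp_all add: simple_at_def)

lemma hom_regular_simps:
  "carrier (hom_regular A P) = {\<phi> \<in> extensional (carrier P). mod_hom A P (regular A) \<phi>}"
  "add (hom_regular A P) = (\<lambda>\<phi> \<psi>. \<lambda>x\<in>carrier P. \<phi> x \<oplus>\<^bsub>A\<^esub> \<psi> x)"
  "smult (hom_regular A P) = (\<lambda>a \<phi>. \<lambda>x\<in>carrier P. a \<otimes>\<^bsub>A\<^esub> \<phi> x)"
  by (simp_all add: hom_regular_def)

locale bound_quiver_vertex = bound_quiver Q I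
  for Q :: "('v, 'e) pre_digraph" and I :: "(('v, 'e) qpath \<Rightarrow> 'k::field) set" +
  fixes k :: 'v
  assumes k: "k \<in> verts Q"
begin

abbreviation B :: "('k, ('k, 'v, 'e) bqelt) module" where "B \<equiv> opposite A"
abbreviation J :: "'e set" where "J \<equiv> arrows_into Q k"
abbreviation Pk :: "(('k, 'v, 'e) bqelt, ('k, 'v, 'e) bqelt) module" where "Pk \<equiv> proj_at Q I k"
abbreviation D :: "(('k, 'v, 'e) bqelt, 'e \<Rightarrow> ('k, 'v, 'e) bqelt) module" where
  "D \<equiv> dsum J (\<lambda>\<alpha>. proj_at Q I (tail Q \<alpha>))"

text \<open>The differential of L_k, written for arguments in all of A instead of P_k: the same
  formula serves on the regular module to map A into the degree 0 term.\<close>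

definition f :: "('k, 'v, 'e) bqelt \<Rightarrow> 'e \<Rightarrow> ('k, 'v, 'e) bqelt" where
  "f x = (\<lambda>\<alpha>\<in>J. ar \<alpha> \<otimes>\<^bsub>A\<^esub> x)"

text \<open>Left modules are right modules over \<open>B\<close>; \<open>L0\<close> is $Ae_k$ and \<open>L1\<close> covers its radical.\<close>

abbreviation L0 :: "(('k, 'v, 'e) bqelt, ('k, 'v, 'e) bqelt) module" where "L0 \<equiv> cyc_proj B (ve k)"
abbreviation L1 :: "(('k, 'v, 'e) bqelt, 'e \<Rightarrow> ('k, 'v, 'e) bqelt) module" where
  "L1 \<equiv> dsum J (\<lambda>\<alpha>. cyc_proj B (ve (tail Q \<alpha>)))"

sublocale B: kalgebra B by (rule opp_kalgebra)

lemma J_arc: "\<alpha> \<in> J \<Longrightarrow> \<alpha> \<in> arcs Q" "\<alpha> \<in> J \<Longrightarrow> head Q \<alpha> = k" "\<alpha> \<in> J \<Longrightarrow> tail Q \<alpha> \<in> verts Q"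
  by (auto simp: arrows_into_def)

lemma finite_J: "finite J" by (simp add: arrows_into_def)

definition arrow_list :: "'e list" where "arrow_list = (SOME as. set as = J \<and> distinct as)"

lemma arrow_list: "set arrow_list = J" "distinct arrow_list"
proof -
  have "\<exists>as. set as = J \<and> distinct as" using finite_distinct_list[OF finite_J] by blast
  from someI_ex[OF this] show "set arrow_list = J" "distinct arrow_list" by (auto simp:
    arrow_list_def)
qed

lemma Pk_rm: "right_module A Pk" unfolding proj_at_eq by (rule idem.cyc_proj_right_module[OF
  A_idem[OF k]])
lemma D_rm: "right_module A D"
  by (rule dsum_right_module[OF A.ring_axioms])
    (simp add: proj_at_eq idem.cyc_proj_right_module[OF A_idem[OF J_arc(3)]])
lemma L0_rm: "right_module B L0" by (rule idem.cyc_proj_right_module[OF opp_idem[OF k]])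
lemma L1_rm: "right_module B L1"
  by (rule dsum_right_module[OF B.ring_axioms]) (rule idem.cyc_proj_right_module[OF opp_idem[OF
    J_arc(3)]])

lemma fd_D: "fd_module A D"
  by (rule A.fd_dsum[OF finite_J]) (simp add: proj_at_eq A.fd_cyc_proj[OF fd_regular A_idem[OF
    J_arc(3)]])
lemma fd_L0: "fd_module B L0" by (rule B.fd_cyc_proj[OF fd_regular_opposite opp_idem[OF k]])
lemma fd_L1: "fd_module B L1"
  by (rule B.fd_dsum[OF finite_J]) (rule B.fd_cyc_proj[OF fd_regular_opposite opp_idem[OF
    J_arc(3)]])

lemma Pk_iff: "x \<in> carrier Pk \<longleftrightarrow> x \<in> carrier A \<and> ve k \<otimes>\<^bsub>A\<^esub> x = x" by (rule proj_at_iff[OF k])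

lemma D_iff: "y \<in> carrier D \<longleftrightarrow> y \<in> extensional J \<and> (\<forall>\<alpha>\<in>J. y \<alpha> \<in> carrier A \<and> ve (tail Q \<alpha>) \<otimes>\<^bsub>A\<^esub> y \<alpha>
  = y \<alpha>)"
  by (auto simp: dsum_simps PiE_iff proj_at_iff[OF J_arc(3)])

lemma L0_iff: "x \<in> carrier L0 \<longleftrightarrow> x \<in> carrier A \<and> x \<otimes>\<^bsub>A\<^esub> ve k = x"
  by (simp add: idem.cyc_proj_iff[OF opp_idem[OF k]])

lemma L1_iff: "y \<in> carrier L1 \<longleftrightarrow> y \<in> extensional J \<and> (\<forall>\<alpha>\<in>J. y \<alpha> \<in> carrier A \<and> y \<alpha> \<otimes>\<^bsub>A\<^esub> ve (tail Q
  \<alpha>) = y \<alpha>)"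
  by (auto simp: dsum_simps PiE_iff idem.cyc_proj_iff[OF opp_idem[OF J_arc(3)]])

lemma proj_at_ops: "add (proj_at Q I i) = add A" "zero (proj_at Q I i) = \<zero>\<^bsub>A\<^esub>" "smult (proj_at Q I
  i) = (\<lambda>a x. x \<otimes>\<^bsub>A\<^esub> a)"
  by (simp_all add: proj_at_eq cyc_proj_simps)

lemma f_extends: "mod_hom A (regular A) D f"
proof (rule mod_homI)
  fix x assume "x \<in> carrier (regular A)"
  then show "f x \<in> carrier D"
    using J_arc by (auto simp: D_iff f_def A.m_assoc[symmetric] ve_ar)
next
  fix x y assume "x \<in> carrier (regular A)" "y \<in> carrier (regular A)"
  then show "f (x \<oplus>\<^bsub>regular A\<^esub> y) = f x \<oplus>\<^bsub>D\<^esub> f y"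
    using J_arc(1) unfolding f_def dsum_simps by (intro restrict_ext) (simp add: proj_at_ops
      A.r_distr)
next
  fix a x assume "a \<in> carrier A" "x \<in> carrier (regular A)"
  then show "f (a \<odot>\<^bsub>regular A\<^esub> x) = a \<odot>\<^bsub>D\<^esub> f x"
    using J_arc(1) unfolding f_def dsum_simps by (intro restrict_ext) (simp add: proj_at_ops
      A.m_assoc)
qed

lemma Pk_incl: "mod_hom A Pk (regular A) (\<lambda>x. x)"
  unfolding proj_at_eq by (rule idem.cyc_proj_incl[OF A_idem[OF k]])

lemma f_hom: "mod_hom A Pk D f"
  using mod_hom_comp[OF Pk_incl f_extends] by simp

text \<open>The values lie in A e_k, and the image is the radical of that module, by
  \<open>vc_rad_cover\<close> and \<open>rad_cover_onto\<close>. The sum runs over a fixed list of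
  the arrows into k because \<open>msum\<close> takes lists.\<close>

definition rad_cover :: "('e \<Rightarrow> ('k, 'v, 'e) bqelt) \<Rightarrow> ('k, 'v, 'e) bqelt" where
  "rad_cover y = msum (regular A) (map (\<lambda>\<alpha>. y \<alpha> \<otimes>\<^bsub>A\<^esub> ar \<alpha>) arrow_list)"

lemma msum_L0: "msum L0 = msum (regular A)"
  by (simp add: msum_def fun_eq_iff cyc_proj_simps)

lemma rad_cover_hom: "mod_hom B L1 L0 rad_cover"
proof -
  have "mod_hom B L1 L0 (\<lambda>y. msum L0 (map (\<lambda>\<alpha>. y \<alpha> \<otimes>\<^bsub>A\<^esub> ar \<alpha>) arrow_list))"
  proof (rule mod_hom_sum[OF L0_rm])
    fix \<alpha> assume "\<alpha> \<in> set arrow_list"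
    then have a: "\<alpha> \<in> J" using arrow_list by simp
    note aa = J_arc[OF a]
    show "mod_hom B L1 L0 (\<lambda>y. y \<alpha> \<otimes>\<^bsub>A\<^esub> ar \<alpha>)"
    proof (rule mod_homI)
      fix y assume "y \<in> carrier L1"
      then show "y \<alpha> \<otimes>\<^bsub>A\<^esub> ar \<alpha> \<in> carrier L0"
        using a aa k by (simp add: L1_iff L0_iff A.m_assoc ar_ve)
    next
      fix y z assume "y \<in> carrier L1" "z \<in> carrier L1"
      then show "(y \<oplus>\<^bsub>L1\<^esub> z) \<alpha> \<otimes>\<^bsub>A\<^esub> ar \<alpha> = y \<alpha> \<otimes>\<^bsub>A\<^esub> ar \<alpha> \<oplus>\<^bsub>L0\<^esub> z \<alpha> \<otimes>\<^bsub>A\<^esub> ar \<alpha>"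
        using a aa unfolding L1_iff by (simp add: dsum_simps cyc_proj_simps A.l_distr)
    next
      fix b y assume "b \<in> carrier B" "y \<in> carrier L1"
      then show "(b \<odot>\<^bsub>L1\<^esub> y) \<alpha> \<otimes>\<^bsub>A\<^esub> ar \<alpha> = b \<odot>\<^bsub>L0\<^esub> (y \<alpha> \<otimes>\<^bsub>A\<^esub> ar \<alpha>)"
        using a aa unfolding L1_iff by (simp add: dsum_simps cyc_proj_simps A.m_assoc)
    qed
  qed
  then show ?thesis by (simp add: rad_cover_def[abs_def] msum_L0)
qed

lemma vc_msum: "set xs \<subseteq> carrier A \<Longrightarrow> vc i (msum (regular A) xs) = sum_list (map (vc i) xs)"
proof (induction xs)
  case (Cons x xs)
  interpret R: right_module A "regular A" by (rule regular_right_module[OF A.ring_axioms])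
  have "msum (regular A) xs \<in> carrier A" using R.msum_closed[of xs] Cons.prems by simp
  then show ?case using Cons by (simp add: vc_add)
qed (simp add: vc_zero)

lemma ac_msum: "set xs \<subseteq> carrier A \<Longrightarrow> ac \<alpha> (msum (regular A) xs) = sum_list (map (ac \<alpha>) xs)"
proof (induction xs)
  case (Cons x xs)
  interpret R: right_module A "regular A" by (rule regular_right_module[OF A.ring_axioms])
  have "msum (regular A) xs \<in> carrier A" using R.msum_closed[of xs] Cons.prems by simp
  then show ?case using Cons by (simp add: ac_add)
qed (simp add: ac_zero)

lemma rad_cover_terms: "y \<in> carrier L1 \<Longrightarrow> set (map (\<lambda>\<alpha>. y \<alpha> \<otimes>\<^bsub>A\<^esub> ar \<alpha>) arrow_list) \<subseteq> carrier A"
  using J_arc arrow_list by (auto simp: L1_iff)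

lemma vc_rad_cover:
  assumes y: "y \<in> carrier L1" shows "vc k (rad_cover y) = 0"
proof -
  have "vc k (y \<alpha> \<otimes>\<^bsub>A\<^esub> ar \<alpha>) = 0" if "\<alpha> \<in> J" for \<alpha>
    using y that J_arc[OF that] by (simp add: L1_iff vc_mult[OF k] vc_ar)
  then have "map (vc k) (map (\<lambda>\<alpha>. y \<alpha> \<otimes>\<^bsub>A\<^esub> ar \<alpha>) arrow_list) = map (\<lambda>_. 0) arrow_list" using
    arrow_list by simp
  then show ?thesis unfolding rad_cover_def vc_msum[OF rad_cover_terms[OF y]] by (simp only:
    sum_list_0)
qed

text \<open>Multiplication by e_j on the right annihilates the coefficient at every other vertex, so
  for an element of A e_j a single coefficient decides membership in the radical.\<close>

lemma right_idem_vc: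
  assumes "x \<in> carrier A" "j \<in> verts Q" "x \<otimes>\<^bsub>A\<^esub> ve j = x" "vc j x = 0"
  shows "x \<in> filt 1"
  unfolding filt_1_iff
proof (intro conjI ballI assms(1))
  fix i assume i: "i \<in> verts Q"
  have "vc i x = vc i (x \<otimes>\<^bsub>A\<^esub> ve j)" using assms by simp
  also have "\<dots> = vc i x * (if j = i then 1 else 0)"
    unfolding vc_mult[OF i assms(1) ve_closed[OF assms(2)]] vc_ve[OF assms(2)] ..
  finally show "vc i x = 0" using assms(4) by (cases "j = i") auto
qed

text \<open>The coefficient of \<alpha> in the sum of the y_\<beta> \<beta> is the coefficient of
  y_\<alpha> at s(\<alpha>). Relations contain no path of length one, so it is well defined and
  vanishes with the sum. This is what makes the presentation of D S_k minimal at its first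
  term.\<close>

lemma rad_cover_ker:
  assumes y: "y \<in> carrier L1" and 0: "rad_cover y = \<zero>\<^bsub>A\<^esub>" and a: "\<alpha> \<in> J"
  shows "y \<alpha> \<in> filt 1"
proof -
  have yb: "y \<beta> \<in> carrier A" if "\<beta> \<in> J" for \<beta> using y that by (simp add: L1_iff)
  have "0 = ac \<alpha> (rad_cover y)" using 0 by (simp add: ac_zero)
  also have "\<dots> = sum_list (map (ac \<alpha>) (map (\<lambda>\<beta>. y \<beta> \<otimes>\<^bsub>A\<^esub> ar \<beta>) arrow_list))"
    unfolding rad_cover_def by (rule ac_msum[OF rad_cover_terms[OF y]])
  also have "map (ac \<alpha>) (map (\<lambda>\<beta>. y \<beta> \<otimes>\<^bsub>A\<^esub> ar \<beta>) arrow_list) = map (\<lambda>\<beta>. if \<beta> = \<alpha> then vc (tail Q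
    \<alpha>) (y \<alpha>) else 0) arrow_list"
    using arrow_list J_arc yb J_arc(1)[OF a] by (auto simp: ac_mult ac_ar vc_ar)
  also have "sum_list \<dots> = vc (tail Q \<alpha>) (y \<alpha>)"
    using arrow_list a by (simp add: sum_list_distinct_conv_sum_set finite_J)
  finally have "vc (tail Q \<alpha>) (y \<alpha>) = 0" by simp
  then show ?thesis using y a J_arc[OF a] by (intro right_idem_vc[of _ "tail Q \<alpha>"]) (auto simp:
    L1_iff)
qed

text \<open>An element of A e_k without a multiple of e_k lies in the radical, hence is a sum of
  w_\<beta> \<beta> over all arrows. Right multiplication by e_k removes the arrows not ending at k,
  and w_\<alpha> can be replaced by w_\<alpha> e_{s(\<alpha>)}, which lies in the \<alpha>-th
  summand of \<open>L1\<close>.\<close>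

lemma rad_cover_onto:
  assumes y: "y \<in> carrier L0" and 0: "vc k y = 0"
  shows "\<exists>x\<in>carrier L1. rad_cover x = y"
proof -
  interpret R: right_module A "regular A" by (rule regular_right_module[OF A.ring_axioms])
  have yA: "y \<in> carrier A" "y \<otimes>\<^bsub>A\<^esub> ve k = y" using y by (auto simp: L0_iff)
  have F: "y \<in> filt 1" by (rule right_idem_vc[OF yA(1) k yA(2) 0])
  obtain rs where rs: "set rs = arcs Q - J" "distinct rs" using finite_distinct_list[of "arcs Q -
    J"] by auto
  have bs: "set (arrow_list @ rs) = arcs Q" "distinct (arrow_list @ rs)" using arrow_list rs
    J_arc(1) by auto
  obtain w where w: "\<forall>\<beta>\<in>arcs Q. w \<beta> \<in> carrier A" "y = msum (regular A) (map (\<lambda>\<beta>. w \<beta> \<otimes>\<^bsub>A\<^esub> ar \<beta>)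
    (arrow_list @ rs))"
    using filt_1_right_decomp[OF F bs] by blast
  define x where "x = (\<lambda>\<alpha>\<in>J. w \<alpha> \<otimes>\<^bsub>A\<^esub> ve (tail Q \<alpha>))"
  have x: "x \<in> carrier L1" using w J_arc by (auto simp: L1_iff x_def A.m_assoc ve_mult)
  have "w \<beta> \<otimes>\<^bsub>A\<^esub> ar \<beta> \<in> carrier A" if "\<beta> \<in> set (arrow_list @ rs)" for \<beta>
    using w(1) that unfolding bs(1) by simp
  then have cl: "set (map (\<lambda>\<beta>. w \<beta> \<otimes>\<^bsub>A\<^esub> ar \<beta>) (arrow_list @ rs)) \<subseteq> carrier (regular B)" by auto
  have "y = y \<otimes>\<^bsub>A\<^esub> ve k" using yA by simp
  also have "\<dots> = msum (regular A) (map (\<lambda>z. z \<otimes>\<^bsub>A\<^esub> ve k) (map (\<lambda>\<beta>. w \<beta> \<otimes>\<^bsub>A\<^esub> ar \<beta>) (arrow_list @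
    rs)))"
    unfolding w(2) using mod_hom_msum[OF right_mult_hom[OF ve_closed[OF k]]
      regular_right_module[OF B.ring_axioms] regular_right_module[OF B.ring_axioms] cl]
    by (simp only: msum_regular_opposite)
  also have "map (\<lambda>z. z \<otimes>\<^bsub>A\<^esub> ve k) (map (\<lambda>\<beta>. w \<beta> \<otimes>\<^bsub>A\<^esub> ar \<beta>) (arrow_list @ rs)) = map (\<lambda>\<alpha>. x \<alpha> \<otimes>\<^bsub>A\<^esub>
    ar \<alpha>) arrow_list @ map (\<lambda>_. \<zero>\<^bsub>A\<^esub>) rs"
  proof -
    have 1: "(w \<beta> \<otimes>\<^bsub>A\<^esub> ar \<beta>) \<otimes>\<^bsub>A\<^esub> ve k = x \<beta> \<otimes>\<^bsub>A\<^esub> ar \<beta>" if "\<beta> \<in> J" for \<beta>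
      using w that J_arc[OF that] k by (simp add: x_def A.m_assoc ar_ve ve_ar)
    have 2: "(w \<beta> \<otimes>\<^bsub>A\<^esub> ar \<beta>) \<otimes>\<^bsub>A\<^esub> ve k = \<zero>\<^bsub>A\<^esub>" if b: "\<beta> \<in> arcs Q - J" for \<beta>
    proof -
      have "k \<noteq> head Q \<beta>" using b by (auto simp: arrows_into_def)
      then show ?thesis using w b k by (simp add: A.m_assoc ar_ve)
    qed
    show ?thesis using 1 2 arrow_list rs by simp
  qed
  also have "msum (regular A) \<dots> = rad_cover x \<oplus>\<^bsub>regular A\<^esub> msum (regular A) (map (\<lambda>_. \<zero>\<^bsub>A\<^esub>) rs)"
    unfolding rad_cover_def by (rule R.msum_append) (use rad_cover_terms[OF x] in auto)
  also have "msum (regular A) (map (\<lambda>_. \<zero>\<^bsub>A\<^esub>) rs) = \<zero>\<^bsub>regular A\<^esub>" by (rule R.msum_zero) auto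
  also have "rad_cover x \<oplus>\<^bsub>regular A\<^esub> \<zero>\<^bsub>regular A\<^esub> = rad_cover x"
    using R.msum_closed[of "map (\<lambda>\<alpha>. x \<alpha> \<otimes>\<^bsub>A\<^esub> ar \<alpha>) arrow_list"] rad_cover_terms[OF x] by (simp
      add: rad_cover_def)
  finally show ?thesis using x by blast
qed

lemma superfluous_A:
  assumes "right_module A P" "dual_basis A P S" "submodule L A P"
    and "\<And>x m \<phi>. x \<in> K \<Longrightarrow> (m, \<phi>) \<in> set S \<Longrightarrow> \<phi> x \<in> filt 1" "K \<subseteq> carrier P"
    and "carrier P \<subseteq> {x \<oplus>\<^bsub>P\<^esub> y | x y. x \<in> K \<and> y \<in> L}"
  shows "L = carrier P"
proof -
  obtain m where m: "filt m = {\<zero>\<^bsub>A\<^esub>}" using filt_nilpotent by blast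
  show ?thesis
  proof (rule superfluous[where F = filt and n = m and K = K and P = P and S = S and L = L and R =
    A])
    show "a \<otimes>\<^bsub>A\<^esub> b \<in> filt (Suc i)" if "a \<in> filt 1" "b \<in> filt i" for a b i
      using filt_mult[OF that] by simp
  qed (fact assms | simp add: m filt_0 filt_subset filt_add filt_zero)+
qed

text \<open>Products in the opposite algebra are reversed, which the filtration tolerates because it
  is multiplicative in both orders.\<close>

lemma superfluous_B:
  assumes "right_module B P" "dual_basis B P S" "submodule L B P"
    and "\<And>x m \<phi>. x \<in> K \<Longrightarrow> (m, \<phi>) \<in> set S \<Longrightarrow> \<phi> x \<in> filt 1" "K \<subseteq> carrier P"
    and "carrier P \<subseteq> {x \<oplus>\<^bsub>P\<^esub> y | x y. x \<in> K \<and> y \<in> L}"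
  shows "L = carrier P"
proof -
  obtain m where m: "filt m = {\<zero>\<^bsub>A\<^esub>}" using filt_nilpotent by blast
  show ?thesis
  proof (rule superfluous[where F = filt and n = m and K = K and P = P and S = S and L = L and R =
    B])
    show "a \<otimes>\<^bsub>B\<^esub> b \<in> filt (Suc i)" if "a \<in> filt 1" "b \<in> filt i" for a b i
      using filt_mult[OF that(2,1)] by simp
  qed (fact assms | simp add: m filt_0 filt_subset filt_add filt_zero)+
qed

lemma proj_cover_B:
  assumes P: "fd_module B P" and S: "dual_basis B P S" and p: "mod_surj B P M p"
    and K: "\<And>x m \<phi>. x \<in> carrier P \<Longrightarrow> p x = \<zero>\<^bsub>M\<^esub> \<Longrightarrow> (m, \<phi>) \<in> set S \<Longrightarrow> \<phi> x \<in> filt 1"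
  shows "proj_cover B P p M"
  unfolding proj_cover_def
proof (intro conjI p dual_basis_projective[OF S P] allI impI)
  fix L assume L: "submodule L B P \<and> carrier P = {x \<oplus>\<^bsub>P\<^esub> y | x y. x \<in> ker P M p \<and> y \<in> L}"
  show "L = carrier P"
  proof (rule superfluous_B[OF fd_moduleD[OF P] S])
    show "submodule L B P" "carrier P \<subseteq> {x \<oplus>\<^bsub>P\<^esub> y | x y. x \<in> ker P M p \<and> y \<in> L}" using L by
      (blast, simp)
    show "ker P M p \<subseteq> carrier P" by (auto simp: ker_def)
    show "\<phi> x \<in> filt 1" if "x \<in> ker P M p" "(m, \<phi>) \<in> set S" for x m \<phi>
      using K[OF _ _ that(2)] that(1) by (simp add: ker_def)
  qed
qed

section \<open>The dual of S_k and its minimal presentation by left projectives\<close>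

abbreviation DS :: "(('k, 'v, 'e) bqelt, 'k \<Rightarrow> 'k) module" where "DS \<equiv> dual A (simple_at k)"

lemma DS_simps:
  "carrier DS = range (\<lambda>c x. x * c)" "zero DS = (\<lambda>x. 0)"
  "\<phi> \<oplus>\<^bsub>DS\<^esub> \<psi> = (\<lambda>x. \<phi> x + \<psi> x)" "a \<odot>\<^bsub>DS\<^esub> \<phi> = (\<lambda>x. \<phi> (x * vc k a))"
proof -
  have sc: "scal A (simple_at k) c x = x * c" for c x
    by (simp add: scal_def simple_at_simps vc_scalar[OF k])
  show "carrier DS = range (\<lambda>c x. x * c)"
  proof
    show "carrier DS \<subseteq> range (\<lambda>c x. x * c)"
    proof
      fix \<phi> assume "\<phi> \<in> carrier DS"
      then have *: "\<forall>c x. \<phi> (x * c) = c * \<phi> x" by (simp add: dual_def simple_at_simps sc)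
      have "\<phi> = (\<lambda>x. x * \<phi> 1)"
      proof
        show "\<phi> c = c * \<phi> 1" for c using *[rule_format, of 1 c] by simp
      qed
      then show "\<phi> \<in> range (\<lambda>c x. x * c)" by blast
    qed
  qed (auto simp: dual_def simple_at_simps sc distrib_right)
qed (simp_all add: dual_def simple_at_simps restrict_def)

text \<open>Elements of D S_k are multiplications by scalars, and y gives the one by its coefficient
  at e_k. This is the projection of A e_k onto its top.\<close>

definition dual_cover :: "('k, 'v, 'e) bqelt \<Rightarrow> 'k \<Rightarrow> 'k" where "dual_cover y = (\<lambda>x. x * vc k y)"

lemma dual_cover_surj: "mod_surj B L0 DS dual_cover"
  unfolding mod_surj_def
proof (intro conjI mod_homI)
  fix y z assume "y \<in> carrier L0" "z \<in> carrier L0"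
  then show "dual_cover (y \<oplus>\<^bsub>L0\<^esub> z) = dual_cover y \<oplus>\<^bsub>DS\<^esub> dual_cover z"
    unfolding L0_iff by (simp add: cyc_proj_simps(2-4) DS_simps dual_cover_def vc_add distrib_left)
next
  fix a y assume "a \<in> carrier B" "y \<in> carrier L0"
  then show "dual_cover (a \<odot>\<^bsub>L0\<^esub> y) = a \<odot>\<^bsub>DS\<^esub> dual_cover y"
    unfolding L0_iff by (simp add: cyc_proj_simps(2-4) DS_simps dual_cover_def vc_mult[OF k]
      mult.assoc)
next
  show "dual_cover ` carrier L0 = carrier DS"
  proof
    show "dual_cover ` carrier L0 \<subseteq> carrier DS" by (auto simp: DS_simps dual_cover_def)
    show "carrier DS \<subseteq> dual_cover ` carrier L0"
    proof
      fix \<phi> assume "\<phi> \<in> carrier DS"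
      then obtain c where c: "\<phi> = (\<lambda>x. x * c)" by (auto simp: DS_simps)
      let ?y = "(c \<odot>\<^bsub>A\<^esub> \<one>\<^bsub>A\<^esub>) \<otimes>\<^bsub>A\<^esub> ve k"
      have "?y \<in> carrier L0" using k by (simp add: L0_iff A.m_assoc ve_mult)
      moreover have "dual_cover ?y = \<phi>" using k by (simp add: dual_cover_def c vc_mult vc_scalar
        vc_ve)
      ultimately show "\<phi> \<in> dual_cover ` carrier L0" by blast
    qed
  qed
qed (auto simp: DS_simps dual_cover_def)

text \<open>The generator of the \<alpha>-th summand. It serves \<open>L1\<close> as well as
  \<open>D\<close>, since e_{s(\<alpha>)} lies both in A e_{s(\<alpha>)} and in e_{s(\<alpha>)}
  A.\<close>

definition eps :: "'e \<Rightarrow> 'e \<Rightarrow> ('k, 'v, 'e) bqelt" where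
  "eps \<alpha> = (\<lambda>i\<in>J. if i = \<alpha> then ve (tail Q \<alpha>) else \<zero>\<^bsub>A\<^esub>)"

lemma L0_basis: "dual_basis B L0 [(ve k, \<lambda>x. x)]"
  by (rule idem.dual_basis_cyc_proj[OF opp_idem[OF k]])

lemma L1_basis: "dual_basis B L1 (map (\<lambda>\<alpha>. (eps \<alpha>, \<lambda>x. x \<alpha>)) arrow_list)"
  using dual_basis_dsum_cyc[where e = "\<lambda>\<alpha>. ve (tail Q \<alpha>)", OF B.ring_axioms opp_idem[OF J_arc(3)]
    arrow_list, unfolded opposite_simps(3)]
  unfolding eps_def .

lemma eps_L1: "\<alpha> \<in> J \<Longrightarrow> eps \<alpha> \<in> carrier L1"
  using J_arc by (auto simp: L1_iff eps_def ve_mult)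

lemma sum_eps:
  assumes a: "\<alpha> \<in> J" and z: "\<And>\<beta>. \<beta> \<in> J \<Longrightarrow> z \<beta> \<in> carrier A"
    "\<And>\<beta>. \<beta> \<in> J \<Longrightarrow> ve (tail Q \<beta>) \<otimes>\<^bsub>A\<^esub> z \<beta> = z \<beta>"
  shows "msum (regular A) (map (\<lambda>\<beta>. eps \<alpha> \<beta> \<otimes>\<^bsub>A\<^esub> z \<beta>) arrow_list) = z \<alpha>"
proof -
  interpret R: right_module A "regular A" by (rule regular_right_module[OF A.ring_axioms])
  have "map (\<lambda>\<beta>. eps \<alpha> \<beta> \<otimes>\<^bsub>A\<^esub> z \<beta>) arrow_list = map (\<lambda>\<beta>. if \<beta> = \<alpha> then z \<alpha> else \<zero>\<^bsub>regular A\<^esub>)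
    arrow_list"
    using z arrow_list a by (auto simp: eps_def)
  then have "msum (regular A) (map (\<lambda>\<beta>. eps \<alpha> \<beta> \<otimes>\<^bsub>A\<^esub> z \<beta>) arrow_list) = msum (regular A) (map (\<lambda>\<beta>.
    if \<beta> = \<alpha> then z \<alpha> else \<zero>\<^bsub>regular A\<^esub>) arrow_list)"
    by (rule arg_cong)
  also have "\<dots> = z \<alpha>" by (rule R.msum_single[OF arrow_list(2)]) (use arrow_list a z in simp_all)
  finally show ?thesis .
qed

lemma rad_cover_eps: "\<alpha> \<in> J \<Longrightarrow> rad_cover (eps \<alpha>) = ar \<alpha>"
  unfolding rad_cover_def by (rule sum_eps) (simp_all add: J_arc ve_ar)

lemma regular_B_rm: "right_module B (regular B)"
  by (rule regular_right_module[OF B.ring_axioms])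

text \<open>
  Applying $\operatorname{Hom}(-, A)$ to the minimal projective presentation of $D S_k$ and evaluating at the
  generators gives back the map \<open>f\<close>.
\<close>

lemma is_tau_inv_coker:
  assumes N: "fd_module A N" and \<pi>: "mod_surj A D N \<pi>" and k\<pi>: "ker D N \<pi> = f ` carrier Pk"
  shows "is_tau_inv A (simple_at k) N"
proof -
  \<comment> \<open>\<open>is_transpose\<close> asks for a presentation by modules on lists of
    scalars, so \<open>L0\<close> and \<open>L1\<close> are replaced by models; the maps h and g are
    mutually inverse and carry the computations back.\<close>
  obtain P0 :: "(('k, 'v, 'e) bqelt, 'k univ) module" and h0 g0 where P0: "fd_module B P0"
    "mod_hom B L0 P0 h0" "mod_hom B P0 L0 g0"
    "\<And>x. x \<in> carrier L0 \<Longrightarrow> g0 (h0 x) = x" "\<And>x. x \<in> carrier P0 \<Longrightarrow> h0 (g0 x) = x"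
    using B.univ_model_maps[OF fd_L0] by blast
  obtain P1 :: "(('k, 'v, 'e) bqelt, 'k univ) module" and h1 g1 where P1: "fd_module B P1"
    "mod_hom B L1 P1 h1" "mod_hom B P1 L1 g1"
    "\<And>x. x \<in> carrier L1 \<Longrightarrow> g1 (h1 x) = x" "\<And>x. x \<in> carrier P1 \<Longrightarrow> h1 (g1 x) = x"
    using B.univ_model_maps[OF fd_L1] by blast
  note rP0 = fd_moduleD[OF P0(1)] and rP1 = fd_moduleD[OF P1(1)]
  have b0: "dual_basis B P0 [(h0 (ve k), g0)]"
    using dual_basis_iso[OF L0_basis L0_rm rP0 P0(2,3,5)] by simp
  have b1: "dual_basis B P1 (map (\<lambda>\<alpha>. (h1 (eps \<alpha>), \<lambda>y. g1 y \<alpha>)) arrow_list)"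
    using dual_basis_iso[where i = h1 and j = g1, OF L1_basis L1_rm rP1 P1(2,3,5)] by (simp add:
      comp_def)
  have vkL: "ve k \<in> carrier L0" using k by (simp add: L0_iff ve_mult)
  have g0L: "g0 x \<in> carrier A" "g0 x \<otimes>\<^bsub>A\<^esub> ve k = g0 x" if "x \<in> carrier P0" for x
    using mod_homD(1)[OF P0(3) that] by (auto simp: L0_iff)
  have zL0: "\<zero>\<^bsub>L0\<^esub> = \<zero>\<^bsub>A\<^esub>" by (simp add: cyc_proj_simps)
  define q where "q x = dual_cover (g0 x)" for x
  have "mod_surj B P0 L0 g0"
    unfolding mod_surj_def
  proof (intro conjI P0(3) equalityI subsetI)
    show "y \<in> carrier L0" if "y \<in> g0 ` carrier P0" for y using that mod_homD(1)[OF P0(3)] by blast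
    show "x \<in> g0 ` carrier P0" if "x \<in> carrier L0" for x
      by (rule image_eqI[where x = "h0 x"]) (simp_all only: P0(4)[OF that] mod_homD(1)[OF P0(2)
        that])
  qed
  then have qs: "mod_surj B P0 DS q" unfolding q_def by (rule mod_surj_comp[OF _ dual_cover_surj])
  have qz: "q x = \<zero>\<^bsub>DS\<^esub> \<longleftrightarrow> vc k (g0 x) = 0" for x
    by (auto simp: q_def dual_cover_def DS_simps fun_eq_iff dest: spec[of _ 1])
  have cover0: "proj_cover B P0 q DS"
  proof (rule proj_cover_B[OF P0(1) b0 qs])
    fix x m \<phi> assume x: "x \<in> carrier P0" "q x = \<zero>\<^bsub>DS\<^esub>" and "(m, \<phi>) \<in> set [(h0 (ve k), g0)]"
    then have "\<phi> = g0" by simp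
    then show "\<phi> x \<in> filt 1" using right_idem_vc[OF g0L(1)[OF x(1)] k g0L(2)[OF x(1)]] x(2) qz by
      blast
  qed
  let ?K = "P0\<lparr>carrier := ker P0 DS q\<rparr>"
  define p where "p x = h0 (rad_cover (g1 x))" for x
  have pmL: "rad_cover (g1 x) \<in> carrier L0" "vc k (rad_cover (g1 x)) = 0" if "x \<in> carrier P1" for x
    using mod_homD(1)[OF rad_cover_hom mod_homD(1)[OF P1(3) that]] vc_rad_cover[OF mod_homD(1)[OF
      P1(3) that]] by auto
  have ph: "mod_hom B P1 P0 p" unfolding p_def by (rule mod_hom_comp[OF mod_hom_comp[OF P1(3)
    rad_cover_hom] P0(2)])
  have pk: "p x \<in> ker P0 DS q" if "x \<in> carrier P1" for x
    using mod_homD(1)[OF ph that] pmL[OF that] P0(4) by (simp add: ker_def qz p_def)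
  have ps: "mod_surj B P1 ?K p"
    unfolding mod_surj_def
  proof (intro conjI equalityI subsetI)
    show "mod_hom B P1 ?K p" using ph pk by (simp add: mod_hom_def Pi_iff)
    show "y \<in> carrier ?K" if "y \<in> p ` carrier P1" for y using that pk by auto
    fix y assume "y \<in> carrier ?K"
    then have y: "y \<in> carrier P0" "vc k (g0 y) = 0" by (auto simp: ker_def qz)
    obtain x where x: "x \<in> carrier L1" "rad_cover x = g0 y" using rad_cover_onto[OF mod_homD(1)[OF
      P0(3) y(1)] y(2)] by blast
    then have "p (h1 x) = y" using P1(4) P0(5) y by (simp add: p_def)
    then show "y \<in> p ` carrier P1" using mod_homD(1)[OF P1(2) x(1)] by blast
  qed
  have cover1: "proj_cover B P1 p ?K"
  proof (rule proj_cover_B[OF P1(1) b1 ps])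
    fix x m \<phi> assume x: "x \<in> carrier P1" "p x = \<zero>\<^bsub>?K\<^esub>" and "(m, \<phi>) \<in> set (map (\<lambda>\<alpha>. (h1 (eps \<alpha>),
      \<lambda>y. g1 y \<alpha>)) arrow_list)"
    then obtain \<alpha> where a: "\<alpha> \<in> J" "\<phi> = (\<lambda>y. g1 y \<alpha>)" using arrow_list by auto
    have "rad_cover (g1 x) = g0 (p x)" using pmL[OF x(1)] P0(4) by (simp add: p_def)
    also have "\<dots> = \<zero>\<^bsub>A\<^esub>" using x(2) mod_hom_zero[OF P0(3) rP0 L0_rm] by (simp add: zL0)
    finally show "\<phi> x \<in> filt 1" unfolding a(2) by (rule rad_cover_ker[OF mod_homD(1)[OF P1(3)
      x(1)] _ a(1)])
  qed
  \<comment> \<open>A homomorphism out of P1 is determined by its values on the generators, and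
    linearity forces the value at the \<alpha>-th generator into e_{s(\<alpha>)} A. Evaluation
    therefore identifies Hom(P1, A) with the degree 0 term of L_k, compatibly with the right action
    of A.\<close>
  define ev where "ev \<phi> = (\<lambda>\<alpha>\<in>J. \<phi> (h1 (eps \<alpha>)))" for \<phi> :: "'k univ \<Rightarrow> ('k, 'v, 'e) bqelt"
  have h1P: "h1 (eps \<alpha>) \<in> carrier P1" if "\<alpha> \<in> J" for \<alpha> using mod_homD(1)[OF P1(2) eps_L1[OF that]] .
  have evD: "ev \<phi> \<in> carrier D" if \<phi>: "mod_hom B P1 (regular B) \<phi>" for \<phi>
    unfolding D_iff
  proof (intro conjI ballI)
    show "ev \<phi> \<in> extensional J" by (simp add: ev_def)
    fix \<alpha> assume a: "\<alpha> \<in> J"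
    note aa = J_arc[OF a]
    show "ev \<phi> \<alpha> \<in> carrier A" using mod_homD(1)[OF \<phi> h1P[OF a]] a by (simp add: ev_def)
    have "ve (tail Q \<alpha>) \<odot>\<^bsub>L1\<^esub> eps \<alpha> = eps \<alpha>"
      using aa unfolding eps_def dsum_simps cyc_proj_simps by (intro restrict_ext) (auto simp:
        ve_mult)
    then have "h1 (eps \<alpha>) = ve (tail Q \<alpha>) \<odot>\<^bsub>P1\<^esub> h1 (eps \<alpha>)"
      using mod_homD(3)[OF P1(2) _ eps_L1[OF a], of "ve (tail Q \<alpha>)"] aa by simp
    then have "\<phi> (h1 (eps \<alpha>)) = ve (tail Q \<alpha>) \<odot>\<^bsub>regular B\<^esub> \<phi> (h1 (eps \<alpha>))"
      using mod_homD(3)[OF \<phi> _ h1P[OF a], of "ve (tail Q \<alpha>)"] aa by simp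
    then show "ve (tail Q \<alpha>) \<otimes>\<^bsub>A\<^esub> ev \<phi> \<alpha> = ev \<phi> \<alpha>" using a by (simp add: ev_def)
  qed
  let ?H1 = "hom_regular B P1" and ?H0 = "hom_regular B P0"
  have evs: "mod_surj A ?H1 D ev"
    unfolding mod_surj_def
  proof (intro conjI mod_homI equalityI subsetI)
    fix \<phi> assume "\<phi> \<in> carrier ?H1"
    then show "ev \<phi> \<in> carrier D" by (auto simp: hom_regular_simps intro: evD)
  next
    fix \<phi> \<psi> assume "\<phi> \<in> carrier ?H1" "\<psi> \<in> carrier ?H1"
    show "ev (\<phi> \<oplus>\<^bsub>?H1\<^esub> \<psi>) = ev \<phi> \<oplus>\<^bsub>D\<^esub> ev \<psi>"
      unfolding ev_def hom_regular_simps dsum_simps by (rule restrict_ext) (simp add: h1P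
        proj_at_ops)
  next
    fix a \<phi> assume "a \<in> carrier A" "\<phi> \<in> carrier ?H1"
    show "ev (a \<odot>\<^bsub>?H1\<^esub> \<phi>) = a \<odot>\<^bsub>D\<^esub> ev \<phi>"
      unfolding ev_def hom_regular_simps dsum_simps by (rule restrict_ext) (simp add: h1P
        proj_at_ops)
  next
    fix y assume "y \<in> ev ` carrier ?H1"
    then show "y \<in> carrier D" by (auto simp: hom_regular_simps intro: evD)
  next
    fix y assume y: "y \<in> carrier D"
    have yA: "y \<beta> \<in> carrier A" "ve (tail Q \<beta>) \<otimes>\<^bsub>A\<^esub> y \<beta> = y \<beta>" if "\<beta> \<in> J" for \<beta> using y that by
      (auto simp: D_iff)
    \<comment> \<open>The preimage of y: the coordinates of x are multiplied on the right by the
      entries of y and added up.\<close>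
    let ?\<phi> = "\<lambda>x. msum (regular B) (map (\<lambda>\<beta>. g1 x \<beta> \<otimes>\<^bsub>A\<^esub> y \<beta>) arrow_list)"
    have "mod_hom B P1 (regular B) ?\<phi>"
    proof (rule mod_hom_sum[OF regular_B_rm])
      fix \<beta> assume "\<beta> \<in> set arrow_list"
      then have b: "\<beta> \<in> J" using arrow_list by simp
      have "mod_hom B L1 (regular B) (\<lambda>x. x \<beta>)"
        using dual_basisD(2)[OF L1_basis, of "eps \<beta>" "\<lambda>x. x \<beta>"] b arrow_list by auto
      from mod_hom_comp[OF mod_hom_comp[OF P1(3) this] right_mult_hom[OF yA(1)[OF b]]]
      show "mod_hom B P1 (regular B) (\<lambda>x. g1 x \<beta> \<otimes>\<^bsub>A\<^esub> y \<beta>)" .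
    qed
    from mod_hom_cong[OF this rP1, of "restrict ?\<phi> (carrier P1)"]
    have m1: "restrict ?\<phi> (carrier P1) \<in> carrier ?H1" by (simp add: hom_regular_simps)
    have m2: "ev (restrict ?\<phi> (carrier P1)) = y"
    proof (rule extensionalityI)
      show "ev (restrict ?\<phi> (carrier P1)) \<in> extensional J" by (simp add: ev_def)
      show "y \<in> extensional J" using y by (simp add: D_iff)
      fix \<alpha> assume a: "\<alpha> \<in> J"
      show "ev (restrict ?\<phi> (carrier P1)) \<alpha> = y \<alpha>"
        using a h1P[OF a] P1(4)[OF eps_L1[OF a]] sum_eps[OF a, of y, OF yA] by (simp add: ev_def
          msum_regular_opposite)
    qed
    show "y \<in> ev ` carrier ?H1" by (rule image_eqI[where f = ev, OF m2[symmetric] m1])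
  qed
  \<comment> \<open>The presentation map sends the \<alpha>-th generator to \<alpha> = \<alpha> e_k,
    where \<psi> takes the value \<alpha> \<psi>(e_k). Precomposition with p thus corresponds to
    applying f to \<psi>(e_k).\<close>
  have evpsi: "ev (\<lambda>x\<in>carrier P1. \<psi> (p x)) = f (\<psi> (h0 (ve k)))" if \<psi>: "mod_hom B P0 (regular B) \<psi>"
    for \<psi>
    unfolding ev_def f_def
  proof (rule restrict_ext)
    fix \<alpha> assume a: "\<alpha> \<in> J"
    note aa = J_arc[OF a]
    have "p (h1 (eps \<alpha>)) = h0 (ar \<alpha>)" by (simp add: p_def P1(4)[OF eps_L1[OF a]] rad_cover_eps[OF
      a])
    also have "ar \<alpha> = ar \<alpha> \<odot>\<^bsub>L0\<^esub> ve k" using aa k by (simp add: cyc_proj_simps ar_ve)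
    also have "h0 \<dots> = ar \<alpha> \<odot>\<^bsub>P0\<^esub> h0 (ve k)" by (rule mod_homD(3)[OF P0(2) _ vkL]) (simp add: aa)
    finally have "\<psi> (p (h1 (eps \<alpha>))) = ar \<alpha> \<odot>\<^bsub>regular B\<^esub> \<psi> (h0 (ve k))"
      using mod_homD(3)[OF \<psi> _ mod_homD(1)[OF P0(2) vkL], of "ar \<alpha>"] aa by simp
    then show "(\<lambda>x\<in>carrier P1. \<psi> (p x)) (h1 (eps \<alpha>)) = ar \<alpha> \<otimes>\<^bsub>A\<^esub> \<psi> (h0 (ve k))" using h1P[OF a] by
      simp
  qed
  have "mod_surj A ?H1 N (\<lambda>\<phi>. \<pi> (ev \<phi>))" by (rule mod_surj_comp[OF evs \<pi>])
  moreover have "ker ?H1 N (\<lambda>\<phi>. \<pi> (ev \<phi>)) = (\<lambda>\<phi>. \<lambda>x\<in>carrier P1. \<phi> (p x)) ` carrier ?H0"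
  proof (intro equalityI subsetI)
    fix \<phi> assume "\<phi> \<in> ker ?H1 N (\<lambda>\<phi>. \<pi> (ev \<phi>))"
    then have \<phi>: "mod_hom B P1 (regular B) \<phi>" "\<phi> \<in> extensional (carrier P1)" "\<pi> (ev \<phi>) = \<zero>\<^bsub>N\<^esub>"
      by (auto simp: ker_def hom_regular_simps)
    then have "ev \<phi> \<in> f ` carrier Pk" using evD unfolding k\<pi>[symmetric] by (simp add: ker_def)
    then obtain u where u: "u \<in> carrier Pk" "ev \<phi> = f u" by blast
    have uA: "u \<in> carrier A" "ve k \<otimes>\<^bsub>A\<^esub> u = u" using u(1) by (auto simp: Pk_iff)
    \<comment> \<open>Right multiplication by u on A e_k has the value u at e_k, so composed with p
      it agrees with \<phi> on the generators of P1.\<close>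
    let ?\<psi> = "\<lambda>x. g0 x \<otimes>\<^bsub>A\<^esub> u"
    have \<psi>: "mod_hom B P0 (regular B) ?\<psi>"
      by (rule mod_hom_comp[OF mod_hom_comp[OF P0(3) idem.cyc_proj_incl[OF opp_idem[OF k]]]
        right_mult_hom[OF uA(1)]])
    have \<psi>r: "mod_hom B P0 (regular B) (restrict ?\<psi> (carrier P0))" by (rule mod_hom_cong[OF \<psi>
      rP0]) simp
    have m2: "\<phi> = (\<lambda>x\<in>carrier P1. restrict ?\<psi> (carrier P0) (p x))"
    proof (rule extensionalityI[OF \<phi>(2)])
      show "(\<lambda>x\<in>carrier P1. restrict ?\<psi> (carrier P0) (p x)) \<in> extensional (carrier P1)" by simp
      fix x assume x: "x \<in> carrier P1"
      have "\<phi> x = ?\<psi> (p x)"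
      proof (rule dual_basis_hom_eq[OF b1 rP1 regular_B_rm \<phi>(1) mod_hom_comp[OF ph \<psi>] _ x])
        fix m \<chi> assume "(m, \<chi>) \<in> set (map (\<lambda>\<alpha>. (h1 (eps \<alpha>), \<lambda>y. g1 y \<alpha>)) arrow_list)"
        then obtain \<alpha> where a: "\<alpha> \<in> J" "m = h1 (eps \<alpha>)" using arrow_list by auto
        have "\<phi> m = ev \<phi> \<alpha>" using a by (simp add: ev_def)
        also have "\<dots> = ar \<alpha> \<otimes>\<^bsub>A\<^esub> ?\<psi> (h0 (ve k))" using a uA P0(4)[OF vkL] by (simp add: u(2) f_def)
        also have "\<dots> = ev (\<lambda>x\<in>carrier P1. ?\<psi> (p x)) \<alpha>" using a by (simp add: evpsi[OF \<psi>] f_def)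
        also have "\<dots> = ?\<psi> (p m)" using a h1P by (simp add: ev_def)
        finally show "\<phi> m = ?\<psi> (p m)" .
      qed
      then show "\<phi> x = (\<lambda>x\<in>carrier P1. restrict ?\<psi> (carrier P0) (p x)) x"
        using x mod_homD(1)[OF ph x] by simp
    qed
    have m1: "restrict ?\<psi> (carrier P0) \<in> carrier ?H0" using \<psi>r by (simp add: hom_regular_simps)
    show "\<phi> \<in> (\<lambda>\<phi>. \<lambda>x\<in>carrier P1. \<phi> (p x)) ` carrier ?H0"
      by (rule image_eqI[where f = "\<lambda>\<phi>. \<lambda>x\<in>carrier P1. \<phi> (p x)", OF m2 m1])
  next
    fix \<phi> assume "\<phi> \<in> (\<lambda>\<phi>. \<lambda>x\<in>carrier P1. \<phi> (p x)) ` carrier ?H0"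
    then obtain \<psi> where \<psi>: "mod_hom B P0 (regular B) \<psi>" "\<phi> = (\<lambda>x\<in>carrier P1. \<psi> (p x))"
      by (auto simp: hom_regular_simps)
    have "mod_hom B P1 (regular B) \<phi>" unfolding \<psi>(2) by (rule mod_hom_cong[OF mod_hom_comp[OF ph
      \<psi>(1)] rP1]) simp
    then have 1: "\<phi> \<in> carrier ?H1" by (simp add: hom_regular_simps \<psi>(2))
    let ?u = "\<psi> (h0 (ve k))"
    have h0P: "h0 (ve k) \<in> carrier P0" by (rule mod_homD(1)[OF P0(2) vkL])
    have "h0 (ve k) = ve k \<odot>\<^bsub>P0\<^esub> h0 (ve k)"
      using mod_homD(3)[OF P0(2) _ vkL, of "ve k"] k by (simp add: cyc_proj_simps ve_mult)
    then have "?u = ve k \<odot>\<^bsub>regular B\<^esub> ?u" using mod_homD(3)[OF \<psi>(1) _ h0P, of "ve k"] k by simp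
    then have "?u \<in> carrier Pk" using mod_homD(1)[OF \<psi>(1) h0P] by (simp add: Pk_iff)
    then have "ev \<phi> \<in> ker D N \<pi>" unfolding k\<pi> \<psi>(2) evpsi[OF \<psi>(1)] by blast
    then show "\<phi> \<in> ker ?H1 N (\<lambda>\<phi>. \<pi> (ev \<phi>))" using 1 by (simp add: ker_def)
  qed
  moreover have "min_proj_presentation B P1 p P0 q DS"
    unfolding min_proj_presentation_def using cover0 cover1 by blast
  ultimately show ?thesis
    unfolding is_tau_inv_def is_transpose_def opposite_opposite using N by blast
qed

end

section \<open>The complex $T^-_k$\<close>

context bound_quiver_vertex begin

abbreviation OP :: "(('k, 'v, 'e) bqelt, 'v \<Rightarrow> ('k, 'v, 'e) bqelt) module" where "OP \<equiv> other_proj Q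
  I k"
abbreviation X :: "(('k, 'v, 'e) bqelt, (('k, 'v, 'e) bqelt \<times> ('e \<Rightarrow> ('k, 'v, 'e) bqelt)) \<times>
    ('v \<Rightarrow> ('k, 'v, 'e) bqelt)) cplx" where "X \<equiv> T_minus Q I k"

lemma OP_rm: "right_module A OP"
  unfolding other_proj_def
  by (rule dsum_right_module[OF A.ring_axioms])
    (simp add: proj_at_eq idem.cyc_proj_right_module[OF A_idem])

lemma fd_OP: "fd_module A OP"
  unfolding other_proj_def
  by (rule A.fd_dsum) (simp_all add: proj_at_eq A.fd_cyc_proj[OF fd_regular A_idem])

lemma OP_iff: "z \<in> carrier OP \<longleftrightarrow> z \<in> extensional (verts Q - {k}) \<and>
    (\<forall>i\<in>verts Q - {k}. z i \<in> carrier A \<and> ve i \<otimes>\<^bsub>A\<^esub> z i = z i)"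
  by (auto simp: other_proj_def dsum_simps PiE_iff proj_at_iff)

text \<open>\<open>csum\<close> and \<open>two_term\<close> pad every degree with zero summands:
  elements of degree 0 have the form ((0, y), z), those of degree -1 the form ((x, 0), 0).\<close>

lemma X_obj: "obj X n = dsum2 (dsum2 (if n = -1 then Pk else zero_sub Pk) (if n = 0 then D else
  zero_sub D))
    (if n = 0 then OP else zero_sub OP)"
  by (simp add: T_minus_def L_cplx_def csum_def two_term_def stalk_def)

lemma X_diff: "diff X n u = ((\<zero>\<^bsub>Pk\<^esub>, if n = -1 then f (fst (fst u)) else \<zero>\<^bsub>D\<^esub>), \<zero>\<^bsub>OP\<^esub>)"
  by (simp add: T_minus_def L_cplx_def csum_def two_term_def stalk_def case_prod_unfold
    f_def[abs_def] ar_def pc_def)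

lemma X_m1: "obj X (-1) = dsum2 (dsum2 Pk (zero_sub D)) (zero_sub OP)"
  and X_0: "obj X 0 = dsum2 (dsum2 (zero_sub Pk) D) OP"
  by (simp_all add: X_obj)

lemma Pk_basis: "dual_basis A Pk [(ve k, \<lambda>x. x)]"
  unfolding proj_at_eq by (rule idem.dual_basis_cyc_proj[OF A_idem[OF k]])

lemma D_basis: "dual_basis A D (map (\<lambda>\<alpha>. (eps \<alpha>, \<lambda>x. x \<alpha>)) arrow_list)"
  unfolding proj_at_eq eps_def
  by (rule dual_basis_dsum_cyc[where e = "\<lambda>\<alpha>. ve (tail Q \<alpha>)", OF A.ring_axioms A_idem[OF J_arc(3)]
    arrow_list])

lemma OP_basis: "\<exists>S. dual_basis A OP S"
proof -
  obtain vs where "set vs = verts Q - {k}" "distinct vs" using finite_distinct_list[of "verts Q -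
    {k}"] by auto
  from dual_basis_dsum_cyc[where e = ve, OF A.ring_axioms A_idem this]
  show ?thesis unfolding other_proj_def proj_at_eq by auto
qed

lemma X_bases: "\<exists>S. dual_basis A (obj X (-1)) S" "\<exists>S. dual_basis A (obj X 0) S"
proof -
  note z = dual_basis_zero_sub and zr = zero_sub_right_module
  show "\<exists>S. dual_basis A (obj X (-1)) S" unfolding X_m1
    using dual_basis_dsum2[OF dual_basis_dsum2[OF Pk_basis z[OF D_rm] Pk_rm zr[OF D_rm]] z[OF OP_rm]
        dsum2_right_module[OF Pk_rm zr[OF D_rm]] zr[OF OP_rm]] by blast
  obtain S where S: "dual_basis A OP S" using OP_basis by blast
  show "\<exists>S. dual_basis A (obj X 0) S" unfolding X_0
    using dual_basis_dsum2[OF dual_basis_dsum2[OF z[OF Pk_rm] D_basis zr[OF Pk_rm] D_rm] S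
        dsum2_right_module[OF zr[OF Pk_rm] D_rm] OP_rm] by blast
qed

lemma zero_D: "\<zero>\<^bsub>D\<^esub> = (\<lambda>\<alpha>\<in>J. \<zero>\<^bsub>A\<^esub>)" and zero_Pk: "\<zero>\<^bsub>Pk\<^esub> = \<zero>\<^bsub>A\<^esub>"
  and zero_OP: "\<zero>\<^bsub>OP\<^esub> = (\<lambda>i\<in>verts Q - {k}. \<zero>\<^bsub>A\<^esub>)"
  by (simp_all add: dsum_simps proj_at_ops other_proj_def)

lemma f_zero_iff: "f x = \<zero>\<^bsub>D\<^esub> \<longleftrightarrow> (\<forall>\<alpha>\<in>J. ar \<alpha> \<otimes>\<^bsub>A\<^esub> x = \<zero>\<^bsub>A\<^esub>)"
proof
  assume eq: "f x = \<zero>\<^bsub>D\<^esub>"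
  show "\<forall>\<alpha>\<in>J. ar \<alpha> \<otimes>\<^bsub>A\<^esub> x = \<zero>\<^bsub>A\<^esub>"
  proof
    fix \<alpha> assume "\<alpha> \<in> J"
    then show "ar \<alpha> \<otimes>\<^bsub>A\<^esub> x = \<zero>\<^bsub>A\<^esub>" using fun_cong[OF eq, of \<alpha>] by (simp add: f_def zero_D)
  qed
next
  assume "\<forall>\<alpha>\<in>J. ar \<alpha> \<otimes>\<^bsub>A\<^esub> x = \<zero>\<^bsub>A\<^esub>"
  then show "f x = \<zero>\<^bsub>D\<^esub>" unfolding f_def zero_D by (intro restrict_ext) blast
qed

text \<open>Elements of P_k with vanishing coefficient at e_k have their coordinate in the radical
  of A. If a maximal submodule N did not contain all of them, adding them to N would give P_k, and
  Nakayama's lemma would force N = P_k.\<close>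

lemma in_rad_Pk:
  assumes x: "x \<in> carrier Pk" and 0: "vc k x = 0"
  shows "x \<in> carrier (rad A Pk)"
proof -
  interpret P: right_module A Pk by (rule Pk_rm)
  let ?K = "{y \<in> carrier Pk. vc k y = 0}"
  have K1: "y \<in> filt 1" if y: "y \<in> ?K" for y
    unfolding filt_1_iff
  proof (intro conjI ballI)
    have yA: "y \<in> carrier A" "ve k \<otimes>\<^bsub>A\<^esub> y = y" using y by (auto simp: Pk_iff)
    then show "y \<in> carrier A" by simp
    fix i assume i: "i \<in> verts Q"
    have "vc i (ve k \<otimes>\<^bsub>A\<^esub> y) = (if k = i then 1 else 0) * vc i y"
      unfolding vc_mult[OF i ve_closed[OF k] yA(1)] vc_ve[OF k] ..
    then show "vc i y = 0" using yA(2) y by (cases "k = i") auto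
  qed
  have K_add: "y \<oplus>\<^bsub>Pk\<^esub> z \<in> ?K" if y: "y \<in> ?K" and z: "z \<in> ?K" for y z
  proof -
    have "y \<in> carrier A" "z \<in> carrier A" using y z by (auto simp: Pk_iff)
    then show ?thesis using y z by (simp add: proj_at_ops(1) vc_add) (use y z P.M.a_closed in
      \<open>simp add: proj_at_ops(1)\<close>)
  qed
  have K_act: "a \<odot>\<^bsub>Pk\<^esub> y \<in> ?K" if a: "a \<in> carrier A" and y: "y \<in> ?K" for a y
  proof -
    have "y \<in> carrier A" using y by (auto simp: Pk_iff)
    then have "vc k (a \<odot>\<^bsub>Pk\<^esub> y) = 0" using y a by (simp add: proj_at_ops(3) vc_mult[OF k])
    then show ?thesis using P.act_closed[OF a] y by simp
  qed
  have "x \<in> N" if N: "submodule N A Pk" "N \<noteq> carrier Pk"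
    and max: "\<forall>L. submodule L A Pk \<and> N \<subseteq> L \<longrightarrow> L = N \<or> L = carrier Pk" for N
  proof -
    note Nd = submoduleD[OF N(1)]
    let ?L = "{y \<oplus>\<^bsub>Pk\<^esub> z | y z. y \<in> ?K \<and> z \<in> N}"
    have zK: "\<zero>\<^bsub>Pk\<^esub> \<in> ?K" by (simp add: zero_Pk vc_zero) (use P.M.zero_closed in \<open>simp add:
      zero_Pk\<close>)
    have L: "submodule ?L A Pk"
    proof (rule right_submoduleI[OF Pk_rm])
      show "?L \<subseteq> carrier Pk" using Nd(1) by auto
      have "\<zero>\<^bsub>Pk\<^esub> = \<zero>\<^bsub>Pk\<^esub> \<oplus>\<^bsub>Pk\<^esub> \<zero>\<^bsub>Pk\<^esub>" by simp
      then show "\<zero>\<^bsub>Pk\<^esub> \<in> ?L" using zK Nd(2) by blast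
    next
      fix u v assume "u \<in> ?L" "v \<in> ?L"
      then obtain y z y' z' where u: "u = y \<oplus>\<^bsub>Pk\<^esub> z" "y \<in> ?K" "z \<in> N" and v: "v = y' \<oplus>\<^bsub>Pk\<^esub> z'" "y'
        \<in> ?K" "z' \<in> N"
        by blast
      have c: "y \<in> carrier Pk" "y' \<in> carrier Pk" "z \<in> carrier Pk" "z' \<in> carrier Pk" using u v
        Nd(1) by auto
      have "u \<oplus>\<^bsub>Pk\<^esub> v = (y \<oplus>\<^bsub>Pk\<^esub> y') \<oplus>\<^bsub>Pk\<^esub> (z \<oplus>\<^bsub>Pk\<^esub> z')" using c by (simp add: u(1) v(1) P.M.a_ac)
      then show "u \<oplus>\<^bsub>Pk\<^esub> v \<in> ?L" using K_add[OF u(2) v(2)] Nd(3)[OF u(3) v(3)] by blast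
    next
      fix a u assume a: "a \<in> carrier A" and "u \<in> ?L"
      then obtain y z where u: "u = y \<oplus>\<^bsub>Pk\<^esub> z" "y \<in> ?K" "z \<in> N" by blast
      have c: "y \<in> carrier Pk" "z \<in> carrier Pk" using u Nd(1) by auto
      have "a \<odot>\<^bsub>Pk\<^esub> u = a \<odot>\<^bsub>Pk\<^esub> y \<oplus>\<^bsub>Pk\<^esub> a \<odot>\<^bsub>Pk\<^esub> z" using c a by (simp add: u(1) P.act_distr)
      then show "a \<odot>\<^bsub>Pk\<^esub> u \<in> ?L" using K_act[OF a u(2)] Nd(4)[OF a u(3)] by blast
    qed
    have NL: "N \<subseteq> ?L"
    proof
      fix z assume z: "z \<in> N"
      then have "z = \<zero>\<^bsub>Pk\<^esub> \<oplus>\<^bsub>Pk\<^esub> z" using Nd(1) by auto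
      then show "z \<in> ?L" using zK z by blast
    qed
    have "?L \<noteq> carrier Pk"
    proof
      assume eq: "?L = carrier Pk"
      have "N = carrier Pk"
        by (rule superfluous_A[OF Pk_rm Pk_basis N(1), where K = ?K]) (use K1 eq in auto)
      then show False using N(2) by simp
    qed
    then have "?L = N" using max L NL by blast
    moreover have "x = x \<oplus>\<^bsub>Pk\<^esub> \<zero>\<^bsub>Pk\<^esub>" using x by simp
    then have "x \<in> ?L" using x 0 Nd(2) by blast
    ultimately show ?thesis by simp
  qed
  then show ?thesis using x by (auto simp: rad_def)
qed

end

locale tilted_vertex = bound_quiver_vertex Q I k
  for Q :: "('v, 'e) pre_digraph" and I :: "(('v, 'e) qpath \<Rightarrow> 'k::field) set" and k :: 'v +
  assumes no_loop: "\<forall>\<alpha>\<in>arcs Q. \<not> (tail Q \<alpha> = k \<and> head Q \<alpha> = k)"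
    and not_isolated: "\<exists>\<alpha>\<in>arcs Q. tail Q \<alpha> = k \<or> head Q \<alpha> = k"
    and not_embeds: "\<not> embeds A (simple_at k) (rad A Pk)"
    and tilt: "tilting_complex A X"
begin

lemma X_bounded: "bounded_complex A X" using tilt by (simp add: tilting_complex_def)

sublocale two_term_complex A X
  by unfold_locales (simp_all add: X_bounded X_obj)

lemma Db_hom_zero_shift: "r \<noteq> 0 \<Longrightarrow> Db_hom_zero A X (shift r X)"
  using tilt by (simp add: tilting_complex_def)

subsection \<open>Injectivity of the differential\<close>

lemma f_ker_other_vertex:
  assumes x: "x \<in> carrier Pk" and fx: "f x = \<zero>\<^bsub>D\<^esub>" and j: "j \<in> verts Q" "j \<noteq> k"
  shows "x \<otimes>\<^bsub>A\<^esub> ve j = \<zero>\<^bsub>A\<^esub>"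
proof -
  have xA: "x \<in> carrier A" "ve k \<otimes>\<^bsub>A\<^esub> x = x" using x by (auto simp: Pk_iff)
  \<comment> \<open>The map from degree 0 to degree -1: pick the component in P_j and multiply it by
    x on the left. The differential has no component in the other projectives and f x = 0, so both
    composites with it vanish.\<close>
  let ?\<phi> = "\<lambda>u. ((x \<otimes>\<^bsub>A\<^esub> snd u j, \<zero>\<^bsub>D\<^esub>), \<zero>\<^bsub>OP\<^esub>)"
  have jO: "j \<in> verts Q - {k}" using j by simp
  have "mod_hom A (proj_at Q I j) Pk (\<lambda>z. x \<otimes>\<^bsub>A\<^esub> z)"
    by (rule mod_homI) (use xA k in \<open>simp_all add: Pk_iff proj_at_iff[OF j(1)] proj_at_ops
      A.r_distr A.m_assoc[symmetric]\<close>)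
  moreover have "mod_hom A (obj X 0) (proj_at Q I j) (\<lambda>u. snd u j)"
    unfolding X_0 other_proj_def by (rule mod_hom_comp[OF mod_hom_snd mod_hom_proj[OF jO]])
  ultimately have h: "mod_hom A (obj X 0) Pk (\<lambda>u. x \<otimes>\<^bsub>A\<^esub> snd u j)" using mod_hom_comp by blast
  have \<phi>: "mod_hom A (obj X 0) (obj X (-1)) ?\<phi>"
    unfolding X_m1
    using mod_hom_dsum2[OF mod_hom_dsum2[OF h mod_hom_const_zero[OF zero_sub_right_module[OF D_rm]]]
        mod_hom_const_zero[OF zero_sub_right_module[OF OP_rm]]] by simp
  \<comment> \<open>The generator e_j of the summand P_j, which \<phi> takes to x e_j.\<close>
  define y where "y = ((\<zero>\<^bsub>Pk\<^esub>, \<zero>\<^bsub>D\<^esub>), \<lambda>i\<in>verts Q - {k}. if i = j then ve j else \<zero>\<^bsub>A\<^esub>)"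
  have zD: "\<zero>\<^bsub>D\<^esub> \<in> carrier D" using D_rm by (simp add: right_module_def abelian_group_def
    abelian_monoid.zero_closed)
  have y: "y \<in> carrier (obj X 0)"
    unfolding X_0 y_def using zD j by (auto simp: OP_iff ve_mult)
  have "?\<phi> y = \<zero>\<^bsub>obj X (-1)\<^esub>"
  proof (rule no_hom_degree_minus_1[OF Db_hom_zero_shift \<phi> _ _ y])
    fix u assume "u \<in> carrier (obj X 0)"
    then have "snd u \<in> carrier OP" unfolding X_0 by auto
    then have uA: "snd u j \<in> carrier A" using jO by (simp add: OP_iff)
    have "f (x \<otimes>\<^bsub>A\<^esub> snd u j) = \<zero>\<^bsub>D\<^esub>"
      using fx uA xA J_arc unfolding f_zero_iff by (simp add: A.m_assoc[symmetric])
    then show "diff X (-1) (?\<phi> u) = \<zero>\<^bsub>obj X 0\<^esub>" by (simp add: X_diff X_0)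
  next
    fix u show "?\<phi> (diff X (-1) u) = \<zero>\<^bsub>obj X (-1)\<^esub>"
      using xA jO by (simp add: X_diff X_m1 zero_OP zero_Pk)
  qed simp
  then have "x \<otimes>\<^bsub>A\<^esub> snd y j = \<zero>\<^bsub>A\<^esub>" by (simp add: X_m1 zero_Pk)
  then show ?thesis using jO by (simp add: y_def)
qed

text \<open>If \<beta> starts away from k, then x \<beta> = (x e_{s(\<beta>)}) \<beta> = 0 at once.
  If it starts at k, it ends elsewhere because there is no loop; x \<beta> is again in the kernel of
  f, so the same vanishing applies to x \<beta> at the end vertex of \<beta>.\<close>

lemma f_ker_arrow:
  assumes x: "x \<in> carrier Pk" and fx: "f x = \<zero>\<^bsub>D\<^esub>" and b: "\<beta> \<in> arcs Q"
  shows "x \<otimes>\<^bsub>A\<^esub> ar \<beta> = \<zero>\<^bsub>A\<^esub>"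
proof -
  have xA: "x \<in> carrier A" "ve k \<otimes>\<^bsub>A\<^esub> x = x" using x by (auto simp: Pk_iff)
  show ?thesis
  proof (cases "tail Q \<beta> = k")
    case False
    have "x \<otimes>\<^bsub>A\<^esub> ar \<beta> = (x \<otimes>\<^bsub>A\<^esub> ve (tail Q \<beta>)) \<otimes>\<^bsub>A\<^esub> ar \<beta>" using xA b by (simp add: A.m_assoc ve_ar)
    then show ?thesis using f_ker_other_vertex[OF x fx _ False] b by simp
  next
    case True
    then have h: "head Q \<beta> \<noteq> k" using no_loop b by blast
    let ?x = "x \<otimes>\<^bsub>A\<^esub> ar \<beta>"
    have "?x \<in> carrier Pk" using xA b k by (simp add: Pk_iff A.m_assoc[symmetric])
    moreover have "f ?x = \<zero>\<^bsub>D\<^esub>"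
      using fx xA b J_arc unfolding f_zero_iff by (simp add: A.m_assoc[symmetric])
    ultimately have "?x \<otimes>\<^bsub>A\<^esub> ve (head Q \<beta>) = \<zero>\<^bsub>A\<^esub>" using f_ker_other_vertex[OF _ _ _ h] b by simp
    then show ?thesis using xA b by (simp add: A.m_assoc ar_ve)
  qed
qed

text \<open>A nonzero kernel element x would embed S_k by c \<mapsto> x c: this is linear over A
  because elements of A act on x through their coefficient at e_k, and injective because nonzero
  scalars are invertible. The values lie in the radical, which is excluded.\<close>

lemma f_ker_zero:
  assumes x: "x \<in> carrier Pk" and fx: "f x = \<zero>\<^bsub>D\<^esub>"
  shows "x = \<zero>\<^bsub>A\<^esub>"
proof (rule ccontr)
  assume nz: "x \<noteq> \<zero>\<^bsub>A\<^esub>"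
  have xA: "x \<in> carrier A" "ve k \<otimes>\<^bsub>A\<^esub> x = x" using x by (auto simp: Pk_iff)
  have xk: "x \<otimes>\<^bsub>A\<^esub> ve k = x" by (rule eq_right_if[OF xA(1) k f_ker_other_vertex[OF x fx]])
  let ?c = "\<lambda>c. c \<odot>\<^bsub>A\<^esub> \<one>\<^bsub>A\<^esub>"
  have R: "right_module A (regular A)" by (rule regular_right_module[OF A.ring_axioms])
  have c0: "x \<otimes>\<^bsub>A\<^esub> ?c 0 = \<zero>\<^bsub>A\<^esub>" using A.scal_zero_left[OF R, of x] xA by (simp add: scal_def)
  \<comment> \<open>Both sides are linear in y, so \<open>filt_span\<close> with n = 0 reduces the
    claim to paths: multiplied on the right, trivial paths away from k and paths with a first arrow
    annihilate x, while e_k fixes it.\<close>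
  have xy: "x \<otimes>\<^bsub>A\<^esub> y = x \<otimes>\<^bsub>A\<^esub> ?c (vc k y)" if y: "y \<in> carrier A" for y
  proof -
    define S where "S = {y \<in> carrier A. x \<otimes>\<^bsub>A\<^esub> y = x \<otimes>\<^bsub>A\<^esub> ?c (vc k y)}"
    have "y \<in> S"
    proof (rule filt_span[where n = 0])
      show "y \<in> filt 0" using y by (simp add: filt_0)
      show "A.subspace (regular A) S"
        unfolding A.subspace_def
      proof (intro conjI ballI allI)
        show "S \<subseteq> carrier (regular A)" by (auto simp: S_def)
        show "\<zero>\<^bsub>regular A\<^esub> \<in> S" using xA by (simp add: S_def vc_zero c0)
        fix u v assume "u \<in> S" "v \<in> S"
        then show "u \<oplus>\<^bsub>regular A\<^esub> v \<in> S" using xA by (simp add: S_def vc_add A.scalar_add A.r_distr)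
      next
        fix c u assume "u \<in> S"
        then have u: "u \<in> carrier A" "x \<otimes>\<^bsub>A\<^esub> u = x \<otimes>\<^bsub>A\<^esub> ?c (vc k u)" by (auto simp: S_def)
        have "x \<otimes>\<^bsub>A\<^esub> (u \<otimes>\<^bsub>A\<^esub> ?c c) = (x \<otimes>\<^bsub>A\<^esub> ?c (vc k u)) \<otimes>\<^bsub>A\<^esub> ?c c"
          using xA u by (simp add: A.m_assoc[symmetric])
        also have "\<dots> = x \<otimes>\<^bsub>A\<^esub> ?c (vc k (u \<otimes>\<^bsub>A\<^esub> ?c c))"
          using xA u by (simp add: A.m_assoc A.scalar_mult vc_mult[OF k] vc_scalar[OF k])
        finally show "scal A (regular A) c u \<in> S" using u(1) by (simp add: S_def scal_def)
      qed
      fix p assume p: "p \<in> paths Q"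
      then show "pc p \<in> S"
      proof (cases rule: pc_cases)
        case (1 i)
        then have "x \<otimes>\<^bsub>A\<^esub> ve i = x \<otimes>\<^bsub>A\<^esub> ?c (vc k (ve i))"
          using xA xk f_ker_other_vertex[OF x fx] c0 by (cases "i = k") (simp_all add: vc_ve
            A.scalar_one)
        then show ?thesis using 1 by (simp add: S_def ve_def vertex_path_in_paths)
      next
        case (2 \<beta> q)
        have "x \<otimes>\<^bsub>A\<^esub> pc p = \<zero>\<^bsub>A\<^esub>"
          using 2 xA f_ker_arrow[OF x fx 2(1)] by (simp add: A.m_assoc[symmetric])
        moreover have "vc k (pc p) = 0" using 2 by (simp add: vc_mult[OF k] vc_ar)
        ultimately show ?thesis using c0 p by (simp add: S_def)
      qed
    qed
    then show ?thesis by (simp add: S_def)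
  qed
  \<comment> \<open>For an arrow \<alpha> starting at k the coefficient of \<alpha> in x \<alpha> is
    the coefficient of x at e_k; for one ending at k the same holds for \<alpha> x. Either product
    is zero.\<close>
  have vx: "vc k x = 0"
  proof -
    obtain \<alpha> where a: "\<alpha> \<in> arcs Q" "tail Q \<alpha> = k \<or> head Q \<alpha> = k" using not_isolated by blast
    from a(2) show ?thesis
    proof
      assume t: "tail Q \<alpha> = k"
      have "ac \<alpha> (x \<otimes>\<^bsub>A\<^esub> ar \<alpha>) = vc k x" using a t xA by (simp add: ac_mult ac_ar vc_ar)
      then show ?thesis using f_ker_arrow[OF x fx a(1)] by (simp add: ac_zero)
    next
      assume h: "head Q \<alpha> = k"
      have "ac \<alpha> (ar \<alpha> \<otimes>\<^bsub>A\<^esub> x) = vc k x" using a h xA by (simp add: ac_mult ac_ar vc_ar)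
      then show ?thesis using fx a h unfolding f_zero_iff by (simp add: arrows_into_def ac_zero)
    qed
  qed
  have xc: "x \<otimes>\<^bsub>A\<^esub> ?c c \<in> carrier Pk" for c using xA k by (simp add: Pk_iff A.m_assoc[symmetric])
  have "mod_hom A (simple_at k) (rad A Pk) (\<lambda>c. x \<otimes>\<^bsub>A\<^esub> ?c c)"
  proof (rule mod_homI)
    fix c :: 'k
    show "x \<otimes>\<^bsub>A\<^esub> ?c c \<in> carrier (rad A Pk)"
      by (rule in_rad_Pk[OF xc]) (simp add: vc_mult[OF k xA(1)] vx)
  next
    fix c c' :: 'k
    show "x \<otimes>\<^bsub>A\<^esub> ?c (c \<oplus>\<^bsub>simple_at k\<^esub> c') = (x \<otimes>\<^bsub>A\<^esub> ?c c) \<oplus>\<^bsub>rad A Pk\<^esub> (x \<otimes>\<^bsub>A\<^esub> ?c c')"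
      using xA by (simp add: simple_at_simps rad_def proj_at_ops A.scalar_add A.r_distr)
  next
    fix a and c :: 'k assume a: "a \<in> carrier A"
    have "x \<otimes>\<^bsub>A\<^esub> ?c (c * vc k a) = (x \<otimes>\<^bsub>A\<^esub> ?c (vc k a)) \<otimes>\<^bsub>A\<^esub> ?c c"
      using xA A.scalar_mult[of "vc k a" c] by (simp add: A.m_assoc mult.commute)
    also have "\<dots> = x \<otimes>\<^bsub>A\<^esub> a \<otimes>\<^bsub>A\<^esub> ?c c" using xy[OF a] by simp
    also have "\<dots> = x \<otimes>\<^bsub>A\<^esub> ?c c \<otimes>\<^bsub>A\<^esub> a" using xA a by (simp add: A.m_assoc A.scalar_central)
    finally show "x \<otimes>\<^bsub>A\<^esub> ?c (a \<odot>\<^bsub>simple_at k\<^esub> c) = a \<odot>\<^bsub>rad A Pk\<^esub> (x \<otimes>\<^bsub>A\<^esub> ?c c)"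
      by (simp add: simple_at_simps rad_def proj_at_ops)
  qed
  moreover have "inj_on (\<lambda>c. x \<otimes>\<^bsub>A\<^esub> ?c c) (carrier (simple_at k))"
  proof (rule inj_onI, rule ccontr)
    fix c c' assume eq: "x \<otimes>\<^bsub>A\<^esub> ?c c = x \<otimes>\<^bsub>A\<^esub> ?c c'" and ne: "c \<noteq> c'"
    have "x \<otimes>\<^bsub>A\<^esub> ?c (c - c') = \<zero>\<^bsub>A\<^esub>"
    proof -
      have "x \<otimes>\<^bsub>A\<^esub> ?c (c - c') \<oplus>\<^bsub>A\<^esub> x \<otimes>\<^bsub>A\<^esub> ?c c' = x \<otimes>\<^bsub>A\<^esub> ?c c"
        using xA A.scalar_add[of "c - c'" c'] by (simp add: A.r_distr)
      then show ?thesis using eq xA by simp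
    qed
    then have "\<zero>\<^bsub>A\<^esub> = (x \<otimes>\<^bsub>A\<^esub> ?c (c - c')) \<otimes>\<^bsub>A\<^esub> ?c (1 / (c - c'))" by simp
    also have "\<dots> = x" using xA ne A.scalar_mult[of "c - c'" "1 / (c - c')"] by (simp add:
      A.m_assoc A.scalar_one)
    finally show False using nz by simp
  qed
  ultimately show False using not_embeds unfolding embeds_def by blast
qed

lemma f_inj: "inj_on f (carrier Pk)"
  using mod_hom_inj_iff[OF f_hom Pk_rm D_rm] f_ker_zero by (simp add: zero_Pk)

subsection \<open>The tilting module\<close>

text \<open>Apart from the padding, the first map is f into the first summand, and the second is
  \<pi> together with the identity on the other projectives. Exactness thus combines the injectivity
  of f with the given description of the kernel of \<pi>.\<close>

lemma resolution:
  assumes N: "right_module A N" and \<pi>: "mod_surj A D N \<pi>" and k\<pi>: "ker D N \<pi> = f ` carrier Pk"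
  shows "short_exact A (obj X (-1)) (diff X (-1)) (obj X 0) (\<lambda>u. (\<pi> (snd (fst u)), snd u)) (dsum2
    N OP)"
    (is "short_exact A ?X1 ?d ?X0 ?p ?T")
  unfolding short_exact_def
proof (intro conjI)
  show "mod_hom A ?X1 ?X0 ?d" by (rule d_hom)
  have \<pi>h: "mod_hom A D N \<pi>" and \<pi>s: "\<pi> ` carrier D = carrier N" using \<pi> by (auto simp:
    mod_surj_def)
  show "inj_on ?d (carrier ?X1)"
  proof (rule inj_onI)
    fix u v assume "u \<in> carrier ?X1" "v \<in> carrier ?X1" "?d u = ?d v"
    then show "u = v" using inj_onD[OF f_inj, of "fst (fst u)" "fst (fst v)"]
      by (auto simp: X_m1 X_diff)
  qed
  have ph: "mod_hom A ?X0 ?T ?p"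
    unfolding X_0
    by (rule mod_hom_dsum2[OF mod_hom_comp[OF mod_hom_comp[OF mod_hom_fst mod_hom_snd] \<pi>h]
      mod_hom_snd])
  show "mod_surj A ?X0 ?T ?p"
    unfolding mod_surj_def
  proof (intro conjI ph equalityI subsetI)
    show "t \<in> carrier ?T" if "t \<in> ?p ` carrier ?X0" for t using that mod_homD(1)[OF ph] by blast
    fix t assume "t \<in> carrier ?T"
    then obtain n z where t: "t = (n, z)" "n \<in> carrier N" "z \<in> carrier OP" by auto
    then obtain y where "y \<in> carrier D" "n = \<pi> y" unfolding \<pi>s[symmetric] by blast
    then show "t \<in> ?p ` carrier ?X0" using t by (intro image_eqI[of _ _ "((\<zero>\<^bsub>Pk\<^esub>, y), z)"])
      (simp_all add: X_0)
  qed
  show "?d ` carrier ?X1 = ker ?X0 ?T ?p"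
  proof (intro equalityI subsetI)
    fix v assume "v \<in> ?d ` carrier ?X1"
    then obtain u where u: "u \<in> carrier ?X1" "v = ?d u" by blast
    then have "fst (fst u) \<in> carrier Pk" by (auto simp: X_m1)
    then have "f (fst (fst u)) \<in> ker D N \<pi>" unfolding k\<pi> by blast
    moreover have "v \<in> carrier ?X0" unfolding u(2) by (rule mod_homD(1)[OF d_hom u(1)])
    ultimately show "v \<in> ker ?X0 ?T ?p" using u by (simp add: ker_def X_diff)
  next
    fix v assume "v \<in> ker ?X0 ?T ?p"
    then obtain y where v: "v = ((\<zero>\<^bsub>Pk\<^esub>, y), \<zero>\<^bsub>OP\<^esub>)" "y \<in> ker D N \<pi>" by (auto simp: ker_def X_0)
    then obtain x where x: "x \<in> carrier Pk" "y = f x" unfolding k\<pi> by blast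
    show "v \<in> ?d ` carrier ?X1"
      by (rule image_eqI[of _ _ "((x, \<zero>\<^bsub>D\<^esub>), \<zero>\<^bsub>OP\<^esub>)"]) (use v x in \<open>simp_all add: X_diff X_m1\<close>)
  qed
qed

text \<open>A is P_k plus the other projectives, and the sequence is P_k -> D -> N plus the identity
  of the other projectives: f x depends only on e_k x, as \<open>fk\<close> shows, and the remaining
  entries are the components e_i x.\<close>

lemma coresolution:
  assumes N: "right_module A N" and \<pi>: "mod_surj A D N \<pi>" and k\<pi>: "ker D N \<pi> = f ` carrier Pk"
  shows "short_exact A (regular A) (\<lambda>x. ((\<zero>\<^bsub>Pk\<^esub>, f x), \<lambda>i\<in>verts Q - {k}. ve i \<otimes>\<^bsub>A\<^esub> x)) (obj X 0)
    (\<lambda>u. \<pi> (snd (fst u))) N"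
    (is "short_exact A _ ?i ?X0 ?p N")
proof -
  have \<pi>h: "mod_hom A D N \<pi>" and \<pi>s: "\<pi> ` carrier D = carrier N" using \<pi> by (auto simp:
    mod_surj_def)
  have R: "right_module A (regular A)" by (rule regular_right_module[OF A.ring_axioms])
  interpret DD: right_module A D by (rule D_rm)
  have rX0: "right_module A ?X0" by (rule bounded_complexD(2)[OF X_bounded])
  have zr: "right_module A (zero_sub Pk)" by (rule zero_sub_right_module[OF Pk_rm])
  have c0: "mod_hom A (regular A) (zero_sub Pk) (\<lambda>x. \<zero>\<^bsub>Pk\<^esub>)" using mod_hom_const_zero[OF zr, of
    "regular A"] by simp
  have "mod_hom A (regular A) OP (\<lambda>x. \<lambda>i\<in>verts Q - {k}. ve i \<otimes>\<^bsub>A\<^esub> x)"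
    unfolding other_proj_def
  proof (rule mod_hom_dsum)
    fix i assume "i \<in> verts Q - {k}"
    then have i: "i \<in> verts Q" by simp
    show "mod_hom A (regular A) (proj_at Q I i) (\<lambda>x. ve i \<otimes>\<^bsub>A\<^esub> x)"
      by (rule mod_homI) (use i in \<open>simp_all add: proj_at_iff proj_at_ops A.r_distr A.m_assoc,
        simp add: A.m_assoc[symmetric] ve_mult\<close>)
  qed
  then have i: "mod_hom A (regular A) ?X0 ?i"
    unfolding X_0 by (intro mod_hom_dsum2 c0 f_extends)
  have ph: "mod_hom A ?X0 N ?p"
    unfolding X_0 by (rule mod_hom_comp[OF mod_hom_comp[OF mod_hom_fst mod_hom_snd] \<pi>h])
  have fk: "f (ve k \<otimes>\<^bsub>A\<^esub> x) = f x" if x: "x \<in> carrier A" for x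
    unfolding f_def
  proof (rule restrict_ext)
    fix \<alpha> assume a: "\<alpha> \<in> J"
    show "ar \<alpha> \<otimes>\<^bsub>A\<^esub> (ve k \<otimes>\<^bsub>A\<^esub> x) = ar \<alpha> \<otimes>\<^bsub>A\<^esub> x"
      using x J_arc[OF a] k by (simp add: A.m_assoc[symmetric] ar_ve)
  qed
  have vkP: "ve k \<otimes>\<^bsub>A\<^esub> x \<in> carrier Pk" if "x \<in> carrier A" for x
    using that k by (simp add: Pk_iff A.m_assoc[symmetric] ve_mult)
  show ?thesis
    unfolding short_exact_def
  proof (intro conjI i)
    show "inj_on ?i (carrier (regular A))"
      unfolding mod_hom_inj_iff[OF i R rX0]
    proof (intro ballI impI)
      fix x assume "x \<in> carrier (regular A)" and "?i x = \<zero>\<^bsub>?X0\<^esub>"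
      then have x: "x \<in> carrier A" and fx: "f x = \<zero>\<^bsub>D\<^esub>"
        and o: "(\<lambda>i\<in>verts Q - {k}. ve i \<otimes>\<^bsub>A\<^esub> x) = \<zero>\<^bsub>OP\<^esub>" by (auto simp: X_0)
      have "ve i \<otimes>\<^bsub>A\<^esub> x = \<zero>\<^bsub>A\<^esub>" if iv: "i \<in> verts Q" for i
      proof (cases "i = k")
        case True
        then show ?thesis using f_ker_zero[OF vkP[OF x]] fx fk[OF x] by simp
      next
        case False
        then show ?thesis using fun_cong[OF o, of i] iv by (simp add: zero_OP)
      qed
      then show "x = \<zero>\<^bsub>regular A\<^esub>" using zero_if_left[OF x] by simp
    qed
    show "mod_surj A ?X0 N ?p"
      unfolding mod_surj_def
    proof (intro conjI ph equalityI subsetI)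
      show "t \<in> carrier N" if "t \<in> ?p ` carrier ?X0" for t using that mod_homD(1)[OF ph] by blast
      fix t assume "t \<in> carrier N"
      then obtain y where y: "y \<in> carrier D" "t = \<pi> y" unfolding \<pi>s[symmetric] by blast
      have "\<zero>\<^bsub>OP\<^esub> \<in> carrier OP" using OP_rm by (simp add: right_module_def abelian_group_def
        abelian_monoid.zero_closed)
      then show "t \<in> ?p ` carrier ?X0" using y by (intro image_eqI[of _ _ "((\<zero>\<^bsub>Pk\<^esub>, y), \<zero>\<^bsub>OP\<^esub>)"])
        (simp_all add: X_0)
    qed
    show "?i ` carrier (regular A) = ker ?X0 N ?p"
    proof (intro equalityI subsetI)
      fix v assume "v \<in> ?i ` carrier (regular A)"
      then obtain x where x: "x \<in> carrier A" "v = ?i x" by auto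
      have "f x \<in> ker D N \<pi>" unfolding k\<pi> fk[OF x(1), symmetric] using vkP[OF x(1)] by blast
      moreover have "v \<in> carrier ?X0" unfolding x(2) by (rule mod_homD(1)[OF i]) (simp add: x)
      ultimately show "v \<in> ker ?X0 N ?p" by (simp add: ker_def x(2))
    next
      fix v assume "v \<in> ker ?X0 N ?p"
      then obtain y z where v: "v = ((\<zero>\<^bsub>Pk\<^esub>, y), z)" "y \<in> ker D N \<pi>" "z \<in> carrier OP" by (auto
        simp: ker_def X_0)
      then obtain u where u: "u \<in> carrier Pk" "y = f u" unfolding k\<pi> by blast
      have uA: "u \<in> carrier A" "ve k \<otimes>\<^bsub>A\<^esub> u = u" using u(1) by (auto simp: Pk_iff)
      have zA: "z i \<in> carrier A" "ve i \<otimes>\<^bsub>A\<^esub> z i = z i" if "i \<in> verts Q - {k}" for i using v(3)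
        that by (auto simp: OP_iff)
      \<comment> \<open>The components of the preimage: u in P_k and z i elsewhere. Their sum x
        satisfies e_i x = w i by orthogonality of the idempotents.\<close>
      define w where "w i = (if i = k then u else z i)" for i
      have w: "w i \<in> carrier A" "ve i \<otimes>\<^bsub>A\<^esub> w i = w i" if "i \<in> verts Q" for i
        using uA zA[of i] that by (auto simp: w_def)
      obtain vs where vs: "set vs = verts Q" "distinct vs" by (rule verts_list)
      interpret RR: right_module A "regular A" by (rule R)
      define x where "x = msum (regular A) (map w vs)"
      have ws: "set (map w vs) \<subseteq> carrier (regular A)" using w vs by auto
      have x: "x \<in> carrier A" using RR.msum_closed[OF ws] by (simp add: x_def)
      have vx: "ve i \<otimes>\<^bsub>A\<^esub> x = w i" if iv: "i \<in> verts Q" for i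
      proof -
        have "ve i \<otimes>\<^bsub>A\<^esub> x = msum (regular A) (map (\<lambda>y. ve i \<otimes>\<^bsub>A\<^esub> y) (map w vs))"
          unfolding x_def by (rule mod_hom_msum[OF left_mult_hom[OF ve_closed[OF iv]] R R ws])
        also have "map (\<lambda>y. ve i \<otimes>\<^bsub>A\<^esub> y) (map w vs) = map (\<lambda>j. if j = i then w i else \<zero>\<^bsub>regular
          A\<^esub>) vs"
        proof -
          have "ve i \<otimes>\<^bsub>A\<^esub> w j = (if j = i then w i else \<zero>\<^bsub>A\<^esub>)" if j: "j \<in> verts Q" for j
          proof -
            have "ve i \<otimes>\<^bsub>A\<^esub> w j = (ve i \<otimes>\<^bsub>A\<^esub> ve j) \<otimes>\<^bsub>A\<^esub> w j" using w[OF j] iv j by (simp add: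
              A.m_assoc)
            then show ?thesis using w[OF j] iv j by (cases "j = i") (simp_all add: ve_mult)
          qed
          then show ?thesis using vs by simp
        qed
        also have "msum (regular A) \<dots> = w i" by (rule RR.msum_single[OF vs(2)]) (use vs iv w in
          simp_all)
        finally show ?thesis .
      qed
      have "v = ?i x"
      proof -
        have "f x = y" using fk[OF x] vx[OF k] u(2) by (simp add: w_def)
        moreover have "z = (\<lambda>i\<in>verts Q - {k}. ve i \<otimes>\<^bsub>A\<^esub> x)"
          using v(3) vx by (intro extensionalityI[of _ "verts Q - {k}"]) (auto simp: OP_iff w_def)
        ultimately show ?thesis using v(1) by simp
      qed
      then show "v \<in> ?i ` carrier (regular A)" using x by (intro image_eqI[of _ _ x]) simp_all
    qed
  qed
qed

text \<open>Without loops at k every s(\<alpha>) differs from k, so P_{s(\<alpha>)} is one of the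
  other projectives and hence a summand of T. One pair of maps for every arrow and one for the other
  projectives themselves decompose the identity of the degree 0 term.\<close>

lemma X0_in_add:
  assumes N: "fd_module A (N :: (('k, 'v, 'e) bqelt, 'n) module)" and W: "fd_module A W"
    and hg: "mod_hom A (obj X 0) W h" "mod_hom A W (obj X 0) g"
    "\<And>x. x \<in> carrier (obj X 0) \<Longrightarrow> g (h x) = x" "\<And>w. w \<in> carrier W \<Longrightarrow> h (g w) = w"
  shows "in_add A (dsum2 N OP) W"
proof -
  let ?T = "dsum2 N OP" and ?X0 = "obj X 0"
  note rN = fd_moduleD[OF N] and rW = fd_moduleD[OF W]
  have T: "fd_module A ?T" by (rule A.fd_dsum2[OF N fd_OP])
  have rX0: "right_module A ?X0" by (rule bounded_complexD(2)[OF X_bounded])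
  interpret NN: right_module A N by (rule rN)
  interpret OO: right_module A OP by (rule OP_rm)
  interpret DD: right_module A D by (rule D_rm)
  interpret XX: right_module A ?X0 by (rule rX0)
  \<comment> \<open>Places the \<alpha>-th component at position s(\<alpha>) of the other
    projectives; \<open>pa\<close> takes it back by letting it act on the \<alpha>-th
    generator.\<close>
  define ia where "ia \<alpha> u = (\<zero>\<^bsub>N\<^esub>, \<lambda>i\<in>verts Q - {k}. if i = tail Q \<alpha> then snd (fst u) \<alpha> else \<zero>\<^bsub>A\<^esub>)"
    for \<alpha> and u :: "(('k, 'v, 'e) bqelt \<times> ('e \<Rightarrow> ('k, 'v, 'e) bqelt)) \<times> ('v \<Rightarrow> ('k, 'v, 'e) bqelt)"
  define pa where "pa \<alpha> t = ((\<zero>\<^bsub>Pk\<^esub>, snd t (tail Q \<alpha>) \<odot>\<^bsub>D\<^esub> eps \<alpha>), \<zero>\<^bsub>OP\<^esub>)"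
    for \<alpha> and t :: "'n \<times> ('v \<Rightarrow> ('k, 'v, 'e) bqelt)"
  define ie where "ie u = (\<zero>\<^bsub>N\<^esub>, snd u)" for u :: "(('k, 'v, 'e) bqelt \<times> ('e \<Rightarrow> ('k, 'v, 'e)
    bqelt)) \<times> ('v \<Rightarrow> ('k, 'v, 'e) bqelt)"
  define pe where "pe t = ((\<zero>\<^bsub>Pk\<^esub>, \<zero>\<^bsub>D\<^esub>), snd t)" for t :: "'n \<times> ('v \<Rightarrow> ('k, 'v, 'e) bqelt)"
  have tl: "tail Q \<alpha> \<in> verts Q - {k}" if "\<alpha> \<in> J" for \<alpha> using no_loop J_arc[OF that] by blast
  have zP: "mod_hom A M (zero_sub Pk) (\<lambda>x. \<zero>\<^bsub>Pk\<^esub>)" for M :: "(('k, 'v, 'e) bqelt, 'z) module"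
    using mod_hom_const_zero[OF zero_sub_right_module[OF Pk_rm], of M] by simp
  have iah: "mod_hom A ?X0 ?T (ia \<alpha>)" if a: "\<alpha> \<in> J" for \<alpha>
    unfolding ia_def
  proof (rule mod_hom_dsum2[OF mod_hom_const_zero[OF rN]], unfold other_proj_def, rule mod_hom_dsum)
    fix i assume i: "i \<in> verts Q - {k}"
    show "mod_hom A ?X0 (proj_at Q I i) (\<lambda>u. if i = tail Q \<alpha> then snd (fst u) \<alpha> else \<zero>\<^bsub>A\<^esub>)"
    proof (cases "i = tail Q \<alpha>")
      case True
      show ?thesis unfolding X_0 using mod_hom_comp[OF mod_hom_comp[OF mod_hom_fst mod_hom_snd]
        mod_hom_proj[OF a]] True by simp
    next
      case False
      have "right_module A (proj_at Q I i)" using i by (simp add: proj_at_eq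
        idem.cyc_proj_right_module[OF A_idem])
      from mod_hom_const_zero[OF this, of ?X0] show ?thesis using False by (simp add: proj_at_ops)
    qed
  qed
  have epsD: "eps \<alpha> \<in> carrier D" if "\<alpha> \<in> J" for \<alpha>
    using that J_arc by (auto simp: D_iff eps_def ve_mult)
  have pah: "mod_hom A ?T ?X0 (pa \<alpha>)" if a: "\<alpha> \<in> J" for \<alpha>
  proof -
    have "mod_hom A OP (proj_at Q I (tail Q \<alpha>)) (\<lambda>z. z (tail Q \<alpha>))"
      unfolding other_proj_def by (rule mod_hom_proj[OF tl[OF a]])
    moreover have "mod_hom A (proj_at Q I (tail Q \<alpha>)) (regular A) (\<lambda>x. x)"
      unfolding proj_at_eq by (rule idem.cyc_proj_incl[OF A_idem[OF J_arc(3)[OF a]]])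
    ultimately have "mod_hom A ?T (regular A) (\<lambda>t. snd t (tail Q \<alpha>))"
      using mod_hom_comp[OF mod_hom_snd mod_hom_comp] by fast
    from mod_hom_act_elem[OF D_rm epsD[OF a] this]
    have "mod_hom A ?T D (\<lambda>t. snd t (tail Q \<alpha>) \<odot>\<^bsub>D\<^esub> eps \<alpha>)" .
    then show ?thesis unfolding pa_def X_0 by (intro mod_hom_dsum2 zP mod_hom_const_zero[OF OP_rm])
  qed
  have ieh: "mod_hom A ?X0 ?T ie" unfolding ie_def X_0 by (intro mod_hom_dsum2
    mod_hom_const_zero[OF rN] mod_hom_snd)
  have peh: "mod_hom A ?T ?X0 pe" unfolding pe_def X_0 by (intro mod_hom_dsum2 zP
    mod_hom_const_zero[OF D_rm] mod_hom_snd)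
  let ?ps = "map (\<lambda>\<alpha>. (ia \<alpha>, pa \<alpha>)) arrow_list @ [(ie, pe)]"
  have hom: "mod_hom A ?X0 ?T i \<and> mod_hom A ?T ?X0 p" if "(i, p) \<in> set ?ps" for i p
    using that iah pah ieh peh arrow_list by auto
  have sum: "msum ?X0 (map (\<lambda>(i, p). p (i u)) ?ps) = u" if uX: "u \<in> carrier ?X0" for u
  proof -
    obtain y z where u: "u = ((\<zero>\<^bsub>Pk\<^esub>, y), z)" "y \<in> carrier D" "z \<in> carrier OP" using uX by (auto
      simp: X_0)
    let ?j = "\<lambda>y. ((\<zero>\<^bsub>Pk\<^esub>, y), \<zero>\<^bsub>OP\<^esub>)"
    have j: "mod_hom A D ?X0 ?j" unfolding X_0 by (intro mod_hom_dsum2 zP mod_hom_id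
      mod_hom_const_zero[OF OP_rm])
    let ?ys = "map (\<lambda>(m, \<phi>). \<phi> y \<odot>\<^bsub>D\<^esub> m) (map (\<lambda>\<alpha>. (eps \<alpha>, \<lambda>x. x \<alpha>)) arrow_list)"
    have ysD: "set ?ys \<subseteq> carrier D"
    proof -
      have "y \<alpha> \<odot>\<^bsub>D\<^esub> eps \<alpha> \<in> carrier D" if "\<alpha> \<in> J" for \<alpha>
        using u(2) that epsD by (intro DD.act_closed) (auto simp: D_iff)
      then show ?thesis using arrow_list by auto
    qed
    have "map (\<lambda>(i, p). p (i u)) (map (\<lambda>\<alpha>. (ia \<alpha>, pa \<alpha>)) arrow_list) = map ?j ?ys"
      using arrow_list tl by (auto simp: ia_def pa_def u(1))
    then have 1: "msum ?X0 (map (\<lambda>(i, p). p (i u)) (map (\<lambda>\<alpha>. (ia \<alpha>, pa \<alpha>)) arrow_list)) = ?j y"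
      using mod_hom_msum[OF j D_rm rX0 ysD] dual_basisD(3)[OF D_basis u(2)] by (simp only:)
    have pu: "pe (ie u) = ((\<zero>\<^bsub>Pk\<^esub>, \<zero>\<^bsub>D\<^esub>), z)" by (simp add: pe_def ie_def u(1))
    have c: "set (map (\<lambda>(i, p). p (i u)) (map (\<lambda>\<alpha>. (ia \<alpha>, pa \<alpha>)) arrow_list)) \<subseteq> carrier ?X0"
    proof
      fix v assume "v \<in> set (map (\<lambda>(i, p). p (i u)) (map (\<lambda>\<alpha>. (ia \<alpha>, pa \<alpha>)) arrow_list))"
      then obtain \<alpha> where a: "\<alpha> \<in> J" "v = pa \<alpha> (ia \<alpha> u)" using arrow_list by auto
      show "v \<in> carrier ?X0" unfolding a(2) by (rule mod_homD(1)[OF pah[OF a(1)] mod_homD(1)[OF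
        iah[OF a(1)] uX]])
    qed
    have c': "pe (ie u) \<in> carrier ?X0" using mod_homD(1)[OF peh mod_homD(1)[OF ieh uX]] .
    have "msum ?X0 (map (\<lambda>(i, p). p (i u)) ?ps) = ?j y \<oplus>\<^bsub>?X0\<^esub> pe (ie u)"
      unfolding map_append XX.msum_append[OF c, of "map (\<lambda>(i, p). p (i u)) [(ie, pe)]"]
      by (subst XX.msum_append[OF c]) (use c' 1 in simp_all)
    also have "\<dots> = u"
    proof -
      interpret PP: right_module A Pk by (rule Pk_rm)
      show ?thesis unfolding pu using u(2,3) by (simp add: u(1) X_0)
    qed
    finally show ?thesis .
  qed
  let ?qs = "map (\<lambda>(i, p). (\<lambda>w. i (g w), \<lambda>t. h (p t))) ?ps"
  show ?thesis
  proof (rule A.in_addI[OF W T, where ps = ?qs])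
    fix i p assume "(i, p) \<in> set ?qs"
    then obtain i' p' where ip: "(i', p') \<in> set ?ps" "i = (\<lambda>w. i' (g w))" "p = (\<lambda>t. h (p' t))" by
      auto
    show "mod_hom A W ?T i" "mod_hom A ?T W p"
      using hom[OF ip(1)] mod_hom_comp[OF hg(2)] mod_hom_comp[OF _ hg(1)] ip(2,3) by auto
  next
    fix w assume w: "w \<in> carrier W"
    have gw: "g w \<in> carrier ?X0" by (rule mod_homD(1)[OF hg(2) w])
    have c: "set (map (\<lambda>(i, p). p (i (g w))) ?ps) \<subseteq> carrier ?X0"
    proof
      fix v assume "v \<in> set (map (\<lambda>(i, p). p (i (g w))) ?ps)"
      then obtain i p where ip: "(i, p) \<in> set ?ps" "v = p (i (g w))" by auto
      have ih: "mod_hom A ?X0 ?T i" and pH: "mod_hom A ?T ?X0 p" using hom[OF ip(1)] by blast+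
      show "v \<in> carrier ?X0" unfolding ip(2) by (rule mod_homD(1)[OF pH mod_homD(1)[OF ih gw]])
    qed
    have "map (\<lambda>(i, p). p (i w)) ?qs = map h (map (\<lambda>(i, p). p (i (g w))) ?ps)" by auto
    then show "msum W (map (\<lambda>(i, p). p (i w)) ?qs) = w"
      using mod_hom_msum[OF hg(1) rX0 rW c] sum[OF gw] hg(4)[OF w] by (simp only:)
  qed
qed

lemma BB_tilting:
  "\<exists>T. is_T_BB Q I k T \<and> tilting_module A T \<and> Db_iso A X (stalk T)"
proof -
  \<comment> \<open>The cokernel of the differential, realised on lists of scalars because
    \<open>is_T_BB\<close> wants a model of \<tau>^{-1} S_k of that type.\<close>
  obtain N :: "(('k, 'v, 'e) bqelt, 'k univ) module" and \<pi> where N: "fd_module A N"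
    and \<pi>: "mod_surj A D N \<pi>" and k\<pi>: "ker D N \<pi> = f ` carrier Pk"
    using A.fd_quotient_univ[OF fd_D image_submodule[OF f_hom Pk_rm D_rm]] by blast
  note rN = fd_moduleD[OF N]
  let ?T = "dsum2 N OP"
  have T: "fd_module A ?T" by (rule A.fd_dsum2[OF N fd_OP])
  note res = resolution[OF rN \<pi> k\<pi>]
  obtain S1 S0 where S: "dual_basis A (obj X (-1)) S1" "dual_basis A (obj X 0) S0" using X_bases
    by blast
  have fX: "fd_module A (obj X n)" for n by (rule bounded_complexD(1)[OF X_bounded])
  have pd: "proj_dim_le_1 A ?T" by (rule A.proj_dim_le_1I[OF res fX fX S])
  have ext: "Ext1_zero A ?T ?T" by (rule resolution_Ext1_zero[OF Db_hom_zero_shift res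
    fd_moduleD[OF T] S]) simp
  \<comment> \<open>The degree 0 term becomes the first term of the coresolution of A in add T and
    needs a list model for that; the second term is N, which already consists of lists.\<close>
  obtain W :: "(('k, 'v, 'e) bqelt, 'k univ) module" and h g where W: "fd_module A W"
    and hg: "mod_hom A (obj X 0) W h" "mod_hom A W (obj X 0) g"
    "\<And>x. x \<in> carrier (obj X 0) \<Longrightarrow> g (h x) = x" "\<And>w. w \<in> carrier W \<Longrightarrow> h (g w) = w"
    using A.univ_model_maps[OF fX] by blast
  have W_add: "in_add A ?T W" by (rule X0_in_add[OF N W hg])
  have N_add: "in_add A ?T N"
  proof (rule A.in_addI[OF N T, where ps = "[(\<lambda>x. (x, \<zero>\<^bsub>OP\<^esub>), fst)]"])
    interpret NN: right_module A N by (rule rN)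
    have "mod_hom A N ?T (\<lambda>x. (x, \<zero>\<^bsub>OP\<^esub>))" by (intro mod_hom_dsum2 mod_hom_id
      mod_hom_const_zero[OF OP_rm])
    then show "mod_hom A N ?T i" "mod_hom A ?T N p" if "(i, p) \<in> set [(\<lambda>x. (x, \<zero>\<^bsub>OP\<^esub>), fst)]" for
      i p
      using that mod_hom_fst by auto
    show "msum N (map (\<lambda>(i, p). p (i x)) [(\<lambda>x. (x, \<zero>\<^bsub>OP\<^esub>), fst)]) = x" if "x \<in> carrier N" for x
      using that by simp
  qed
  have "short_exact A (regular A) (\<lambda>x. h ((\<zero>\<^bsub>Pk\<^esub>, f x), \<lambda>i\<in>verts Q - {k}. ve i \<otimes>\<^bsub>A\<^esub> x)) W (\<lambda>w. \<pi>
    (snd (fst (g w)))) N"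
    by (rule A.short_exact_transport[OF coresolution[OF rN \<pi> k\<pi>] mod_hom_id mod_hom_id refl refl
      hg])
  then have "tilting_module A ?T"
    unfolding tilting_module_def using T pd ext W_add N_add by blast
  moreover have "is_T_BB Q I k ?T" unfolding is_T_BB_def using is_tau_inv_coker[OF N \<pi> k\<pi>] by blast
  moreover have "Db_iso A X (stalk ?T)" by (rule resolution_Db_iso[OF res T])
  ultimately show ?thesis by blast
qed

end

theorem lemma2p9:
  fixes Q :: "('v, 'e) pre_digraph"
    and I :: "(('v, 'e) qpath \<Rightarrow> 'k::field) set"
    and k :: 'v
  assumes "fin_digraph Q"
    and "admissible Q I"
    and "k \<in> verts Q"
    and no_loop: "\<forall>\<alpha>\<in>arcs Q. \<not> (tail Q \<alpha> = k \<and> head Q \<alpha> = k)"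
    and not_isolated: "\<exists>\<alpha>\<in>arcs Q. tail Q \<alpha> = k \<or> head Q \<alpha> = k"
    and "\<not> embeds (bound_quiver_algebra Q I) (simple_at k)
              (rad (bound_quiver_algebra Q I) (proj_at Q I k))"
    and "tilting_complex (bound_quiver_algebra Q I) (T_minus Q I k)"
  shows "\<exists>T. is_T_BB Q I k T \<and> tilting_module (bound_quiver_algebra Q I) T \<and>
           Db_iso (bound_quiver_algebra Q I) (T_minus Q I k) (stalk T)"
proof -
  interpret tilted_vertex Q I k
    using assms
    by (intro tilted_vertex.intro bound_quiver_vertex.intro bound_quiver.intro
      bound_quiver_axioms.intro
        bound_quiver_vertex_axioms.intro tilted_vertex_axioms.intro)
  show ?thesis by (rule BB_tilting)
qed

end
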